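(* Let $F=\begin{pmatrix}E&X\\0&1\end{pmatrix}$ be the extended frame of a flat Egoroff metric $\sum_ih_i^2du_i^2$ on $\Omega$ with rotation coefficient matrix $\beta$. Let $z_1,z_2\in\mathbb{C}\setminus\mathbb{R}$ with $z_1\neq z_2,\bar z_2$, let $\pi_1,\pi_2$ be Hermitian projections of $\mathbb{C}^n$, let $\rho_1$ be the Hermitian projection onto $g_{z_2,\pi_2}(z_1)(\mathrm{Im}\,\pi_1)$ and $\rho_2$ the Hermitian projection onto $g_{z_1,\pi_1}(z_2)(\mathrm{Im}\,\pi_2)$ (so that $g_{z_2,\rho_2}g_{z_1,\pi_1}=g_{z_1,\rho_1}g_{z_2,\pi_2}$). For $j=1,2$ let $F_j:=g_{z_j,\pi_j}\ast F$. Then $$F_{12}:=(g_{z_2,\rho_2}g_{z_1,\pi_1})\ast F=g_{z_2,\rho_2}\ast F_1=F_{21}:=(g_{z_1,\rho_1}g_{z_2,\pi_2})\ast F=g_{z_1,\rho_1}\ast F_2 .$$ Moreover, writing $F_{12}=\begin{pmatrix}E_{12}&X_{12}\\0&1\end{pmatrix}$, $$X_{12}=g_{\bar z_2,\rho_2^\perp}g_{\bar z_1,\pi_1^\perp}\Big(X-\tfrac{\bar z_1-z_1}{\lambda-z_1}E\tilde\pi_1\eta_1-\tfrac{\bar z_2-z_2}{\lambda-z_2}E\,g_{z_1,\tilde\pi_1^\perp}\tilde\rho_2\,\eta_{12}\Big)$$ $$=g_{\bar z_1,\rho_1^\perp}g_{\bar z_2,\pi_2^\perp}\Big(X-\tfrac{\bar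 z_2-z_2}{\lambda-z_2}E\tilde\pi_2\eta_2-\tfrac{\bar z_1-z_1}{\lambda-z_1}E\,g_{z_2,\tilde\pi_2^\perp}\tilde\rho_1\,\eta_{21}\Big),$$ $$F_{12}^{-1}dF_{12}=\begin{pmatrix}\mathrm{i}\lambda\delta+[\delta,\beta_{12}]&\delta h_{12}\\0&0\end{pmatrix},$$ where $$h_{12}=h+\mathrm{i}(z_1-\bar z_1)\tilde\pi_1\eta_1+\mathrm{i}(z_2-\bar z_2)\tilde\rho_2\eta_{12}=h+\mathrm{i}(z_2-\bar z_2)\tilde\pi_2\eta_2+\mathrm{i}(z_1-\bar z_1)\tilde\rho_1\eta_{21},$$ $$\beta_{12}=\beta+\mathrm{i}(z_1-\bar z_1)\tilde\pi_{1\ast}+\mathrm{i}(z_2-\bar z_2)\tilde\rho_{2\ast}=\beta+\mathrm{i}(z_2-\bar z_2)\tilde\pi_{2\ast}+\mathrm{i}(z_1-\bar z_1)\tilde\rho_{1\ast}.$$ Here $\tilde\pi_j(u)$ is the Hermitian projection onto $E(u,z_j)^{-1}(\mathrm{Im}\,\pi_j)$, $\eta_j(u)=E(u,\bar z_j)^{-1}X(u,\bar z_j)$, and, for $j=1,2$ and $k=3-j$, $\tilde\rho_j$ is the Hermitian projection onto $g_{z_k,\tilde\pi_k}(z_j)(\mathrm{Im}\,\tilde\pi_j)$ and $$\eta_{kj}(u)=g_{\bar z_k,\tilde\pi_k^\perp}(\bar z_j)\,\eta_j+\frac{\bar z_k-z_k}{\bar z_k-\bar z_j}\,\tilde\pi_k\,\eta_k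 .$$
   Context: $\Omega\subset\mathbb{R}^n$ is a connected, simply connected open neighbourhood of $0$ with coordinates $u$. $\delta=\mathrm{diag}(du_1,\dots,du_n)$, $[\delta,\beta]=\delta\beta-\beta\delta$. For a matrix $\xi$, $\xi_\ast$ is $\xi$ with diagonal entries replaced by $0$. A flat Egoroff metric is a flat Riemannian metric $\sum_i h_i^2\,du_i^2$, with $h_i$ smooth, real-valued and nowhere zero, for which there is a function $\phi$ with $\partial\phi/\partial u_i=h_i^2$; $h=(h_1,\dots,h_n)^t$. Its rotation coefficient matrix is $\beta_{ij}=(h_i)_{u_j}/h_j$ for $i\ne j$, $\beta_{ii}=0$ (symmetric). Its extended frame is the unique $F(u,\lambda)=\begin{pmatrix}E&X\\0&1\end{pmatrix}$, holomorphic in $\lambda\in\mathbb{C}$, with $F^{-1}dF=\begin{pmatrix}\mathrm{i}\lambda\delta+[\delta,\beta]&\delta h\\0&0\end{pmatrix}$, $F(0,\lambda)=\mathrm{I}$. A Hermitian projection is a matrix $\pi$ with $\pi^2=\pi=\pi^*$; $\pi^\perp=\mathrm{I}-\pi$. For $w\in\mathbb{C}\setminus\mathbb{R}$, $g_{w,\pi}(\lambda)=\pi+\frac{\lambda-\bar w}{\lambda-w}\pi^\perp$. Dressing: $\Lambda_+(m)$ is the group of holomorphic maps $\mathbb{C}\to GL(m,\mathbb{C})$, $\Lambda_-(m)$ the group of holomorphic maps from an open disk about $\infty$ (small enough to avoid all poles in question) to $GL(m,\mathbb{C})$ with value $\mathrm{I}$ at $\infty$. For $g\in\Lambda_-(n+1)$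 and $G\in\Lambda_+(n+1)$, $g\ast G:=\tilde G$ where $gG=\tilde G\tilde g$ with $\tilde G\in\Lambda_+(n+1)$, $\tilde g\in\Lambda_-(n+1)$ (unique if it exists). Here $g_{z,\pi}\ast G$ abbreviates the action of $g_{z,\bar z,\pi'}=\begin{pmatrix}g_{z,\pi}&0\\0&\frac{\lambda-\bar z}{\lambda-z}\end{pmatrix}$, a product $g_{z_2,\rho_2}g_{z_1,\pi_1}$ acts through the product of the corresponding $(n+1)\times(n+1)$ matrices, and the action is applied to $F(u,\cdot)$ for each $u$. *)

theory Defs
  imports "HOL-Analysis.Analysis"
begin

section \<open>Smooth functions and flat Egoroff metrics\<close>

primrec Ck_on :: "nat \<Rightarrow> ('a::real_normed_vector \<Rightarrow> 'b::real_normed_vector) \<Rightarrow> 'a set \<Rightarrow> bool" where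
  "Ck_on 0 f S \<longleftrightarrow> continuous_on S f"
| "Ck_on (Suc k) f S \<longleftrightarrow>
     (\<forall>u\<in>S. f differentiable at u) \<and> (\<forall>v. Ck_on k (\<lambda>u. frechet_derivative f (at u) v) S)"

definition smooth_on :: "('a::real_normed_vector \<Rightarrow> 'b::real_normed_vector) \<Rightarrow> 'a set \<Rightarrow> bool" where
  "smooth_on f S \<longleftrightarrow> (\<forall>k. Ck_on k f S)"

definition pderiv_at :: "'n::finite \<Rightarrow> (real^'n \<Rightarrow> real) \<Rightarrow> real^'n \<Rightarrow> real" where
  "pderiv_at i f u = frechet_derivative f (at u) (axis i 1)"

text \<open>A Riemannian metric on an open subset of \<open>\<real>\<^sup>n\<close> is given by its Gram matrix \<open>g u\<close> in the
  coordinates \<open>u\<close>; it is flat if its curvature tensor \<open>R\<^sup>l\<^sub>k\<^sub>i\<^sub>j\<close> vanishes.\<close>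

definition christoffel ::
  "(real^'n \<Rightarrow> real^'n^'n) \<Rightarrow> 'n \<Rightarrow> 'n \<Rightarrow> 'n \<Rightarrow> real^'n \<Rightarrow> real" where
  "christoffel g k i j u =
     (1/2) * (\<Sum>l\<in>UNIV. matrix_inv (g u) $ k $ l *
        (pderiv_at i (\<lambda>x. g x $ j $ l) u + pderiv_at j (\<lambda>x. g x $ i $ l) u
           - pderiv_at l (\<lambda>x. g x $ i $ j) u))"

definition riemann_curvature ::
  "(real^'n \<Rightarrow> real^'n^'n) \<Rightarrow> 'n \<Rightarrow> 'n \<Rightarrow> 'n \<Rightarrow> 'n \<Rightarrow> real^'n \<Rightarrow> real" where
  "riemann_curvature g l k i j u =
     pderiv_at i (christoffel g l j k) u - pderiv_at j (christoffel g l i k) u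
     + (\<Sum>m\<in>UNIV. christoffel g l i m u * christoffel g m j k u
                    - christoffel g l j m u * christoffel g m i k u)"

definition flat_metric_on :: "(real^'n) set \<Rightarrow> (real^'n \<Rightarrow> real^'n^'n) \<Rightarrow> bool" where
  "flat_metric_on \<Omega> g \<longleftrightarrow> (\<forall>u\<in>\<Omega>. \<forall>l k i j. riemann_curvature g l k i j u = 0)"

text \<open>The metric \<open>\<Sum>\<^sub>i h\<^sub>i\<^sup>2 du\<^sub>i\<^sup>2\<close>.\<close>

definition orthogonal_metric :: "(real^'n \<Rightarrow> real^'n) \<Rightarrow> real^'n \<Rightarrow> real^'n^'n" where
  "orthogonal_metric h u = (\<chi> i j. if i = j then (h u $ i)^2 else 0)"

definition flat_egoroff_metric :: "(real^'n) set \<Rightarrow> (real^'n \<Rightarrow> real^'n) \<Rightarrow> bool" where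
  "flat_egoroff_metric \<Omega> h \<longleftrightarrow>
     (\<forall>i. smooth_on (\<lambda>u. h u $ i) \<Omega>) \<and>
     (\<forall>u\<in>\<Omega>. \<forall>i. h u $ i \<noteq> 0) \<and>
     flat_metric_on \<Omega> (orthogonal_metric h) \<and>
     (\<exists>\<phi>::real^'n \<Rightarrow> real. \<forall>u\<in>\<Omega>. \<phi> differentiable at u \<and> (\<forall>i. pderiv_at i \<phi> u = (h u $ i)^2))"

definition rotation_coeffs :: "(real^'n \<Rightarrow> real^'n) \<Rightarrow> real^'n \<Rightarrow> real^'n^'n" where
  "rotation_coeffs h u =
     (\<chi> i j. if i = j then 0 else pderiv_at j (\<lambda>x. h x $ i) u / h u $ j)"

section \<open>Complex matrices\<close>

definition cvec :: "real^'n \<Rightarrow> complex^'n" where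
  "cvec x = (\<chi> i. of_real (x $ i))"

definition cmat :: "real^'n^'m \<Rightarrow> complex^'n^'m" where
  "cmat A = (\<chi> i j. of_real (A $ i $ j))"

definition mscale :: "complex \<Rightarrow> complex^'n^'m \<Rightarrow> complex^'n^'m" (infixr \<open>*\<^sub>M\<close> 75) where
  "c *\<^sub>M A = (\<chi> i j. c * A $ i $ j)"

definition conj_transpose :: "complex^'n^'m \<Rightarrow> complex^'m^'n" where
  "conj_transpose A = (\<chi> i j. cnj (A $ j $ i))"

definition off_diag :: "complex^'n^'n \<Rightarrow> complex^'n^'n" where
  "off_diag A = (\<chi> i j. if i = j then 0 else A $ i $ j)"

abbreviation mat_range :: "complex^'n^'n \<Rightarrow> (complex^'n) set" where
  "mat_range A \<equiv> range ((*v) A)"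

text \<open>The square matrix of size \<open>n + 1\<close> with rows \<open>(A  b)\<close> and \<open>(0  d)\<close>.\<close>

definition block_mat :: "complex^'n^'n \<Rightarrow> complex^'n \<Rightarrow> complex \<Rightarrow> complex^('n + 1)^('n + 1)" where
  "block_mat A b d =
     (\<chi> i j. case i of
         Inl i' \<Rightarrow> (case j of Inl j' \<Rightarrow> A $ i' $ j' | Inr _ \<Rightarrow> b $ i')
       | Inr _ \<Rightarrow> (case j of Inl _ \<Rightarrow> 0 | Inr _ \<Rightarrow> d))"

section \<open>Extended frames\<close>

text \<open>The spectral parameter is written \<open>\<zeta>\<close>. A matrix of one-forms is represented by its value at a point \<open>u\<close> on a tangent vector \<open>v\<close>;
  in particular \<open>\<delta> = diag(du\<^sub>1, \<dots>, du\<^sub>n)\<close> maps \<open>v\<close> to \<open>diag(v\<^sub>1, \<dots>, v\<^sub>n)\<close>.\<close>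

definition delta_form :: "real^'n \<Rightarrow> complex^'n^'n" where
  "delta_form v = (\<chi> i j. if i = j then of_real (v $ i) else 0)"

definition connection_form ::
  "complex \<Rightarrow> complex^'n^'n \<Rightarrow> complex^'n \<Rightarrow> real^'n \<Rightarrow> complex^('n + 1)^('n + 1)" where
  "connection_form \<zeta> \<beta> h v =
     block_mat ((\<i> * \<zeta>) *\<^sub>M delta_form v + (delta_form v ** \<beta> - \<beta> ** delta_form v))
               (delta_form v *v h) 0"

text \<open>\<open>F\<^sup>-\<^sup>1 dF = \<omega>\<close> on \<open>S\<close>.\<close>

definition has_log_derivative_on ::
  "(real^'n \<Rightarrow> complex^'m^'m) \<Rightarrow> (real^'n \<Rightarrow> real^'n \<Rightarrow> complex^'m^'m) \<Rightarrow> (real^'n) set \<Rightarrow> bool"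
  where
  "has_log_derivative_on F \<omega> S \<longleftrightarrow>
     (\<forall>u\<in>S. invertible (F u) \<and> F differentiable at u \<and>
        (\<forall>v. matrix_inv (F u) ** frechet_derivative F (at u) v = \<omega> u v))"

definition extended_frame ::
  "(real^'n) set \<Rightarrow> (real^'n \<Rightarrow> real^'n) \<Rightarrow> (real^'n \<Rightarrow> real^'n^'n)
    \<Rightarrow> (real^'n \<Rightarrow> complex \<Rightarrow> complex^'n^'n) \<Rightarrow> (real^'n \<Rightarrow> complex \<Rightarrow> complex^'n) \<Rightarrow> bool" where
  "extended_frame \<Omega> h \<beta> E X \<longleftrightarrow>
     (\<forall>u\<in>\<Omega>. \<forall>i j. (\<lambda>\<zeta>. block_mat (E u \<zeta>) (X u \<zeta>) 1 $ i $ j) holomorphic_on UNIV) \<and>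
     (\<forall>\<zeta>. has_log_derivative_on (\<lambda>u. block_mat (E u \<zeta>) (X u \<zeta>) 1)
            (\<lambda>u. connection_form \<zeta> (cmat (\<beta> u)) (cvec (h u))) \<Omega>) \<and>
     (\<forall>\<zeta>. block_mat (E 0 \<zeta>) (X 0 \<zeta>) 1 = mat 1)"

section \<open>Hermitian projections and simple elements\<close>

definition hermitian_projection :: "complex^'n^'n \<Rightarrow> bool" where
  "hermitian_projection P \<longleftrightarrow> P ** P = P \<and> conj_transpose P = P"

definition hermitian_projection_onto :: "(complex^'n) set \<Rightarrow> complex^'n^'n" where
  "hermitian_projection_onto V = (THE P. hermitian_projection P \<and> mat_range P = V)"

text \<open>\<open>simple_elt w P \<zeta>\<close> is \<open>g\<^sub>w\<^sub>,\<^sub>\<pi>(\<zeta>)\<close>, and \<open>simple_elt_ext w P \<zeta>\<close> its extension to size \<open>n + 1\<close>;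
  they are meaningful for \<open>\<zeta> \<noteq> w\<close> only.\<close>

definition simple_elt :: "complex \<Rightarrow> complex^'n^'n \<Rightarrow> complex \<Rightarrow> complex^'n^'n" where
  "simple_elt w P \<zeta> = P + ((\<zeta> - cnj w) / (\<zeta> - w)) *\<^sub>M (mat 1 - P)"

definition simple_elt_ext ::
  "complex \<Rightarrow> complex^'n^'n \<Rightarrow> complex \<Rightarrow> complex^('n + 1)^('n + 1)" where
  "simple_elt_ext w P \<zeta> = block_mat (simple_elt w P \<zeta>) 0 ((\<zeta> - cnj w) / (\<zeta> - w))"

section \<open>Dressing\<close>

definition Lambda_plus :: "(complex \<Rightarrow> complex^'m^'m) set" where
  "Lambda_plus =
     {G. (\<forall>i j. (\<lambda>\<zeta>. G \<zeta> $ i $ j) holomorphic_on UNIV) \<and> (\<forall>\<zeta>. invertible (G \<zeta>))}"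

text \<open>Elements of the negative group are represented by functions on \<open>\<complex>\<close> of which only the values
  near \<open>\<infinity>\<close> matter; there the coordinate is \<open>\<mu> = 1 / \<zeta>\<close>, and the value at \<open>\<infinity>\<close> is \<open>I\<close>.\<close>

definition Lambda_minus :: "(complex \<Rightarrow> complex^'m^'m) set" where
  "Lambda_minus =
     {g. \<exists>r>0. \<forall>\<mu>\<in>ball 0 r. invertible (if \<mu> = 0 then mat 1 else g (inverse \<mu>)) \<and>
           (\<forall>i j. (\<lambda>\<mu>. (if \<mu> = 0 then mat 1 else g (inverse \<mu>)) $ i $ j) holomorphic_on ball 0 r)}"

definition is_dressing ::
  "(complex \<Rightarrow> complex^'m^'m) \<Rightarrow> (complex \<Rightarrow> complex^'m^'m) \<Rightarrow> (complex \<Rightarrow> complex^'m^'m) \<Rightarrow> bool"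
  where
  "is_dressing g G G' \<longleftrightarrow>
     g \<in> Lambda_minus \<and> G \<in> Lambda_plus \<and> G' \<in> Lambda_plus \<and>
     (\<exists>g'\<in>Lambda_minus. \<forall>\<^sub>F \<zeta> in at_infinity. g \<zeta> ** G \<zeta> = G' \<zeta> ** g' \<zeta>)"

definition dressable ::
  "(complex \<Rightarrow> complex^'m^'m) \<Rightarrow> (complex \<Rightarrow> complex^'m^'m) \<Rightarrow> bool" where
  "dressable g G \<longleftrightarrow> (\<exists>!G'. is_dressing g G G')"

definition dress ::
  "(complex \<Rightarrow> complex^'m^'m) \<Rightarrow> (complex \<Rightarrow> complex^'m^'m) \<Rightarrow> (complex \<Rightarrow> complex^'m^'m)" where
  "dress g G = (THE G'. is_dressing g G G')"

section \<open>Data attached to an extended frame\<close>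

definition dressed_projection ::
  "(real^'n \<Rightarrow> complex \<Rightarrow> complex^'n^'n) \<Rightarrow> complex \<Rightarrow> complex^'n^'n \<Rightarrow> real^'n \<Rightarrow> complex^'n^'n" where
  "dressed_projection E z P u =
     hermitian_projection_onto ((*v) (matrix_inv (E u z)) ` mat_range P)"

definition eta_vec ::
  "(real^'n \<Rightarrow> complex \<Rightarrow> complex^'n^'n) \<Rightarrow> (real^'n \<Rightarrow> complex \<Rightarrow> complex^'n) \<Rightarrow> complex \<Rightarrow> real^'n
     \<Rightarrow> complex^'n" where
  "eta_vec E X z u = matrix_inv (E u (cnj z)) *v X u (cnj z)"

text \<open>\<open>permuted_projection z' P' z P\<close> is the Hermitian projection onto \<open>g\<^sub>z\<^sub>'\<^sub>,\<^sub>P\<^sub>'(z)(Im P)\<close>.\<close>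

definition permuted_projection ::
  "complex \<Rightarrow> complex^'n^'n \<Rightarrow> complex \<Rightarrow> complex^'n^'n \<Rightarrow> complex^'n^'n" where
  "permuted_projection z' P' z P =
     hermitian_projection_onto ((*v) (simple_elt z' P' z) ` mat_range P)"

text \<open>\<open>eta_pair zk Pk ek zj ej\<close> is \<open>\<eta>\<^sub>k\<^sub>j\<close>, built from \<open>\<pi>\<^sub>k\<close>-tilde \<open>= Pk\<close>, \<open>\<eta>\<^sub>k = ek\<close> and \<open>\<eta>\<^sub>j = ej\<close>.\<close>

definition eta_pair ::
  "complex \<Rightarrow> complex^'n^'n \<Rightarrow> complex^'n \<Rightarrow> complex \<Rightarrow> complex^'n \<Rightarrow> complex^'n" where
  "eta_pair zk Pk ek zj ej =
     simple_elt (cnj zk) (mat 1 - Pk) (cnj zj) *v ej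
     + ((cnj zk - zk) / (cnj zk - cnj zj)) *s (Pk *v ek)"

end

theory Submission
  imports Defs "HOL-Complex_Analysis.Complex_Analysis"
begin

text \<open>
  The dressing action of a product of simple elements is computed one simple element at a time, and
  each single dressing is explicit. Let \<open>F\<close> be a frame with blocks \<open>E\<close> and \<open>X\<close>, let \<open>P(u)\<close> be the
  projection onto \<open>E(u, z)\<^sup>-\<^sup>1(Im \<pi>)\<close> and \<open>\<eta>(u) = E(u, cnj z)\<^sup>-\<^sup>1 X(u, cnj z)\<close>. The candidate for the dressed
  frame is \<open>g F g'\<^sup>-\<^sup>1\<close>, where \<open>g'\<close> is \<open>g\<close> with \<open>\<pi>\<close> replaced by \<open>P\<close> and a last column proportional to \<open>P \<eta>\<close>.
  It could have simple poles at \<open>z\<close> and \<open>cnj z\<close>, but the residues vanish by the choice of \<open>P\<close> and \<open>\<eta>\<close>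
  together with the reality condition \<open>E(u, cnj \<zeta>)\<^sup>* E(u, \<zeta>) = I\<close> (\<open>dressing_by_simple_element\<close>).
  Factorisations are unique by Liouville's theorem (\<open>is_dressing_unique\<close>), so this is the dressed frame.

  The reality condition holds for the extended frame because \<open>\<beta>\<close> is symmetric, which in turn is the
  symmetry of the second derivatives of the potential of the Egoroff metric. It makes the frame form
  at \<open>cnj \<zeta>\<close> the negative adjoint of the frame form at \<open>\<zeta>\<close>, hence \<open>E(u, \<zeta>) E(u, cnj \<zeta>)\<^sup>*\<close> constant
  (\<open>extended_frame_unitary_frame_field\<close>).

  The derivatives of \<open>P\<close> and \<open>\<eta>\<close> in \<open>u\<close> are polynomial expressions in \<open>P\<close>, \<open>\<eta>\<close> and the connection form,
  and a computation in the matrix algebra (\<open>gauge_identity\<close>) shows that the dressed frame has a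
  connection form of the same shape, with \<open>\<beta>\<close> and \<open>h\<close> changed by multiples of the off-diagonal part
  of \<open>P\<close> and of \<open>P \<eta>\<close>. This applies for \<open>\<zeta>\<close> different from \<open>z\<close> and \<open>cnj z\<close>. At these two values the dressed frame
  is only given by removal of a singularity, and differentiability in \<open>u\<close> follows by estimating
  Taylor remainders on a circle and applying the maximum modulus principle
  (\<open>has_derivative_at_exceptional_parameter\<close>). Since the dressed frame has all the properties used
  of the original one (\<open>dressing_frame_field\<close>), a second simple element can be applied, and its data
  expressed through \<open>E\<close> and \<open>X\<close> are the permuted projection and the combined vector of the theorem
  (\<open>second_dressing_data\<close>).

  Finally \<open>g\<^sub>z\<^sub>2\<^sub>,\<^sub>\<rho>\<^sub>2 g\<^sub>z\<^sub>1\<^sub>,\<^sub>\<pi>\<^sub>1\<close> and \<open>g\<^sub>z\<^sub>1\<^sub>,\<^sub>\<rho>\<^sub>1 g\<^sub>z\<^sub>2\<^sub>,\<^sub>\<pi>\<^sub>2\<close> agree: both are, up to a scalar, monic quadratic matrix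
  polynomials in \<open>\<zeta>\<close>, and conjugation with one matrix turns the right linear factors into the left ones
  (\<open>simple_elt_permutability\<close>). Hence the two orders of dressing lead to the same frame, and
  comparing the two resulting expressions gives the second form of each formula.
\<close>

(* the dollar sign denotes vector components throughout *)
unbundle no fps_syntax

section \<open>Algebra of complex matrices\<close>

lemma matrix_diff_ldistrib: "(A::complex^'m^'n) ** (B - C) = A ** B - A ** C"
  by (vector matrix_matrix_mult_def sum_subtractf[symmetric] algebra_simps)

lemma matrix_diff_rdistrib: "(A - B) ** (C::complex^'m^'n) = A ** C - B ** C"
  by (vector matrix_matrix_mult_def sum_subtractf[symmetric] algebra_simps)

lemma matrix_add_rdistrib: "(A + B) ** (C::complex^'m^'n) = A ** C + B ** C"
  by (vector matrix_matrix_mult_def sum.distrib[symmetric] algebra_simps)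

lemma matrix_uminus_mult: "(- A) ** (C::complex^'m^'n) = - (A ** C)"
  "A ** (- (C::complex^'m^'n)) = - (A ** C)"
  by (vector matrix_matrix_mult_def sum_negf[symmetric])+

lemma matrix_mult_zero [simp]: "0 ** (A::complex^'m^'n) = 0" "(A::complex^'m^'n) ** 0 = 0"
  by (vector matrix_matrix_mult_def)+

lemma mscale_nth [simp]: "(c *\<^sub>M A) $ i $ j = c * A $ i $ j"
  by (simp add: mscale_def)

lemma mscale_mult: "(c *\<^sub>M A) ** B = c *\<^sub>M (A ** B)" "A ** (c *\<^sub>M B) = c *\<^sub>M (A ** B)"
  by (vector matrix_matrix_mult_def mscale_def sum_distrib_left ac_simps)+

lemma mscale_mscale: "a *\<^sub>M (b *\<^sub>M A) = (a * b) *\<^sub>M A"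
  by (vector mscale_def ac_simps)

lemma mscale_zero [simp]: "c *\<^sub>M 0 = 0" "0 *\<^sub>M A = 0" "1 *\<^sub>M A = A"
  by (vector mscale_def)+

lemma mscale_distrib:
  "c *\<^sub>M (A + B) = c *\<^sub>M A + c *\<^sub>M B" "c *\<^sub>M (A - B) = c *\<^sub>M A - c *\<^sub>M B" "c *\<^sub>M (- A) = - (c *\<^sub>M A)"
  by (vector mscale_def algebra_simps)+

lemma mscale_cancel: "c \<noteq> 0 \<Longrightarrow> c *\<^sub>M A = c *\<^sub>M B \<Longrightarrow> A = B"
  by (simp add: vec_eq_iff)

lemma mscale_vector: "(c *\<^sub>M A) *v x = c *s (A *v x)"
  by (simp add: vec_eq_iff matrix_vector_mult_def sum_distrib_left ac_simps)

lemma matrix_vector_uminus: "(- A) *v x = - (A *v (x::complex^'n))" "A *v (- x) = - (A *v x)"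
  by (simp_all add: vec_eq_iff matrix_vector_mult_def sum_negf)

lemma conj_transpose_nth [simp]: "conj_transpose A $ i $ j = cnj (A $ j $ i)"
  by (simp add: conj_transpose_def)

lemma conj_transpose_involutive [simp]: "conj_transpose (conj_transpose A) = A"
  by (simp add: vec_eq_iff)

lemma conj_transpose_mult: "conj_transpose (A ** B) = conj_transpose B ** conj_transpose A"
  by (simp add: vec_eq_iff matrix_matrix_mult_def ac_simps)

lemma conj_transpose_linear:
  "conj_transpose (A + B) = conj_transpose A + conj_transpose B"
  "conj_transpose (A - B) = conj_transpose A - conj_transpose B"
  "conj_transpose (- A) = - conj_transpose A"
  "conj_transpose (c *\<^sub>M A) = cnj c *\<^sub>M conj_transpose A"
  "conj_transpose 0 = 0"
  by (simp_all add: vec_eq_iff)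

lemma conj_transpose_mat_1 [simp]: "conj_transpose (mat 1) = mat 1"
  by (simp add: vec_eq_iff mat_def)

lemmas matrix_expand =
  matrix_add_ldistrib matrix_add_rdistrib matrix_diff_ldistrib matrix_diff_rdistrib
  matrix_uminus_mult mscale_mult mscale_mscale mscale_distrib

lemmas matrix_vector_expand =
  matrix_vector_right_distrib matrix_vector_mult_add_rdistrib matrix_vector_mult_diff_distrib
  matrix_vector_mult_diff_rdistrib mscale_vector vector_scalar_commute matrix_vector_mul_assoc
  vector_add_ldistrib vector_ssub_ldistrib vector_smult_assoc matrix_vector_uminus

lemma matrix_inv_eqI:
  fixes A B :: "complex^'n^'n"
  assumes "A ** B = mat 1"
  shows "matrix_inv A = B"
proof -
  have BA: "B ** A = mat 1" using assms matrix_left_right_inverse by blast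
  have "A ** matrix_inv A = mat 1 \<and> matrix_inv A ** A = mat 1"
    unfolding matrix_inv_def by (rule someI2[of _ B]) (use assms BA in auto)
  then have "B ** (A ** matrix_inv A) = B" by simp
  then show ?thesis by (simp add: matrix_mul_assoc BA)
qed

lemma matrix_inv_mult:
  fixes A :: "complex^'n^'n"
  assumes "invertible A"
  shows "A ** matrix_inv A = mat 1" "matrix_inv A ** A = mat 1"
  using assms matrix_inv_eqI unfolding invertible_def by metis+

lemma invertible_cancel_right:
  fixes A B D :: "complex^'n^'n"
  assumes "invertible D" "A ** D = B ** D"
  shows "A = B"
proof -
  have "A ** (D ** matrix_inv D) = B ** (D ** matrix_inv D)"
    by (simp only: matrix_mul_assoc assms(2))
  then show ?thesis by (simp add: matrix_inv_mult assms(1))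
qed

lemma invertible_ker:
  fixes A :: "complex^'n^'n"
  assumes "invertible A" "A *v x = 0"
  shows "x = 0"
proof -
  have "matrix_inv A *v (A *v x) = 0" using assms(2) by simp
  then show ?thesis by (simp add: matrix_vector_mul_assoc matrix_inv_mult assms(1))
qed

text \<open>Cramer's rule makes the dependence of the inverse on the entries explicit; it is what
  carries holomorphy and limits over from a matrix function to its inverse.\<close>

lemma matrix_inv_cramer:
  fixes A :: "complex^'n^'n"
  assumes "invertible A"
  shows "matrix_inv A $ k $ l = det (\<chi> i j. if j = k then axis l 1 $ i else A $ i $ j) / det A"
proof -
  have "A *v (matrix_inv A *v axis l 1) = axis l 1"
    by (simp add: matrix_vector_mul_assoc matrix_inv_mult assms)
  moreover have "det A \<noteq> 0" using assms invertible_det_nz by blast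
  ultimately have "matrix_inv A *v axis l 1
      = (\<chi> k. det (\<chi> i j. if j = k then axis l 1 $ i else A $ i $ j) / det A)"
    using cramer by blast
  moreover have "(matrix_inv A *v axis l 1) $ k = matrix_inv A $ k $ l"
    by (simp add: matrix_vector_mult_def axis_def if_distrib cong: if_cong)
  ultimately show ?thesis by simp
qed

subsection \<open>Block matrices\<close>

lemma sum_UNIV_plus_1: "(\<Sum>i\<in>(UNIV::('n::finite + 1) set). f i) = (\<Sum>i\<in>UNIV. f (Inl i)) + f (Inr 1)"
proof -
  have "(UNIV::1 set) = {1}" by auto
  then show ?thesis
    by (simp add: sum.Plus UNIV_Plus_UNIV[symmetric] del: UNIV_Plus_UNIV)
qed

lemma block_mat_nth [simp]:
  "block_mat A b d $ Inl i $ Inl j = A $ i $ j" "block_mat A b d $ Inl i $ Inr k = b $ i"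
  "block_mat A b d $ Inr k $ Inl j = 0" "block_mat A b d $ Inr k $ Inr l = d"
  by (simp_all add: block_mat_def)

lemma all_plus_iff: "(\<forall>i::'n + 1. P i) \<longleftrightarrow> (\<forall>i. P (Inl i)) \<and> P (Inr 1)"
  by (metis num1_eq_iff sum.exhaust)

lemma block_mat_eq_iff: "block_mat A b d = block_mat A' b' d' \<longleftrightarrow> A = A' \<and> b = b' \<and> d = d'"
  by (auto simp: vec_eq_iff all_plus_iff)

lemma block_mat_mult:
  "block_mat A b d ** block_mat A' b' d' = block_mat (A ** A') (A *v b' + d' *s b) (d * d')"
  by (simp add: vec_eq_iff all_plus_iff matrix_matrix_mult_def sum_UNIV_plus_1
      matrix_vector_mult_def ac_simps)

lemma block_mat_add: "block_mat A b d + block_mat A' b' d' = block_mat (A + A') (b + b') (d + d')"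
  by (simp add: vec_eq_iff all_plus_iff)

lemma block_mat_mat_1: "block_mat (mat 1) 0 1 = mat 1"
  by (simp add: vec_eq_iff all_plus_iff mat_def)

lemma invertible_block_mat:
  assumes "invertible A" "d \<noteq> 0"
  shows "invertible (block_mat A b d)"
proof -
  have "block_mat A b d ** block_mat (matrix_inv A) (- inverse d *s (matrix_inv A *v b)) (inverse d)
      = mat 1"
    using assms
    by (simp add: block_mat_mult matrix_inv_mult block_mat_mat_1[symmetric] block_mat_eq_iff
        matrix_vector_expand vector_smult_lneg)
  then show ?thesis
    by (meson invertible_right_inverse)
qed

subsection \<open>Hermitian projections\<close>

lemma hermitian_projectionD:
  assumes "hermitian_projection P"
  shows "P ** P = P" "conj_transpose P = P" "P ** (mat 1 - P) = 0" "(mat 1 - P) ** P = 0"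
    "(mat 1 - P) ** (mat 1 - P) = mat 1 - P"
  using assms by (auto simp: hermitian_projection_def matrix_expand)

lemma mat_range_subset_iff:
  fixes P A :: "complex^'n^'n"
  assumes "P ** P = P"
  shows "mat_range A \<subseteq> mat_range P \<longleftrightarrow> P ** A = A"
proof
  assume sub: "mat_range A \<subseteq> mat_range P"
  have "P *v (A *v x) = A *v x" for x
  proof -
    obtain y where "A *v x = P *v y" using sub by auto
    then show ?thesis by (metis assms matrix_vector_mul_assoc)
  qed
  then show "P ** A = A" by (metis matrix_eq matrix_vector_mul_assoc)
next
  assume "P ** A = A"
  then show "mat_range A \<subseteq> mat_range P" by (metis image_subsetI matrix_vector_mul_assoc rangeI)
qed

lemma hermitian_projection_unique:
  assumes "hermitian_projection P" "hermitian_projection P'" "mat_range P = mat_range P'"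
  shows "P = P'"
proof -
  have 1: "P ** P' = P'" "P' ** P = P"
    using assms mat_range_subset_iff[of P P'] mat_range_subset_iff[of P' P]
    by (auto simp: hermitian_projection_def)
  have "P' = conj_transpose (P ** P')" using assms 1 by (simp add: hermitian_projection_def)
  also have "\<dots> = P' ** P" using assms by (simp add: hermitian_projection_def conj_transpose_mult)
  finally show ?thesis using 1 by simp
qed

lemma conj_transpose_self_eq_0:
  assumes "conj_transpose A ** A = 0"
  shows "A = 0"
proof -
  have "A $ i $ j = 0" for i j
  proof -
    have "(\<Sum>k\<in>UNIV. cnj (A $ k $ j) * A $ k $ j) = (conj_transpose A ** A) $ j $ j"
      by (simp add: matrix_matrix_mult_def)
    also have "\<dots> = 0" using assms by simp
    finally have "complex_of_real (\<Sum>k\<in>UNIV. (cmod (A $ k $ j))\<^sup>2) = 0"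
      by (simp add: complex_norm_square mult.commute del: of_real_power)
    then have "(\<Sum>k\<in>UNIV. (cmod (A $ k $ j))\<^sup>2) = 0" using of_real_eq_0_iff by blast
    then show ?thesis by (simp add: sum_nonneg_eq_0_iff)
  qed
  then show ?thesis by (simp add: vec_eq_iff)
qed

text \<open>For an idempotent \<open>Q\<close> the matrix \<open>S = Q + Q\<^sup>* - I\<close> is invertible, since \<open>S x = 0\<close> gives
  \<open>Q x = 0\<close> and \<open>x = Q\<^sup>* x\<close>, two orthogonal conditions; it satisfies \<open>Q S = S Q\<^sup>*\<close> and
  \<open>S Q = Q\<^sup>* S\<close>, which make \<open>Q S\<^sup>-\<^sup>1\<close> the Hermitian projection onto the range of \<open>Q\<close>.\<close>

lemma hermitian_projection_exists:
  fixes Q :: "complex^'n^'n"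
  assumes Q: "Q ** Q = Q"
  obtains P where "hermitian_projection P" "mat_range P = mat_range Q"
proof -
  define R where "R = conj_transpose Q"
  define S where "S = Q + R - mat 1"
  have R: "R ** R = R" unfolding R_def by (metis Q conj_transpose_mult)
  have QS: "Q ** S = S ** R" and SQ: "S ** Q = R ** S"
    by (simp_all add: S_def matrix_expand Q R)
  have Sh: "conj_transpose S = S" by (simp add: S_def R_def conj_transpose_linear)
  have "\<exists>B. B ** S = mat 1"
  proof (rule matrix_left_invertible_ker[THEN iffD2], intro allI impI)
    fix x assume x: "S *v x = 0"
    \<comment> \<open>\<open>M\<close> has all columns equal to \<open>x\<close>; norms of vectors become products \<open>M\<^sup>* M\<close> of matrices\<close>
    define M :: "complex^'n^'n" where "M = (\<chi> i j. x $ i)"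
    have SM: "S ** M = 0"
      using x by (simp add: M_def vec_eq_iff matrix_matrix_mult_def matrix_vector_mult_def)
    have QM: "Q ** M = 0"
    proof -
      have "R ** (Q ** M) = R ** (S ** M)"
        by (simp add: S_def matrix_expand R matrix_mul_assoc)
      then have "R ** (Q ** M) = 0" by (simp add: SM)
      then have "conj_transpose (Q ** M) ** (Q ** M) = 0"
        by (metis R_def conj_transpose_mult matrix_mul_assoc matrix_mult_zero(2))
      then show ?thesis by (rule conj_transpose_self_eq_0)
    qed
    have RM: "R ** M = M" using SM QM by (simp add: S_def matrix_expand)
    have "conj_transpose M ** M = conj_transpose M ** (R ** M)" by (simp add: RM)
    also have "\<dots> = conj_transpose (Q ** M) ** M"
      by (simp add: conj_transpose_mult R_def matrix_mul_assoc)
    finally have "M = 0" using conj_transpose_self_eq_0 QM by (simp add: conj_transpose_linear)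
    then show "x = 0" by (simp add: M_def vec_eq_iff)
  qed
  then obtain B where BS: "B ** S = mat 1" by blast
  then have SB: "S ** B = mat 1" using matrix_left_right_inverse by blast
  define P where "P = Q ** B"
  have BQ: "B ** Q = R ** B"
  proof -
    have "B ** (Q ** S) ** B = B ** (S ** R) ** B" by (simp add: QS)
    then show ?thesis by (metis BS SB matrix_mul_assoc matrix_mul_lid matrix_mul_rid)
  qed
  have Bh: "conj_transpose B = B"
    by (metis BS SB Sh conj_transpose_mult conj_transpose_mat_1 matrix_mul_assoc matrix_mul_lid
        matrix_mul_rid)
  have "P = B ** R"
  proof -
    have "B ** (S ** Q) ** B = B ** (R ** S) ** B" by (simp add: SQ)
    then show ?thesis unfolding P_def
      by (metis BS SB matrix_mul_assoc matrix_mul_lid matrix_mul_rid)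
  qed
  then have h: "conj_transpose P = P"
    by (simp add: conj_transpose_mult Bh) (simp add: R_def P_def)
  have QP: "Q ** P = P" by (simp add: P_def matrix_mul_assoc Q)
  have PS: "P ** S = Q" unfolding P_def by (metis BS matrix_mul_assoc matrix_mul_rid)
  have PQ: "P ** Q = Q"
  proof -
    have "P ** Q = (B ** R) ** Q" by (simp add: \<open>P = B ** R\<close>)
    also have "R ** Q = S ** Q" by (simp add: S_def matrix_expand Q)
    then have "(B ** R) ** Q = B ** S ** Q" by (metis matrix_mul_assoc)
    finally show ?thesis by (simp add: BS)
  qed
  have "P ** P = P" by (metis P_def PQ matrix_mul_assoc)
  moreover from this have "mat_range P = mat_range Q"
    using mat_range_subset_iff[of P Q] mat_range_subset_iff[of Q P] PQ QP Q by blast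
  ultimately show thesis using that h by (simp add: hermitian_projection_def)
qed

text \<open>The idempotent \<open>M P N\<close> has range \<open>M(Im P)\<close>, so the Hermitian projection onto this space exists.
  The two identities say that \<open>M\<close> maps the range of \<open>P\<close> into that of \<open>R\<close> and that \<open>N\<close> maps it back; in
  this form they serve as vanishing conditions for residues.\<close>

lemma hermitian_projection_onto_image:
  fixes M N :: "complex^'n^'n"
  assumes P: "hermitian_projection P" and MN: "M ** N = mat 1"
  defines "R \<equiv> hermitian_projection_onto ((*v) M ` mat_range P)"
  shows "hermitian_projection R" "R ** M ** P = M ** P" "P ** N ** R = N ** R"
    "mat_range R = (*v) M ` mat_range P"
proof -
  have NM: "N ** M = mat 1" using MN matrix_left_right_inverse by blast
  let ?Q = "M ** P ** N"
  have "?Q ** ?Q = M ** P ** (N ** M) ** P ** N" by (simp only: matrix_mul_assoc)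
  also have "\<dots> = M ** (P ** P) ** N" by (simp add: NM matrix_mul_assoc)
  finally have Q: "?Q ** ?Q = ?Q" by (simp add: hermitian_projectionD[OF P])
  have range: "(*v) M ` mat_range P = mat_range ?Q"
  proof -
    have "M *v (P *v x) \<in> mat_range ?Q" for x
    proof -
      have "?Q *v (M *v x) = M *v (P *v ((N ** M) *v x))"
        by (simp add: matrix_vector_mul_assoc matrix_mul_assoc)
      then show ?thesis by (metis NM matrix_vector_mul_lid rangeI)
    qed
    moreover have "?Q *v x = M *v (P *v (N *v x))" for x
      by (simp add: matrix_vector_mul_assoc matrix_mul_assoc)
    ultimately show ?thesis by auto
  qed
  obtain P' where P': "hermitian_projection P'" "mat_range P' = mat_range ?Q"
    using hermitian_projection_exists[OF Q] .
  have "(THE S. hermitian_projection S \<and> mat_range S = mat_range ?Q) = P'"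
  proof (rule the_equality)
    show "hermitian_projection P' \<and> mat_range P' = mat_range ?Q" using P' by simp
    show "S = P'" if "hermitian_projection S \<and> mat_range S = mat_range ?Q" for S
      by (rule hermitian_projection_unique) (use that P' in simp_all)
  qed
  then have "R = P'" by (simp only: R_def hermitian_projection_onto_def range)
  then have R: "hermitian_projection R" "mat_range R = mat_range ?Q" using P' by auto
  show "hermitian_projection R" by fact
  show "mat_range R = (*v) M ` mat_range P" using R(2) range by simp
  have "R ** ?Q = ?Q" using R mat_range_subset_iff[of R ?Q] by (auto simp: hermitian_projection_def)
  then have "R ** (?Q ** M) = ?Q ** M" by (simp add: matrix_mul_assoc)
  moreover have "?Q ** M = M ** P"
    by (simp add: NM matrix_mul_assoc[symmetric])
  ultimately show "R ** M ** P = M ** P" by (simp add: matrix_mul_assoc)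
  have "?Q ** R = R" using R mat_range_subset_iff[of ?Q R] Q by auto
  then have "N ** (?Q ** R) = N ** R" by simp
  then show "P ** N ** R = N ** R" by (simp add: matrix_mul_assoc NM)
qed

section \<open>Simple elements and their permutability\<close>

lemma not_real_cnj_neq: "z \<notin> \<real> \<Longrightarrow> z \<noteq> cnj z" "z \<notin> \<real> \<Longrightarrow> cnj z \<noteq> z" "z \<notin> \<real> \<Longrightarrow> z \<noteq> 0"
  using Reals_cnj_iff by auto

lemma simple_elt_inverse:
  assumes "hermitian_projection P" "\<zeta> \<noteq> w" "\<zeta> \<noteq> cnj w"
  shows "simple_elt w P \<zeta> ** simple_elt (cnj w) P \<zeta> = mat 1"
  using assms(2,3) hermitian_projectionD[OF assms(1)]
  by (simp add: simple_elt_def matrix_add_ldistrib matrix_add_rdistrib mscale_mult mscale_mscale)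

lemma conj_transpose_simple_elt:
  assumes "hermitian_projection P"
  shows "conj_transpose (simple_elt w P (cnj \<zeta>)) = simple_elt (cnj w) P \<zeta>"
  using hermitian_projectionD[OF assms] by (simp add: simple_elt_def conj_transpose_linear)

lemma simple_elt_complement:
  "\<zeta> \<noteq> w \<Longrightarrow> \<zeta> \<noteq> cnj w \<Longrightarrow>
    simple_elt (cnj w) (mat 1 - P) \<zeta> = ((\<zeta> - w) / (\<zeta> - cnj w)) *\<^sub>M simple_elt w P \<zeta>"
  by (simp add: simple_elt_def mscale_distrib mscale_mscale add.commute)

lemma invertible_simple_elt:
  assumes "hermitian_projection P" "\<zeta> \<noteq> w" "\<zeta> \<noteq> cnj w"
  shows "invertible (simple_elt w P \<zeta>)"
  using simple_elt_inverse[OF assms] invertible_right_inverse by blast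

text \<open>The last identity is the adjoint of the statement that the inverse of \<open>simple_elt z' P' z\<close> maps
  the range of \<open>R\<close> into the range of \<open>P\<close>: this inverse is the adjoint of \<open>simple_elt z' P' (cnj z)\<close>.\<close>

lemma permuted_projection_props:
  assumes P: "hermitian_projection P" "hermitian_projection P'" and z: "z \<noteq> z'" "z \<noteq> cnj z'"
  defines "R \<equiv> permuted_projection z' P' z P"
  shows "hermitian_projection R"
    and "R ** simple_elt z' P' z ** P = simple_elt z' P' z ** P"
    and "R ** simple_elt z' P' (cnj z) ** P = R ** simple_elt z' P' (cnj z)"
proof -
  note inv = simple_elt_inverse[OF P(2) z]
  note img = hermitian_projection_onto_image[OF P(1) inv, folded permuted_projection_def, folded R_def]
  show "hermitian_projection R" "R ** simple_elt z' P' z ** P = simple_elt z' P' z ** P"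
    using img by auto
  have "conj_transpose (P ** simple_elt (cnj z') P' z ** R) = conj_transpose (simple_elt (cnj z') P' z ** R)"
    using img by simp
  then show "R ** simple_elt z' P' (cnj z) ** P = R ** simple_elt z' P' (cnj z)"
    using conj_transpose_simple_elt[OF P(2), of "cnj z'" "cnj z"] hermitian_projectionD[OF P(1)]
      hermitian_projectionD[OF img(1)]
    by (simp add: conj_transpose_mult matrix_mul_assoc)
qed

text \<open>The normal matrix with eigenvalue \<open>z\<close> on the range of \<open>P\<close> and \<open>cnj z\<close> on its orthogonal
  complement. Up to the factor \<open>\<zeta> - z\<close> the simple element is the linear matrix polynomial
  \<open>\<zeta> - spectral_mat z P\<close>, and permutability becomes a statement on factorisations of a quadratic
  matrix polynomial.\<close>

definition spectral_mat :: "complex \<Rightarrow> complex^'n^'n \<Rightarrow> complex^'n^'n" where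
  "spectral_mat z P = z *\<^sub>M P + cnj z *\<^sub>M (mat 1 - P)"

lemma simple_elt_spectral_mat:
  "\<zeta> \<noteq> z \<Longrightarrow> (\<zeta> - z) *\<^sub>M simple_elt z P \<zeta> = \<zeta> *\<^sub>M mat 1 - spectral_mat z P"
  by (simp add: simple_elt_def spectral_mat_def mscale_distrib mscale_mscale)
    (simp add: vec_eq_iff algebra_simps)

text \<open>On the range of \<open>P\<close> the difference of the two spectral matrices is a multiple of
  \<open>simple_elt z' P' z\<close>, and on the complement a multiple of \<open>simple_elt z' P' (cnj z)\<close>, which is
  the inverse adjoint of the former. So it maps the range of \<open>P\<close> into the range of \<open>R\<close> and
  its complement into the complement.\<close>

lemma permuted_projection_intertwines:
  assumes P: "hermitian_projection P" "hermitian_projection P'" and z: "z \<noteq> z'" "z \<noteq> cnj z'"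
  defines "R \<equiv> permuted_projection z' P' z P" and "D \<equiv> spectral_mat z' P' - spectral_mat z P"
  shows "R ** D = D ** P"
proof -
  note R = permuted_projection_props[OF P z, folded R_def]
  note pp = hermitian_projectionD[OF P(1)]
  have NP: "spectral_mat z P ** P = z *\<^sub>M P" "spectral_mat z P ** (mat 1 - P) = cnj z *\<^sub>M (mat 1 - P)"
    by (simp_all add: spectral_mat_def matrix_add_rdistrib mscale_mult pp)
  have z2: "cnj z \<noteq> z'" using z by auto
  have e1: "z *\<^sub>M mat 1 - spectral_mat z' P' = (z - z') *\<^sub>M simple_elt z' P' z"
    using simple_elt_spectral_mat[OF z(1), of P'] by simp
  have e2: "cnj z *\<^sub>M mat 1 - spectral_mat z' P' = (cnj z - z') *\<^sub>M simple_elt z' P' (cnj z)"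
    using simple_elt_spectral_mat[OF z2, of P'] by simp
  have "D ** P = - ((z *\<^sub>M mat 1 - spectral_mat z' P') ** P)"
    by (simp add: D_def matrix_diff_rdistrib NP mscale_mult)
  then have DP: "D ** P = - ((z - z') *\<^sub>M (simple_elt z' P' z ** P))"
    by (simp only: e1 mscale_mult)
  have "D ** (mat 1 - P) = - ((cnj z *\<^sub>M mat 1 - spectral_mat z' P') ** (mat 1 - P))"
    by (simp only: D_def matrix_diff_rdistrib NP mscale_mult matrix_mul_lid) simp
  then have DP': "D ** (mat 1 - P) = - ((cnj z - z') *\<^sub>M (simple_elt z' P' (cnj z) ** (mat 1 - P)))"
    by (simp only: e2 mscale_mult)
  have a: "R ** (D ** P) = D ** P"
    unfolding DP using R(2) by (simp add: matrix_uminus_mult mscale_mult matrix_mul_assoc)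
  have "R ** (simple_elt z' P' (cnj z) ** (mat 1 - P)) = 0"
    using R(3) by (simp add: matrix_diff_ldistrib matrix_mul_assoc)
  then have b: "R ** (D ** (mat 1 - P)) = 0"
    unfolding DP' by (simp add: matrix_uminus_mult mscale_mult mscale_distrib)
  have "R ** D = R ** (D ** P) + R ** (D ** (mat 1 - P))"
    by (simp add: matrix_diff_ldistrib matrix_mul_assoc)
  then show ?thesis using a b by simp
qed

lemma invertible_spectral_mat_shift:
  assumes "hermitian_projection P" "\<zeta> \<noteq> z" "\<zeta> \<noteq> cnj z" "spectral_mat z P *v x = \<zeta> *s x"
  shows "x = 0"
proof -
  have "(\<zeta> *\<^sub>M mat 1 - spectral_mat z P) *v x = 0"
    using assms(4) by (simp add: matrix_vector_expand)
  then have "(\<zeta> - z) *s (simple_elt z P \<zeta> *v x) = 0"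
    using simple_elt_spectral_mat[OF assms(2), of P] by (metis mscale_vector)
  then have "simple_elt z P \<zeta> *v x = 0" using assms(2) by simp
  then show ?thesis by (rule invertible_ker[OF invertible_simple_elt[OF assms(1-3)]])
qed

text \<open>A vector in the kernel of the difference \<open>D\<close> has both its components in the range of \<open>P\<close> and in the
  complement in the kernel, because \<open>R D = D P\<close>. On either component \<open>D y = 0\<close> makes \<open>z\<close> or \<open>cnj z\<close> an
  eigenvalue of the spectral matrix of \<open>P'\<close>, whose eigenvalues are \<open>z'\<close> and \<open>cnj z'\<close>.\<close>

lemma invertible_spectral_mat_diff:
  assumes P: "hermitian_projection P" "hermitian_projection P'" and z: "z \<noteq> z'" "z \<noteq> cnj z'"
  shows "invertible (spectral_mat z' P' - spectral_mat z P)"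
proof -
  let ?D = "spectral_mat z' P' - spectral_mat z P"
  let ?R = "permuted_projection z' P' z P"
  note pp = hermitian_projectionD[OF P(1)]
  have inter: "?R ** ?D = ?D ** P" by (rule permuted_projection_intertwines[OF P z])
  have zero: "y = 0" if "?D *v y = 0" "spectral_mat z P *v y = w *s y" "w \<noteq> z'" "w \<noteq> cnj z'" for y w
  proof -
    have "spectral_mat z' P' *v y = w *s y"
      using that(1,2) by (simp only: matrix_vector_mult_diff_rdistrib right_minus_eq)
    then show ?thesis by (rule invertible_spectral_mat_shift[OF P(2) that(3,4)])
  qed
  have "x = 0" if "?D *v x = 0" for x
  proof -
    have "?D *v (P *v x) = ?R *v (?D *v x)" by (simp only: matrix_vector_mul_assoc inter)
    then have D1: "?D *v (P *v x) = 0" using that by (simp only: matrix_vector_mult_0_right)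
    have "?D *v ((mat 1 - P) *v x) = ?D *v x - ?D *v (P *v x)"
      by (simp only: matrix_vector_mult_diff_rdistrib[of "mat 1" P] matrix_vector_mult_diff_distrib
          matrix_vector_mul_lid)
    then have D2: "?D *v ((mat 1 - P) *v x) = 0" by (simp only: that D1 diff_self)
    have "spectral_mat z P *v (P *v x) = z *s (P *v x)"
      by (simp add: matrix_vector_mul_assoc spectral_mat_def matrix_add_rdistrib mscale_mult pp
          mscale_vector)
    then have "P *v x = 0" by (rule zero[OF D1 _ z])
    moreover have "spectral_mat z P *v ((mat 1 - P) *v x) = cnj z *s ((mat 1 - P) *v x)"
      by (simp only: matrix_vector_mul_assoc spectral_mat_def matrix_add_rdistrib mscale_mult pp)
        (simp add: mscale_vector)
    then have "(mat 1 - P) *v x = 0" by (rule zero[OF D2]) (use z in auto)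
    ultimately show "x = 0" by (simp add: matrix_vector_mult_diff_rdistrib)
  qed
  then show ?thesis
    by (simp only: invertible_left_inverse matrix_left_invertible_ker) simp
qed

text \<open>Write \<open>N\<^sub>j\<close> for the spectral matrix of \<open>P\<^sub>j\<close> and \<open>D = N\<^sub>2 - N\<^sub>1\<close>. The spectral matrices \<open>N\<^sub>j'\<close>
  of the permuted projections are \<open>D N\<^sub>j D\<^sup>-\<^sup>1\<close>, so \<open>N\<^sub>2' - N\<^sub>1' = D\<close>; the equality of the products
  \<open>N\<^sub>2' N\<^sub>1\<close> and \<open>N\<^sub>1' N\<^sub>2\<close> is then a one line computation.\<close>

theorem simple_elt_permutability:
  assumes P: "hermitian_projection P1" "hermitian_projection P2"
    and z: "z1 \<noteq> z2" "z1 \<noteq> cnj z2" and \<zeta>: "\<zeta> \<notin> {z1, z2}"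
  defines "R1 \<equiv> permuted_projection z2 P2 z1 P1" and "R2 \<equiv> permuted_projection z1 P1 z2 P2"
  shows "simple_elt z2 R2 \<zeta> ** simple_elt z1 P1 \<zeta> = simple_elt z1 R1 \<zeta> ** simple_elt z2 P2 \<zeta>"
proof -
  define N1 where "N1 = spectral_mat z1 P1"
  define N2 where "N2 = spectral_mat z2 P2"
  define M1 where "M1 = spectral_mat z1 R1"
  define M2 where "M2 = spectral_mat z2 R2"
  define D where "D = N2 - N1"
  have z': "z2 \<noteq> z1" "z2 \<noteq> cnj z1" using z by auto
  have R1: "R1 ** D = D ** P1"
    unfolding D_def N1_def N2_def R1_def by (rule permuted_projection_intertwines[OF P z])
  have "R2 ** (N1 - N2) = (N1 - N2) ** P2"
    unfolding N1_def N2_def R2_def by (rule permuted_projection_intertwines[OF P(2,1) z'])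
  then have "- (R2 ** (N1 - N2)) = - ((N1 - N2) ** P2)" by simp
  then have R2: "R2 ** D = D ** P2"
    by (simp add: D_def matrix_diff_ldistrib matrix_diff_rdistrib)
  have M: "M1 ** D = D ** N1" "M2 ** D = D ** N2"
    by (simp_all add: M1_def M2_def N1_def N2_def spectral_mat_def matrix_expand R1 R2)
  have "(M2 - M1) ** D = D ** D"
    by (simp add: matrix_diff_rdistrib M) (simp add: D_def matrix_diff_ldistrib)
  then have MD: "M2 - M1 = D"
    unfolding D_def N1_def N2_def
    by (rule invertible_cancel_right[OF invertible_spectral_mat_diff[OF P z]])
  have "M2 ** N1 = M2 ** (N2 - D)" by (simp add: D_def)
  also have "\<dots> = M2 ** N2 - D ** N2" by (simp add: matrix_diff_ldistrib M)
  also have "\<dots> = (M2 - D) ** N2" by (simp add: matrix_diff_rdistrib)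
  also have "M2 - D = M1" by (simp add: MD[symmetric])
  finally have prod: "M2 ** N1 = M1 ** N2" .
  have sum: "M2 + N1 = M1 + N2" using MD by (simp add: D_def algebra_simps)
  let ?I = "\<zeta> *\<^sub>M (mat 1 :: complex^'a^'a)"
  have "(?I - M2) ** (?I - N1) = \<zeta> *\<^sub>M ?I - \<zeta> *\<^sub>M (M2 + N1) + M2 ** N1"
    by (simp add: matrix_expand)
  also have "\<dots> = (?I - M1) ** (?I - N2)"
    unfolding sum prod by (simp add: matrix_expand)
  finally have "((\<zeta> - z2) *\<^sub>M simple_elt z2 R2 \<zeta>) ** ((\<zeta> - z1) *\<^sub>M simple_elt z1 P1 \<zeta>)
      = ((\<zeta> - z1) *\<^sub>M simple_elt z1 R1 \<zeta>) ** ((\<zeta> - z2) *\<^sub>M simple_elt z2 P2 \<zeta>)"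
    using \<zeta> by (simp add: simple_elt_spectral_mat N1_def N2_def M1_def M2_def)
  then have "((\<zeta> - z2) * (\<zeta> - z1)) *\<^sub>M (simple_elt z2 R2 \<zeta> ** simple_elt z1 P1 \<zeta>)
      = ((\<zeta> - z2) * (\<zeta> - z1)) *\<^sub>M (simple_elt z1 R1 \<zeta> ** simple_elt z2 P2 \<zeta>)"
    by (simp add: mscale_mult mscale_mscale mult.commute)
  then show ?thesis
    by (rule mscale_cancel[rotated]) (use \<zeta> in auto)
qed

section \<open>Uniqueness and composition of dressing\<close>

definition mat_holomorphic_on :: "(complex \<Rightarrow> complex^'n^'m) \<Rightarrow> complex set \<Rightarrow> bool" where
  "mat_holomorphic_on G S \<longleftrightarrow> (\<forall>i j. (\<lambda>\<zeta>. G \<zeta> $ i $ j) holomorphic_on S)"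

lemma mat_holomorphic_on_mult:
  assumes "mat_holomorphic_on G S" "mat_holomorphic_on H S"
  shows "mat_holomorphic_on (\<lambda>\<zeta>. G \<zeta> ** H \<zeta>) S"
  using assms unfolding mat_holomorphic_on_def matrix_matrix_mult_def
  by (auto intro!: holomorphic_intros)

lemma holomorphic_on_det:
  assumes "mat_holomorphic_on G S"
  shows "(\<lambda>\<zeta>. det (G \<zeta>)) holomorphic_on S"
  using assms unfolding mat_holomorphic_on_def det_def by (auto intro!: holomorphic_intros)

lemma mat_holomorphic_on_inv:
  fixes G :: "complex \<Rightarrow> complex^'n^'n"
  assumes G: "mat_holomorphic_on G S" and inv: "\<And>\<zeta>. \<zeta> \<in> S \<Longrightarrow> invertible (G \<zeta>)"
  shows "mat_holomorphic_on (\<lambda>\<zeta>. matrix_inv (G \<zeta>)) S"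
proof -
  have "(\<lambda>\<zeta>. matrix_inv (G \<zeta>) $ k $ l) holomorphic_on S" for k l
  proof -
    have "mat_holomorphic_on (\<lambda>\<zeta>. \<chi> i j. if j = k then axis l 1 $ i else G \<zeta> $ i $ j) S"
      unfolding mat_holomorphic_on_def
    proof (intro allI)
      fix i j
      show "(\<lambda>\<zeta>. (\<chi> i j. if j = k then axis l 1 $ i else G \<zeta> $ i $ j) $ i $ j) holomorphic_on S"
        using G by (cases "j = k") (auto simp: mat_holomorphic_on_def)
    qed
    then have "(\<lambda>\<zeta>. det (\<chi> i j. if j = k then axis l 1 $ i else G \<zeta> $ i $ j) / det (G \<zeta>))
        holomorphic_on S"
      using G inv by (intro holomorphic_on_divide holomorphic_on_det) (auto simp: invertible_det_nz)
    then show ?thesis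
      by (rule holomorphic_transform) (simp add: matrix_inv_cramer inv)
  qed
  then show ?thesis by (simp add: mat_holomorphic_on_def)
qed

lemma tendsto_matrix_iff:
  fixes G :: "'a \<Rightarrow> complex^'n^'m"
  shows "(G \<longlongrightarrow> A) F \<longleftrightarrow> (\<forall>i j. ((\<lambda>x. G x $ i $ j) \<longlongrightarrow> A $ i $ j) F)"
  by (auto intro: tendsto_vec_nth vec_tendstoI)

lemma tendsto_matrix_mult:
  fixes G :: "'a \<Rightarrow> complex^'n^'m" and H :: "'a \<Rightarrow> complex^'k^'n"
  assumes "(G \<longlongrightarrow> A) F" "(H \<longlongrightarrow> B) F"
  shows "((\<lambda>x. G x ** H x) \<longlongrightarrow> A ** B) F"
  using assms unfolding tendsto_matrix_iff matrix_matrix_mult_def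
  by (auto intro!: tendsto_sum tendsto_mult)

lemma tendsto_matrix_inv:
  fixes G :: "'a \<Rightarrow> complex^'n^'n"
  assumes G: "(G \<longlongrightarrow> A) F" and A: "invertible A" and inv: "\<forall>\<^sub>F x in F. invertible (G x)"
  shows "((\<lambda>x. matrix_inv (G x)) \<longlongrightarrow> matrix_inv A) F"
  unfolding tendsto_matrix_iff
proof (intro allI)
  have det: "((\<lambda>x. det (H x)) \<longlongrightarrow> det B) F" if "(H \<longlongrightarrow> B) F" for H and B :: "complex^'n^'n"
    using that unfolding tendsto_matrix_iff det_def
    by (intro tendsto_sum tendsto_mult tendsto_const tendsto_prod) blast
  fix k l
  have "((\<lambda>x. \<chi> i j. if j = k then axis l 1 $ i else G x $ i $ j)
      \<longlongrightarrow> (\<chi> i j. if j = k then axis l 1 $ i else A $ i $ j)) F"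
    unfolding tendsto_matrix_iff
  proof (intro allI)
    fix i j
    show "((\<lambda>x. (\<chi> i j. if j = k then axis l 1 $ i else G x $ i $ j) $ i $ j)
        \<longlongrightarrow> (\<chi> i j. if j = k then axis l 1 $ i else A $ i $ j) $ i $ j) F"
      using G by (cases "j = k") (auto simp: tendsto_matrix_iff)
  qed
  then have "((\<lambda>x. det (\<chi> i j. if j = k then axis l 1 $ i else G x $ i $ j) / det (G x))
      \<longlongrightarrow> matrix_inv A $ k $ l) F"
    unfolding matrix_inv_cramer[OF A] using G A by (intro tendsto_divide det) (auto simp: invertible_det_nz)
  then show "((\<lambda>x. matrix_inv (G x) $ k $ l) \<longlongrightarrow> matrix_inv A $ k $ l) F"
  proof (rule Lim_transform_eventually)
    show "\<forall>\<^sub>F x in F. det (\<chi> i j. if j = k then axis l 1 $ i else G x $ i $ j) / det (G x)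
        = matrix_inv (G x) $ k $ l"
      using inv by eventually_elim (simp add: matrix_inv_cramer)
  qed
qed

lemma mat_holomorphic_on_subset:
  "mat_holomorphic_on G S \<Longrightarrow> T \<subseteq> S \<Longrightarrow> mat_holomorphic_on G T"
  unfolding mat_holomorphic_on_def using holomorphic_on_subset by blast

lemma Lambda_plus_iff:
  "G \<in> Lambda_plus \<longleftrightarrow> mat_holomorphic_on G UNIV \<and> (\<forall>\<zeta>. invertible (G \<zeta>))"
  by (simp add: Lambda_plus_def mat_holomorphic_on_def)

text \<open>Invertibility and holomorphy near infinity may be checked on discs of different radii.\<close>

lemma Lambda_minus_iff:
  "g \<in> Lambda_minus \<longleftrightarrow>
    (\<exists>r>0. \<forall>\<mu>\<in>ball 0 r. invertible (if \<mu> = 0 then mat 1 else g (inverse \<mu>)))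
    \<and> (\<exists>r>0. mat_holomorphic_on (\<lambda>\<mu>. if \<mu> = 0 then mat 1 else g (inverse \<mu>)) (ball 0 r))"
    (is "_ \<longleftrightarrow> (\<exists>r>0. ?I r) \<and> (\<exists>r>0. ?H r)")
proof
  assume "g \<in> Lambda_minus"
  then obtain r where r: "0 < r" "\<forall>\<mu>\<in>ball 0 r. invertible (if \<mu> = 0 then mat 1 else g (inverse \<mu>)) \<and>
     (\<forall>i j. (\<lambda>\<mu>. (if \<mu> = 0 then mat 1 else g (inverse \<mu>)) $ i $ j) holomorphic_on ball 0 r)"
    unfolding Lambda_minus_def by blast
  moreover have "0 \<in> ball (0::complex) r" using r by simp
  ultimately show "(\<exists>r>0. ?I r) \<and> (\<exists>r>0. ?H r)"
    unfolding mat_holomorphic_on_def by blast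
next
  assume "(\<exists>r>0. ?I r) \<and> (\<exists>r>0. ?H r)"
  then obtain r s where rs: "0 < r" "?I r" "0 < s" "?H s" by blast
  have "0 < min r s" using rs by simp
  moreover have "?I (min r s)" using rs(2) by simp
  moreover have "?H (min r s)"
    by (rule mat_holomorphic_on_subset[OF rs(4)]) (simp add: subset_ball)
  ultimately show "g \<in> Lambda_minus"
    unfolding Lambda_minus_def mat_holomorphic_on_def by blast
qed

lemma Lambda_minus_mult:
  assumes "g \<in> Lambda_minus" "g' \<in> Lambda_minus"
  shows "(\<lambda>\<zeta>. g \<zeta> ** g' \<zeta>) \<in> Lambda_minus"
proof -
  let ?e = "\<lambda>g \<mu>. if \<mu> = 0 then mat 1 else g (inverse \<mu>)"
  have e: "?e (\<lambda>\<zeta>. g \<zeta> ** g' \<zeta>) \<mu> = ?e g \<mu> ** ?e g' \<mu>" for \<mu> by simp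
  obtain r s where 1: "r > 0" "\<forall>\<mu>\<in>ball 0 r. invertible (?e g \<mu>)"
      "s > 0" "mat_holomorphic_on (?e g) (ball 0 s)"
    using assms(1) unfolding Lambda_minus_iff by blast
  obtain r' s' where 2: "r' > 0" "\<forall>\<mu>\<in>ball 0 r'. invertible (?e g' \<mu>)"
      "s' > 0" "mat_holomorphic_on (?e g') (ball 0 s')"
    using assms(2) unfolding Lambda_minus_iff by blast
  have "\<forall>\<mu>\<in>ball 0 (min r r'). invertible (?e (\<lambda>\<zeta>. g \<zeta> ** g' \<zeta>) \<mu>)"
    unfolding e
  proof (intro ballI invertible_mult)
    fix \<mu> :: complex assume "\<mu> \<in> ball 0 (min r r')"
    then have "\<mu> \<in> ball 0 r" "\<mu> \<in> ball 0 r'" by auto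
    then show "invertible (?e g \<mu>)" "invertible (?e g' \<mu>)" using 1(2) 2(2) by blast+
  qed
  moreover have "mat_holomorphic_on (?e (\<lambda>\<zeta>. g \<zeta> ** g' \<zeta>)) (ball 0 (min s s'))"
    unfolding e
  proof (rule mat_holomorphic_on_mult)
    show "mat_holomorphic_on (?e g) (ball 0 (min s s'))"
      by (rule mat_holomorphic_on_subset[OF 1(4)]) (simp add: subset_ball)
    show "mat_holomorphic_on (?e g') (ball 0 (min s s'))"
      by (rule mat_holomorphic_on_subset[OF 2(4)]) (simp add: subset_ball)
  qed
  moreover have "min r r' > 0" "min s s' > 0" using 1 2 by auto
  ultimately show ?thesis unfolding Lambda_minus_iff by blast
qed

lemma Lambda_minus_eventually_invertible:
  assumes "g \<in> Lambda_minus"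
  shows "\<forall>\<^sub>F \<zeta> in at_infinity. invertible (g \<zeta>)"
proof -
  obtain r where r: "r > 0" "\<forall>\<mu>\<in>ball 0 r. invertible (if \<mu> = 0 then mat 1 else g (inverse \<mu>))"
    using assms unfolding Lambda_minus_iff by blast
  have "\<forall>\<^sub>F \<mu> in at 0. invertible (g (inverse \<mu>))"
    using r unfolding eventually_at by (metis dist_commute mem_ball)
  then show ?thesis by (simp add: at_to_infinity eventually_filtermap)
qed

lemma Lambda_minus_tendsto:
  assumes "g \<in> Lambda_minus"
  shows "(g \<longlongrightarrow> mat 1) at_infinity"
  unfolding tendsto_matrix_iff
proof (intro allI)
  fix i j
  let ?e = "\<lambda>\<mu>. (if \<mu> = 0 then mat 1 else g (inverse \<mu>)) $ i $ j"
  obtain s where s: "s > 0" "?e holomorphic_on (ball 0 s)"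
    using assms unfolding Lambda_minus_iff mat_holomorphic_on_def by blast
  then have "isCont ?e 0"
    by (meson centre_in_ball continuous_on_eq_continuous_at holomorphic_on_imp_continuous_on open_ball)
  then have "(?e \<longlongrightarrow> mat 1 $ i $ j) (at 0)" by (simp add: isCont_def)
  then have "((\<lambda>\<mu>. g (inverse \<mu>) $ i $ j) \<longlongrightarrow> mat 1 $ i $ j) (at 0)"
    by (rule Lim_transform_eventually) (simp add: eventually_at_filter)
  then show "((\<lambda>\<zeta>. g \<zeta> $ i $ j) \<longlongrightarrow> mat 1 $ i $ j) at_infinity"
    by (simp add: lim_at_infinity_0 comp_def)
qed

text \<open>If \<open>G\<^sub>1 g\<^sub>1 = G\<^sub>2 g\<^sub>2\<close> near infinity then the entire matrix \<open>G\<^sub>2\<^sup>-\<^sup>1 G\<^sub>1 = g\<^sub>2 g\<^sub>1\<^sup>-\<^sup>1\<close> tends to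
  the identity at infinity, so it is the identity by Liouville's theorem.\<close>

theorem is_dressing_unique:
  assumes "is_dressing g G G1" "is_dressing g G G2"
  shows "G1 = G2"
proof
  fix \<xi>
  obtain g1 where g1: "g1 \<in> Lambda_minus" "\<forall>\<^sub>F \<zeta> in at_infinity. g \<zeta> ** G \<zeta> = G1 \<zeta> ** g1 \<zeta>"
    using assms(1) unfolding is_dressing_def by blast
  obtain g2 where g2: "g2 \<in> Lambda_minus" "\<forall>\<^sub>F \<zeta> in at_infinity. g \<zeta> ** G \<zeta> = G2 \<zeta> ** g2 \<zeta>"
    using assms(2) unfolding is_dressing_def by blast
  have plus: "mat_holomorphic_on G1 UNIV" "mat_holomorphic_on G2 UNIV" "\<And>\<zeta>. invertible (G2 \<zeta>)"
    using assms unfolding is_dressing_def Lambda_plus_iff by blast+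
  define K where "K \<zeta> = matrix_inv (G2 \<zeta>) ** G1 \<zeta>" for \<zeta>
  have K: "mat_holomorphic_on K UNIV"
    unfolding K_def by (intro mat_holomorphic_on_mult mat_holomorphic_on_inv plus)
  have lim: "((\<lambda>\<zeta>. g2 \<zeta> ** matrix_inv (g1 \<zeta>)) \<longlongrightarrow> mat 1 ** matrix_inv (mat 1)) at_infinity"
    using g1 g2 by (intro tendsto_matrix_mult tendsto_matrix_inv Lambda_minus_tendsto
        Lambda_minus_eventually_invertible) (auto simp: invertible_def intro: exI[of _ "mat 1"])
  have ev: "\<forall>\<^sub>F \<zeta> in at_infinity. g2 \<zeta> ** matrix_inv (g1 \<zeta>) = K \<zeta>"
    using g1(2) g2(2) Lambda_minus_eventually_invertible[OF g1(1)]
  proof eventually_elim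
    case (elim \<zeta>)
    have "matrix_inv (G2 \<zeta>) ** (G2 \<zeta> ** g2 \<zeta>) ** matrix_inv (g1 \<zeta>)
        = matrix_inv (G2 \<zeta>) ** (G1 \<zeta> ** g1 \<zeta>) ** matrix_inv (g1 \<zeta>)"
      using elim by simp
    then have "(matrix_inv (G2 \<zeta>) ** G2 \<zeta>) ** g2 \<zeta> ** matrix_inv (g1 \<zeta>)
        = matrix_inv (G2 \<zeta>) ** G1 \<zeta> ** (g1 \<zeta> ** matrix_inv (g1 \<zeta>))"
      by (simp only: matrix_mul_assoc)
    then show ?case using elim plus(3) by (simp add: matrix_inv_mult K_def)
  qed
  have "matrix_inv (mat 1) = (mat 1 :: complex^'a^'a)" by (rule matrix_inv_eqI) simp
  then have Klim: "(K \<longlongrightarrow> mat 1) at_infinity"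
    using Lim_transform_eventually[OF lim ev] by simp
  have "K \<xi> $ i $ j = mat 1 $ i $ j" for i j
    using K Klim unfolding mat_holomorphic_on_def tendsto_matrix_iff
    by (intro Liouville_weak) auto
  then have "K \<xi> = mat 1" by (simp add: vec_eq_iff)
  then have "G2 \<xi> ** K \<xi> = G2 \<xi>" by simp
  then show "G1 \<xi> = G2 \<xi>" using plus(3) by (simp add: K_def matrix_mul_assoc matrix_inv_mult)
qed

lemma is_dressing_dress:
  assumes "is_dressing g G G'"
  shows "dressable g G" "dress g G = G'"
  using assms is_dressing_unique unfolding dressable_def dress_def by blast+

lemma is_dressing_compose:
  assumes "is_dressing g G G'" "is_dressing k G' G''"
  shows "is_dressing (\<lambda>\<zeta>. k \<zeta> ** g \<zeta>) G G''"
proof -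
  obtain g1 where g1: "g1 \<in> Lambda_minus" "\<forall>\<^sub>F \<zeta> in at_infinity. g \<zeta> ** G \<zeta> = G' \<zeta> ** g1 \<zeta>"
    using assms(1) unfolding is_dressing_def by blast
  obtain k1 where k1: "k1 \<in> Lambda_minus" "\<forall>\<^sub>F \<zeta> in at_infinity. k \<zeta> ** G' \<zeta> = G'' \<zeta> ** k1 \<zeta>"
    using assms(2) unfolding is_dressing_def by blast
  have "\<forall>\<^sub>F \<zeta> in at_infinity. k \<zeta> ** g \<zeta> ** G \<zeta> = G'' \<zeta> ** (k1 \<zeta> ** g1 \<zeta>)"
    using g1(2) k1(2)
    by eventually_elim (simp add: matrix_mul_assoc[symmetric], simp add: matrix_mul_assoc)
  moreover have "g \<in> Lambda_minus" "k \<in> Lambda_minus" "G \<in> Lambda_plus" "G'' \<in> Lambda_plus"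
    using assms unfolding is_dressing_def by blast+
  ultimately show ?thesis
    using Lambda_minus_mult[OF k1(1) g1(1)] Lambda_minus_mult[of k g] unfolding is_dressing_def
    by (intro conjI bexI[of _ "\<lambda>\<zeta>. k1 \<zeta> ** g1 \<zeta>"])
qed

lemma is_dressing_cong:
  assumes "is_dressing g G G'" "\<forall>\<^sub>F \<zeta> in at_infinity. k \<zeta> = g \<zeta>" "k \<in> Lambda_minus"
  shows "is_dressing k G G'"
proof -
  obtain g1 where g1: "g1 \<in> Lambda_minus" "\<forall>\<^sub>F \<zeta> in at_infinity. g \<zeta> ** G \<zeta> = G' \<zeta> ** g1 \<zeta>"
    using assms(1) unfolding is_dressing_def by blast
  have "\<forall>\<^sub>F \<zeta> in at_infinity. k \<zeta> ** G \<zeta> = G' \<zeta> ** g1 \<zeta>"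
    using g1(2) assms(2) by eventually_elim simp
  then show ?thesis using assms g1 unfolding is_dressing_def by blast
qed

text \<open>The right factor in the factorisation of \<open>g F\<close> has this shape with \<open>w = P \<eta>\<close>, and \<open>w = 0\<close> gives
  the extended simple elements themselves. In the coordinate \<open>\<mu> = 1 / \<zeta>\<close> all entries are rational with
  denominator \<open>1 - \<mu> z\<close>, and the inverse has the denominator \<open>1 - \<mu> cnj z\<close>; this determines the
  radius.\<close>

lemma block_simple_elt_in_Lambda_minus:
  assumes P: "hermitian_projection P" and z: "z \<noteq> 0"
  shows "(\<lambda>\<zeta>. block_mat (simple_elt z P \<zeta>) (((cnj z - z) / (\<zeta> - z)) *s w) ((\<zeta> - cnj z) / (\<zeta> - z)))
    \<in> Lambda_minus" (is "?g \<in> _")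
proof -
  let ?c = "\<lambda>\<mu>. (1 - \<mu> * cnj z) / (1 - \<mu> * z)"
  let ?d = "\<lambda>\<mu>. \<mu> * (cnj z - z) / (1 - \<mu> * z)"
  let ?A = "\<lambda>\<mu>. P + ?c \<mu> *\<^sub>M (mat 1 - P)"
  let ?H = "\<lambda>\<mu>. block_mat (?A \<mu>) (?d \<mu> *s w) (?c \<mu>)"
  let ?r = "1 / cmod z"
  have nz: "1 - \<mu> * z \<noteq> 0" "1 - \<mu> * cnj z \<noteq> 0" if "\<mu> \<in> ball 0 ?r" for \<mu>
  proof -
    have "cmod \<mu> * cmod z < 1" using that z by (simp add: field_simps)
    then have "cmod (\<mu> * z) < 1" "cmod (\<mu> * cnj z) < 1" by (simp_all add: norm_mult)
    then show "1 - \<mu> * z \<noteq> 0" "1 - \<mu> * cnj z \<noteq> 0" by auto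
  qed
  have eq: "(if \<mu> = 0 then mat 1 else ?g (inverse \<mu>)) = ?H \<mu>" if "\<mu> \<in> ball 0 ?r" for \<mu>
  proof (cases "\<mu> = 0")
    case False
    have 1: "inverse \<mu> - a = (1 - \<mu> * a) / \<mu>" for a using False by (simp add: field_simps)
    have 2: "(inverse \<mu> - cnj z) / (inverse \<mu> - z) = ?c \<mu>" "(cnj z - z) / (inverse \<mu> - z) = ?d \<mu>"
      unfolding 1 using False nz[OF that] by (simp_all add: divide_simps)
    show ?thesis using False by (simp add: simple_elt_def 2)
  qed (simp add: block_mat_mat_1)
  have "invertible (?H \<mu>)" if "\<mu> \<in> ball 0 ?r" for \<mu>
  proof (rule invertible_block_mat)
    have "?A \<mu> ** (P + ((1 - \<mu> * z) / (1 - \<mu> * cnj z)) *\<^sub>M (mat 1 - P)) = mat 1"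
      using nz[OF that] hermitian_projectionD[OF P]
      by (simp add: matrix_add_ldistrib matrix_add_rdistrib mscale_mult mscale_mscale)
    then show "invertible (?A \<mu>)" by (meson invertible_right_inverse)
    show "?c \<mu> \<noteq> 0" using nz[OF that] by simp
  qed
  then have inv: "\<forall>\<mu>\<in>ball 0 ?r. invertible (if \<mu> = 0 then mat 1 else ?g (inverse \<mu>))"
    using eq by simp
  have "mat_holomorphic_on ?H (ball 0 ?r)"
    unfolding mat_holomorphic_on_def all_plus_iff
    using nz by (auto intro!: holomorphic_intros)
  then have hol: "(\<lambda>\<mu>. ?H \<mu> $ i $ j) holomorphic_on ball 0 ?r" for i j
    unfolding mat_holomorphic_on_def by blast
  have "mat_holomorphic_on (\<lambda>\<mu>. if \<mu> = 0 then mat 1 else ?g (inverse \<mu>)) (ball 0 ?r)"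
    unfolding mat_holomorphic_on_def
    by (intro allI, rule holomorphic_transform[OF hol]) (simp only: eq)
  moreover have "?r > 0" using z by simp
  ultimately show ?thesis using inv unfolding Lambda_minus_iff by blast
qed

lemma simple_elt_ext_in_Lambda_minus:
  assumes "hermitian_projection P" "z \<noteq> 0"
  shows "simple_elt_ext z P \<in> Lambda_minus"
  using block_simple_elt_in_Lambda_minus[OF assms, of 0] by (simp add: simple_elt_ext_def[abs_def])

section \<open>Dressing by one simple element\<close>

lemma eventually_at_infinity_notin_finite:
  assumes "finite (S::complex set)"
  shows "\<forall>\<^sub>F \<zeta> in at_infinity. \<zeta> \<notin> S"
proof -
  obtain b where b: "\<And>x. x \<in> S \<Longrightarrow> norm x \<le> b"
    using finite_imp_bounded[OF assms] unfolding bounded_iff by blast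
  show ?thesis unfolding eventually_at_infinity
    by (rule exI[of _ "b + 1"]) (use b in force)
qed

lemma continuous_eq_const_off_finite:
  fixes f :: "complex \<Rightarrow> complex"
  assumes "continuous_on UNIV f" "finite S" "\<And>\<zeta>. \<zeta> \<notin> S \<Longrightarrow> f \<zeta> = c"
  shows "f a = c"
proof -
  have "(f \<longlongrightarrow> f a) (at a)"
    using assms(1) by (simp add: continuous_on_eq_continuous_at isCont_def)
  moreover have "\<forall>\<^sub>F \<zeta> in at a. f \<zeta> = c"
  proof -
    obtain d where "d > 0" "\<forall>x\<in>S. x \<noteq> a \<longrightarrow> d \<le> dist a x"
      using finite_set_avoid[OF assms(2)] by blast
    then show ?thesis
      unfolding eventually_at by (intro exI[of _ d]) (use assms(3) in \<open>force simp: dist_commute\<close>)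
  qed
  ultimately have "((\<lambda>\<zeta>. c) \<longlongrightarrow> f a) (at a)" by (rule Lim_transform_eventually)
  then show ?thesis by (simp add: tendsto_const_iff)
qed

lemma entire_divide_two_zeros:
  fixes f :: "complex \<Rightarrow> complex"
  assumes "f holomorphic_on UNIV" "f a = 0" "f b = 0" "a \<noteq> b"
  obtains g where "g holomorphic_on UNIV" "\<And>\<zeta>. f \<zeta> = (\<zeta> - a) * (\<zeta> - b) * g \<zeta>"
proof -
  have div: "\<exists>g. g holomorphic_on UNIV \<and> (\<forall>\<zeta>. f \<zeta> = (\<zeta> - a) * g \<zeta>)"
    if "f holomorphic_on UNIV" "f a = 0" for f :: "complex \<Rightarrow> complex" and a
    using that pole_lemma[of f UNIV a]
    by (intro exI[of _ "\<lambda>z. if z = a then deriv f a else (f z - f a) / (z - a)"]) auto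
  obtain g where g: "g holomorphic_on UNIV" "\<And>\<zeta>. f \<zeta> = (\<zeta> - a) * g \<zeta>"
    using div[OF assms(1,2)] by blast
  then have "g b = 0" using assms(3,4) by auto
  then obtain k where "k holomorphic_on UNIV" "\<And>\<zeta>. g \<zeta> = (\<zeta> - b) * k \<zeta>"
    using div g(1) by blast
  then show thesis using that g(2) by auto
qed

text \<open>The blocks of an extended frame at a fixed point. The relation \<open>E(cnj \<zeta>)\<^sup>* E(\<zeta>) = I\<close> expresses
  that \<open>E(\<zeta>)\<close> is unitary for real \<open>\<zeta>\<close>.\<close>

definition unitary_frame :: "(complex \<Rightarrow> complex^'n^'n) \<Rightarrow> (complex \<Rightarrow> complex^'n) \<Rightarrow> bool" where
  "unitary_frame E X \<longleftrightarrow> mat_holomorphic_on E UNIV \<and> (\<forall>i. (\<lambda>\<zeta>. X \<zeta> $ i) holomorphic_on UNIV)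
    \<and> (\<forall>\<zeta>. conj_transpose (E (cnj \<zeta>)) ** E \<zeta> = mat 1)"

lemma unitary_frameD:
  assumes "unitary_frame E X"
  shows "E \<zeta> ** conj_transpose (E (cnj \<zeta>)) = mat 1" "conj_transpose (E (cnj \<zeta>)) ** E \<zeta> = mat 1"
    "matrix_inv (E \<zeta>) = conj_transpose (E (cnj \<zeta>))" "invertible (E \<zeta>)"
proof -
  show 1: "conj_transpose (E (cnj \<zeta>)) ** E \<zeta> = mat 1" using assms by (simp add: unitary_frame_def)
  then show 2: "E \<zeta> ** conj_transpose (E (cnj \<zeta>)) = mat 1" using matrix_left_right_inverse by blast
  then show "matrix_inv (E \<zeta>) = conj_transpose (E (cnj \<zeta>))" by (rule matrix_inv_eqI)
  show "invertible (E \<zeta>)" using 2 invertible_right_inverse by blast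
qed

lemma unitary_frame_in_Lambda_plus:
  assumes "unitary_frame E X"
  shows "(\<lambda>\<zeta>. block_mat (E \<zeta>) (X \<zeta>) 1) \<in> Lambda_plus"
  using assms invertible_block_mat[OF unitary_frameD(4)[OF assms], of 1]
  by (simp add: Lambda_plus_iff mat_holomorphic_on_def all_plus_iff unitary_frame_def)

lemma spectral_mat_at_eigenvalue:
  "z *\<^sub>M mat 1 - spectral_mat z P = (z - cnj z) *\<^sub>M (mat 1 - P)"
  "cnj z *\<^sub>M mat 1 - spectral_mat z P = (cnj z - z) *\<^sub>M P"
  by (simp_all add: spectral_mat_def vec_eq_iff algebra_simps)

text \<open>The candidate for the dressed frame has simple poles at \<open>z\<close> and \<open>cnj z\<close> at most, stemming from
  the scalar \<open>(\<zeta> - cnj z) / (\<zeta> - z)\<close> and its inverse. The choice of \<open>P\<close> makes the residues vanish: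
  \<open>(1 - \<pi>) E(z) P = 0\<close> holds by definition, and \<open>\<pi> E(cnj z) (1 - P) = 0\<close> is its adjoint by unitarity.
  The choice of \<open>\<eta>\<close> does the same for the last column.\<close>

theorem dressing_by_simple_element:
  fixes E :: "complex \<Rightarrow> complex^'n^'n"
  assumes fr: "unitary_frame E X" and z: "z \<notin> \<real>" and pi: "hermitian_projection \<pi>"
  defines "P \<equiv> hermitian_projection_onto ((*v) (matrix_inv (E z)) ` mat_range \<pi>)"
    and "\<eta> \<equiv> matrix_inv (E (cnj z)) *v X (cnj z)"
  obtains E1 X1 where "unitary_frame E1 X1"
    "is_dressing (simple_elt_ext z \<pi>) (\<lambda>\<zeta>. block_mat (E \<zeta>) (X \<zeta>) 1) (\<lambda>\<zeta>. block_mat (E1 \<zeta>) (X1 \<zeta>) 1)"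
    "\<And>\<zeta>. \<zeta> \<notin> {z, cnj z} \<Longrightarrow> E1 \<zeta> = simple_elt z \<pi> \<zeta> ** E \<zeta> ** simple_elt (cnj z) P \<zeta>"
    "\<And>\<zeta>. \<zeta> \<notin> {z, cnj z} \<Longrightarrow> X1 \<zeta> = simple_elt (cnj z) (mat 1 - \<pi>) \<zeta> *v
        (X \<zeta> - ((cnj z - z) / (\<zeta> - z)) *s ((E \<zeta> ** P) *v \<eta>))"
proof -
  note E = unitary_frameD[OF fr]
  have img: "hermitian_projection P" "P ** matrix_inv (E z) ** \<pi> = matrix_inv (E z) ** \<pi>"
      "\<pi> ** E z ** P = E z ** P"
    unfolding P_def by (rule hermitian_projection_onto_image[OF pi matrix_inv_mult(2)[OF E(4)]])+
  note P = hermitian_projectionD[OF img(1)] and pp = hermitian_projectionD[OF pi]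
  have "conj_transpose (P ** matrix_inv (E z) ** \<pi>) = conj_transpose (matrix_inv (E z) ** \<pi>)"
    by (simp only: img(2))
  then have img': "\<pi> ** E (cnj z) ** P = \<pi> ** E (cnj z)"
    by (simp add: E(3) conj_transpose_mult P pp matrix_mul_assoc)
  have zz: "z \<noteq> cnj z" using z not_real_cnj_neq by blast
  \<comment> \<open>\<open>T\<close> and \<open>W\<close> are the left and right simple elements with their denominators cleared, \<open>NE\<close> and \<open>NX\<close> the
    blocks of the candidate multiplied by \<open>(\<zeta> - z) (\<zeta> - cnj z)\<close>; they have to vanish at \<open>z\<close> and \<open>cnj z\<close>\<close>
  define T where "T \<zeta> = \<zeta> *\<^sub>M mat 1 - spectral_mat z \<pi>" for \<zeta>
  define W where "W \<zeta> = \<zeta> *\<^sub>M mat 1 - spectral_mat (cnj z) P" for \<zeta>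
  define NE where "NE \<zeta> = T \<zeta> ** E \<zeta> ** W \<zeta>" for \<zeta>
  define NX where "NX \<zeta> = T \<zeta> *v ((z - cnj z) *s ((E \<zeta> ** P) *v \<eta>) + (\<zeta> - z) *s X \<zeta>)" for \<zeta>
  have TW: "T z = (z - cnj z) *\<^sub>M (mat 1 - \<pi>)" "T (cnj z) = (cnj z - z) *\<^sub>M \<pi>"
      "W z = (z - cnj z) *\<^sub>M P" "W (cnj z) = (cnj z - z) *\<^sub>M (mat 1 - P)"
    using spectral_mat_at_eigenvalue[of z \<pi>] spectral_mat_at_eigenvalue[of "cnj z" P]
    by (simp_all add: T_def W_def)
  have holE: "(\<lambda>\<zeta>. E \<zeta> $ i $ j) holomorphic_on UNIV" "(\<lambda>\<zeta>. X \<zeta> $ i) holomorphic_on UNIV" for i j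
    using fr by (auto simp: unitary_frame_def mat_holomorphic_on_def)
  have holTW: "(\<lambda>\<zeta>. T \<zeta> $ i $ j) holomorphic_on UNIV" "(\<lambda>\<zeta>. W \<zeta> $ i $ j) holomorphic_on UNIV" for i j
    unfolding T_def W_def by (auto intro!: holomorphic_intros)
  have holN: "(\<lambda>\<zeta>. NE \<zeta> $ i $ j) holomorphic_on UNIV" "(\<lambda>\<zeta>. NX \<zeta> $ i) holomorphic_on UNIV" for i j
    unfolding NE_def NX_def matrix_matrix_mult_def matrix_vector_mult_def
    by (auto intro!: holomorphic_intros holE holTW)
  have "NE z = 0"
    unfolding NE_def TW using img(3) by (simp add: mscale_mult matrix_expand)
  moreover have "NE (cnj z) = 0"
    unfolding NE_def TW using img' by (simp add: mscale_mult matrix_expand matrix_mul_assoc)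
  moreover have "NX z = 0"
  proof -
    have "(mat 1 - \<pi>) ** (E z ** P) = 0" using img(3) by (simp add: matrix_expand matrix_mul_assoc)
    then show ?thesis unfolding NX_def TW by (simp add: mscale_vector matrix_vector_mult_diff_distrib vector_scalar_commute
          matrix_vector_mul_assoc mscale_mult)
  qed
  moreover have "NX (cnj z) = 0"
  proof -
    have 1: "X (cnj z) = E (cnj z) *v \<eta>"
      by (simp add: \<eta>_def matrix_vector_mul_assoc matrix_inv_mult E(4))
    have 2: "\<pi> *v ((E (cnj z) ** P) *v \<eta>) = \<pi> *v (E (cnj z) *v \<eta>)"
      using img' by (simp add: matrix_vector_mul_assoc matrix_mul_assoc)
    have "\<pi> *v ((z - cnj z) *s ((E (cnj z) ** P) *v \<eta>) + (cnj z - z) *s X (cnj z)) = 0"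
      unfolding matrix_vector_right_distrib vector_scalar_commute 2 1
      by (simp add: vec_eq_iff algebra_simps)
    then show ?thesis unfolding NX_def TW by (simp add: mscale_vector)
  qed
  ultimately have zero: "NE z $ i $ j = 0" "NE (cnj z) $ i $ j = 0" "NX z $ i = 0" "NX (cnj z) $ i = 0"
    for i j by simp_all
  have "\<exists>g. g holomorphic_on UNIV \<and> (\<forall>\<zeta>. NE \<zeta> $ i $ j = (\<zeta> - z) * (\<zeta> - cnj z) * g \<zeta>)" for i j
    using entire_divide_two_zeros[OF holN(1) zero(1,2) zz] by metis
  then obtain e where e: "\<And>i j. e i j holomorphic_on UNIV"
      "\<And>i j \<zeta>. NE \<zeta> $ i $ j = (\<zeta> - z) * (\<zeta> - cnj z) * e i j \<zeta>" by metis
  have "\<exists>g. g holomorphic_on UNIV \<and> (\<forall>\<zeta>. NX \<zeta> $ i = (\<zeta> - z) * (\<zeta> - cnj z) * g \<zeta>)" for i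
    using entire_divide_two_zeros[OF holN(2) zero(3,4) zz] by metis
  then obtain x where x: "\<And>i. x i holomorphic_on UNIV"
      "\<And>i \<zeta>. NX \<zeta> $ i = (\<zeta> - z) * (\<zeta> - cnj z) * x i \<zeta>" by metis
  define E1 where "E1 \<zeta> = (\<chi> i j. e i j \<zeta>)" for \<zeta>
  define X1 where "X1 \<zeta> = (\<chi> i. x i \<zeta>)" for \<zeta>
  have NE: "NE \<zeta> = ((\<zeta> - z) * (\<zeta> - cnj z)) *\<^sub>M E1 \<zeta>" and NX: "NX \<zeta> = ((\<zeta> - z) * (\<zeta> - cnj z)) *s X1 \<zeta>" for \<zeta>
    by (simp_all add: vec_eq_iff e(2) x(2) E1_def X1_def)
  have E1: "E1 \<zeta> = simple_elt z \<pi> \<zeta> ** E \<zeta> ** simple_elt (cnj z) P \<zeta>" if "\<zeta> \<notin> {z, cnj z}" for \<zeta>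
  proof (rule mscale_cancel)
    show "(\<zeta> - z) * (\<zeta> - cnj z) \<noteq> 0" using that by simp
    have "NE \<zeta> = ((\<zeta> - z) *\<^sub>M simple_elt z \<pi> \<zeta>) ** E \<zeta> ** ((\<zeta> - cnj z) *\<^sub>M simple_elt (cnj z) P \<zeta>)"
      using that by (simp add: NE_def T_def W_def simple_elt_spectral_mat)
    then show "((\<zeta> - z) * (\<zeta> - cnj z)) *\<^sub>M E1 \<zeta>
        = ((\<zeta> - z) * (\<zeta> - cnj z)) *\<^sub>M (simple_elt z \<pi> \<zeta> ** E \<zeta> ** simple_elt (cnj z) P \<zeta>)"
      by (simp add: NE mscale_mult mscale_mscale mult.commute)
  qed
  have X1: "X1 \<zeta> = simple_elt (cnj z) (mat 1 - \<pi>) \<zeta> *v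
      (X \<zeta> - ((cnj z - z) / (\<zeta> - z)) *s ((E \<zeta> ** P) *v \<eta>))" (is "_ = ?x") if "\<zeta> \<notin> {z, cnj z}" for \<zeta>
  proof -
    let ?v = "(E \<zeta> ** P) *v \<eta>"
    have nz: "\<zeta> - z \<noteq> 0" "\<zeta> - cnj z \<noteq> 0" using that by auto
    have 1: "(z - cnj z) *s ?v + (\<zeta> - z) *s X \<zeta> = (\<zeta> - z) *s (X \<zeta> - ((cnj z - z) / (\<zeta> - z)) *s ?v)"
      using nz by (simp add: vec_eq_iff field_simps)
    have 2: "T \<zeta> = (\<zeta> - cnj z) *\<^sub>M simple_elt (cnj z) (mat 1 - \<pi>) \<zeta>"
      using that nz by (simp add: T_def simple_elt_complement mscale_mscale simple_elt_spectral_mat[symmetric])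
    have "NX \<zeta> = ((\<zeta> - z) * (\<zeta> - cnj z)) *s ?x"
      unfolding NX_def 1 2 mscale_vector vector_scalar_commute vector_smult_assoc
      by (simp only: mult.commute)
    then show ?thesis using nz by (simp add: NX)
  qed
  have "unitary_frame E1 X1"
    unfolding unitary_frame_def
  proof (intro conjI allI)
    show "mat_holomorphic_on E1 UNIV" by (simp add: mat_holomorphic_on_def E1_def e)
    show "(\<lambda>\<zeta>. X1 \<zeta> $ i) holomorphic_on UNIV" for i by (simp add: X1_def x)
    \<comment> \<open>the reality condition passes to the two exceptional points by continuity\<close>
    have off: "conj_transpose (E1 (cnj \<zeta>)) ** E1 \<zeta> = mat 1" if \<zeta>: "\<zeta> \<notin> {z, cnj z}" for \<zeta>
    proof -
      have "cnj \<zeta> \<notin> {z, cnj z}" using \<zeta> by auto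
      then have "conj_transpose (E1 (cnj \<zeta>))
          = simple_elt z P \<zeta> ** conj_transpose (E (cnj \<zeta>)) ** simple_elt (cnj z) \<pi> \<zeta>"
        using conj_transpose_simple_elt[OF pi, of z] conj_transpose_simple_elt[OF img(1), of "cnj z"]
        by (simp add: E1 conj_transpose_mult matrix_mul_assoc)
      then have "conj_transpose (E1 (cnj \<zeta>)) ** E1 \<zeta> = simple_elt z P \<zeta> ** (conj_transpose (E (cnj \<zeta>)) **
          (simple_elt (cnj z) \<pi> \<zeta> ** simple_elt z \<pi> \<zeta>) ** E \<zeta>) ** simple_elt (cnj z) P \<zeta>"
        by (simp only: E1[OF \<zeta>] matrix_mul_assoc)
      also have "\<dots> = mat 1"
        using \<zeta> simple_elt_inverse[OF pi, of \<zeta> "cnj z"] simple_elt_inverse[OF img(1), of \<zeta> z]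
        by (simp add: E(2))
      finally show ?thesis .
    qed
    have "(\<Sum>k\<in>UNIV. cnj (E1 (cnj \<zeta>) $ k $ i) * E1 \<zeta> $ k $ j) = mat 1 $ i $ j" for i j \<zeta>
    proof (rule continuous_eq_const_off_finite[where S = "{z, cnj z}" and a = \<zeta>
          and f = "\<lambda>\<zeta>. \<Sum>k\<in>UNIV. cnj (E1 (cnj \<zeta>) $ k $ i) * E1 \<zeta> $ k $ j"])
      have c: "continuous_on UNIV (\<lambda>\<zeta>. E1 \<zeta> $ k $ l)" for k l
        using e by (simp add: E1_def holomorphic_on_imp_continuous_on)
      have "continuous_on UNIV (\<lambda>\<zeta>. cnj (E1 (cnj \<zeta>) $ k $ l))" for k l
        by (intro continuous_on_cnj continuous_on_compose2[OF c, of UNIV cnj]) (auto intro: continuous_intros)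
      then show "continuous_on UNIV (\<lambda>\<zeta>. \<Sum>k\<in>UNIV. cnj (E1 (cnj \<zeta>) $ k $ i) * E1 \<zeta> $ k $ j)"
        by (intro continuous_on_sum continuous_on_mult c)
      fix \<zeta> assume "\<zeta> \<notin> {z, cnj z}"
      from off[OF this] have "(conj_transpose (E1 (cnj \<zeta>)) ** E1 \<zeta>) $ i $ j = mat 1 $ i $ j" by simp
      then show "(\<Sum>k\<in>UNIV. cnj (E1 (cnj \<zeta>) $ k $ i) * E1 \<zeta> $ k $ j) = mat 1 $ i $ j"
        by (simp add: matrix_matrix_mult_def)
    qed simp
    then show "conj_transpose (E1 (cnj \<zeta>)) ** E1 \<zeta> = mat 1" for \<zeta>
      by (simp add: vec_eq_iff matrix_matrix_mult_def)
  qed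
  moreover have "is_dressing (simple_elt_ext z \<pi>) (\<lambda>\<zeta>. block_mat (E \<zeta>) (X \<zeta>) 1)
      (\<lambda>\<zeta>. block_mat (E1 \<zeta>) (X1 \<zeta>) 1)"
    unfolding is_dressing_def
  proof (intro conjI bexI)
    let ?g = "\<lambda>\<zeta>. block_mat (simple_elt z P \<zeta>) (((cnj z - z) / (\<zeta> - z)) *s (P *v \<eta>))
        ((\<zeta> - cnj z) / (\<zeta> - z))"
    show "simple_elt_ext z \<pi> \<in> Lambda_minus" "?g \<in> Lambda_minus"
      using z not_real_cnj_neq simple_elt_ext_in_Lambda_minus[OF pi]
        block_simple_elt_in_Lambda_minus[OF img(1)] by blast+
    show "(\<lambda>\<zeta>. block_mat (E \<zeta>) (X \<zeta>) 1) \<in> Lambda_plus" "(\<lambda>\<zeta>. block_mat (E1 \<zeta>) (X1 \<zeta>) 1) \<in> Lambda_plus"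
      using unitary_frame_in_Lambda_plus fr calculation by blast+
    have "simple_elt_ext z \<pi> \<zeta> ** block_mat (E \<zeta>) (X \<zeta>) 1 = block_mat (E1 \<zeta>) (X1 \<zeta>) 1 ** ?g \<zeta>"
      if \<zeta>: "\<zeta> \<notin> {z, cnj z}" for \<zeta>
    proof -
      let ?s = "(cnj z - z) / (\<zeta> - z)" and ?c = "(\<zeta> - cnj z) / (\<zeta> - z)"
      have 1: "E1 \<zeta> ** simple_elt z P \<zeta> = simple_elt z \<pi> \<zeta> ** E \<zeta>"
      proof -
        have "E1 \<zeta> ** simple_elt z P \<zeta>
            = simple_elt z \<pi> \<zeta> ** E \<zeta> ** (simple_elt (cnj z) P \<zeta> ** simple_elt z P \<zeta>)"
          by (simp only: E1[OF \<zeta>] matrix_mul_assoc)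
        then show ?thesis using \<zeta> simple_elt_inverse[OF img(1), of \<zeta> "cnj z"] by simp
      qed
      have "simple_elt (cnj z) P \<zeta> ** P = P"
        by (simp add: simple_elt_def matrix_add_rdistrib mscale_mult P)
      then have 2: "E1 \<zeta> *v (P *v \<eta>) = simple_elt z \<pi> \<zeta> *v ((E \<zeta> ** P) *v \<eta>)"
        by (simp add: E1[OF \<zeta>] matrix_vector_mul_assoc matrix_mul_assoc[symmetric])
      have 3: "?c *s X1 \<zeta> = simple_elt z \<pi> \<zeta> *v (X \<zeta> - ?s *s ((E \<zeta> ** P) *v \<eta>))"
        using \<zeta> by (simp add: X1 simple_elt_complement mscale_vector vector_smult_assoc)
      have "E1 \<zeta> *v (?s *s (P *v \<eta>)) + ?c *s X1 \<zeta> = simple_elt z \<pi> \<zeta> *v X \<zeta>"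
        unfolding 3 by (simp add: vector_scalar_commute 2 matrix_vector_mult_diff_distrib)
      then show ?thesis by (simp add: simple_elt_ext_def block_mat_mult block_mat_eq_iff 1)
    qed
    then show "\<forall>\<^sub>F \<zeta> in at_infinity.
        simple_elt_ext z \<pi> \<zeta> ** block_mat (E \<zeta>) (X \<zeta>) 1 = block_mat (E1 \<zeta>) (X1 \<zeta>) 1 ** ?g \<zeta>"
      using eventually_at_infinity_notin_finite[of "{z, cnj z}"] by (auto elim: eventually_mono)
  qed
  ultimately show thesis using that E1 X1 by blast
qed

section \<open>Differentiability at the exceptional spectral values\<close>

lemma bounded_bilinear_matrix_mult:
  "bounded_bilinear ((**) :: complex^'n^'m \<Rightarrow> complex^'k^'n \<Rightarrow> complex^'k^'m)"
  by (rule bilinear_conv_bounded_bilinear[THEN iffD1])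
    (auto simp: bilinear_def linear_iff vec_eq_iff matrix_matrix_mult_def scaleR_sum_right
      sum.distrib[symmetric] algebra_simps)

lemma bounded_bilinear_matrix_vector_mult:
  "bounded_bilinear ((*v) :: complex^'n^'m \<Rightarrow> complex^'n \<Rightarrow> complex^'m)"
  by (rule bilinear_conv_bounded_bilinear[THEN iffD1])
    (auto simp: bilinear_def linear_iff vec_eq_iff matrix_vector_mult_def scaleR_sum_right
      sum.distrib[symmetric] algebra_simps)

lemma bounded_linear_conj_transpose:
  "bounded_linear (conj_transpose :: complex^'n^'m \<Rightarrow> complex^'m^'n)"
  by (rule linear_conv_bounded_linear[THEN iffD1]) (auto simp: linear_iff vec_eq_iff)

lemma bounded_linear_mscale: "bounded_linear (\<lambda>A :: complex^'n^'m. c *\<^sub>M A)"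
  by (rule linear_conv_bounded_linear[THEN iffD1]) (auto simp: linear_iff vec_eq_iff algebra_simps)

lemma bounded_linear_vector_smult: "bounded_linear (\<lambda>x :: complex^'n. c *s x)"
  by (rule linear_conv_bounded_linear[THEN iffD1]) (auto simp: linear_iff vec_eq_iff algebra_simps)

lemma norm_mscale: "norm (c *\<^sub>M A) = cmod c * norm (A :: complex^'n^'m)"
proof -
  have row: "norm ((c *\<^sub>M A) $ i) = cmod c * norm (A $ i)" for i
    by (simp add: norm_vec_def mscale_def norm_mult L2_set_right_distrib)
  show ?thesis by (subst (1 2) norm_vec_def) (simp add: row L2_set_right_distrib)
qed

lemma matrix_entry_norm_le: "cmod (A $ i $ j) \<le> norm (A :: complex^'n^'m)"
  by (meson Finite_Cartesian_Product.norm_nth_le order_trans)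

lemma matrix_norm_le_card:
  fixes A :: "complex^'m^'m"
  assumes "\<And>i j. cmod (A $ i $ j) \<le> b"
  shows "norm A \<le> real (CARD('m) * CARD('m)) * b"
proof -
  have "norm A \<le> (\<Sum>i\<in>UNIV. norm (A $ i))" by (simp add: norm_vec_def L2_set_le_sum)
  also have "\<dots> \<le> (\<Sum>i\<in>(UNIV::'m set). \<Sum>j\<in>UNIV. cmod (A $ i $ j))"
    by (intro sum_mono) (simp add: norm_vec_def L2_set_le_sum)
  also have "\<dots> \<le> (\<Sum>i\<in>(UNIV::'m set). \<Sum>j\<in>(UNIV::'m set). b)"
    by (intro sum_mono assms)
  finally show ?thesis by (simp add: mult_ac)
qed

lemma mat_holomorphic_on_imp_continuous_on:
  assumes "mat_holomorphic_on G S"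
  shows "continuous_on S G"
  using assms holomorphic_on_imp_continuous_on
  unfolding mat_holomorphic_on_def continuous_on_def tendsto_matrix_iff by blast

text \<open>Let a family of entire matrix functions \<open>G(u, \<zeta>)\<close> satisfy a linear differential equation in
  \<open>u\<close>, with coefficients affine in \<open>\<zeta>\<close>, for all but finitely many \<open>\<zeta>\<close>. On a circle about an
  exceptional \<open>\<xi>\<close> the equation gives a bound on \<open>G\<close> that is uniform in \<open>\<zeta>\<close>, hence first order Taylor
  remainders in \<open>u\<close> that are small uniformly in \<open>\<zeta>\<close>. These remainders are entire in \<open>\<zeta>\<close>, so the
  maximum modulus principle carries the estimate to the centre \<open>\<xi>\<close>.\<close>

theorem has_derivative_at_exceptional_parameter:
  fixes G :: "'a::euclidean_space \<Rightarrow> complex \<Rightarrow> complex^'m^'m"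
    and L :: "'a \<Rightarrow> complex^'m^'m"
    and B :: "'a \<Rightarrow> 'p::real_normed_vector \<Rightarrow> complex^'m^'m"
  assumes "open \<Omega>" "u0 \<in> \<Omega>"
    and hol: "\<And>u. u \<in> \<Omega> \<Longrightarrow> mat_holomorphic_on (G u) UNIV"
    and L: "bounded_linear L" and B: "bounded_bilinear B" and p: "continuous_on \<Omega> p"
    and S: "finite S"
    and der: "\<And>u \<zeta>. u \<in> \<Omega> \<Longrightarrow> \<zeta> \<notin> S \<Longrightarrow>
        ((\<lambda>u. G u \<zeta>) has_derivative (\<lambda>v. G u \<zeta> ** (\<zeta> *\<^sub>M L v + B v (p u)))) (at u)"
  shows "((\<lambda>u. G u \<xi>) has_derivative (\<lambda>v. G u0 \<xi> ** (\<xi> *\<^sub>M L v + B v (p u0)))) (at u0)"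
proof -
  define \<omega> where "\<omega> \<zeta> u v = \<zeta> *\<^sub>M L v + B v (p u)" for \<zeta> u v
  interpret M: bounded_bilinear "(**) :: complex^'m^'m \<Rightarrow> complex^'m^'m \<Rightarrow> complex^'m^'m"
    by (rule bounded_bilinear_matrix_mult)
  interpret L: bounded_linear L by (rule L)
  interpret B: bounded_bilinear B by (rule B)
  obtain r where r: "r > 0" "\<And>\<zeta>. \<zeta> \<in> sphere \<xi> r \<Longrightarrow> \<zeta> \<notin> S"
  proof -
    obtain d where d: "d > 0" "\<forall>x\<in>S. x \<noteq> \<xi> \<longrightarrow> d \<le> dist \<xi> x" using finite_set_avoid[OF S] by blast
    show thesis
    proof (rule that)
      show "d / 2 > 0" using d by simp
      show "\<zeta> \<notin> S" if "\<zeta> \<in> sphere \<xi> (d / 2)" for \<zeta>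
      proof
        assume "\<zeta> \<in> S"
        moreover have "\<zeta> \<noteq> \<xi>" "dist \<xi> \<zeta> = d / 2" using that d(1) by auto
        ultimately show False using d by fastforce
      qed
    qed
  qed
  obtain K where "0 < K \<and> (\<forall>x y. norm (x ** y) \<le> norm (x :: complex^'m^'m) * norm (y :: complex^'m^'m) * K)"
    using M.pos_bounded ..
  then have K: "K > 0" "\<And>x y. norm (x ** y) \<le> norm (x :: complex^'m^'m) * norm (y :: complex^'m^'m) * K"
    by simp_all
  obtain KL where "0 < KL \<and> (\<forall>v. norm (L v) \<le> norm v * KL)" using L.pos_bounded ..
  then have KL: "KL > 0" "\<And>v. norm (L v) \<le> norm v * KL" by simp_all
  obtain KB where "0 < KB \<and> (\<forall>v q. norm (B v q) \<le> norm v * norm q * KB)" using B.pos_bounded ..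
  then have KB: "KB > 0" "\<And>v q. norm (B v q) \<le> norm v * norm q * KB" by simp_all
  define R where "R = cmod \<xi> + r"
  have R: "R > 0" "\<And>\<zeta>. \<zeta> \<in> sphere \<xi> r \<Longrightarrow> cmod \<zeta> \<le> R"
  proof -
    show "R > 0" using r(1) by (simp add: R_def add_nonneg_pos)
    show "cmod \<zeta> \<le> R" if "\<zeta> \<in> sphere \<xi> r" for \<zeta>
      using that norm_triangle_sub[of \<zeta> \<xi>] by (simp add: R_def dist_norm norm_minus_commute)
  qed
  have cont_p: "isCont p u0" using p assms(1,2) continuous_on_eq_continuous_at by blast
  obtain d0 where d0: "d0 > 0" "ball u0 d0 \<subseteq> \<Omega>" "\<And>u. u \<in> ball u0 d0 \<Longrightarrow> norm (p u) \<le> norm (p u0) + 1"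
  proof -
    obtain a where a: "a > 0" "ball u0 a \<subseteq> \<Omega>" using assms(1,2) openE by blast
    obtain b where b: "b > 0" "\<And>u. dist u u0 < b \<Longrightarrow> dist (p u) (p u0) < 1"
      using cont_p[unfolded continuous_at_eps_delta, rule_format, of 1] by auto
    have "norm (p u) \<le> norm (p u0) + 1" if "u \<in> ball u0 b" for u
    proof -
      have "norm (p u - p u0) < 1" using b(2)[of u] that by (simp add: dist_norm norm_minus_commute)
      then show ?thesis using norm_triangle_sub[of "p u" "p u0"] by linarith
    qed
    moreover have "ball u0 (min a b) \<subseteq> \<Omega>" using a(2) by auto
    ultimately show thesis using that[of "min a b"] a b by auto
  qed
  define C0 where "C0 = R * KL + (norm (p u0) + 1) * KB"
  have C0: "C0 > 0" unfolding C0_def using R KL KB by (intro add_pos_pos mult_pos_pos add_nonneg_pos) auto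
  have \<omega>_le: "norm (\<omega> \<zeta> u v) \<le> C0 * norm v" if "u \<in> ball u0 d0" "\<zeta> \<in> sphere \<xi> r" for u \<zeta> v
  proof -
    have "norm (\<omega> \<zeta> u v) \<le> cmod \<zeta> * norm (L v) + norm (B v (p u))"
      unfolding \<omega>_def by (metis norm_mscale norm_triangle_ineq)
    also have "\<dots> \<le> R * (norm v * KL) + norm v * (norm (p u0) + 1) * KB"
    proof (rule add_mono)
      show "cmod \<zeta> * norm (L v) \<le> R * (norm v * KL)"
        by (rule mult_mono) (use R(2)[OF that(2)] R(1) KL in auto)
      have "norm (B v (p u)) \<le> norm v * norm (p u) * KB" by (rule KB)
      also have "\<dots> \<le> norm v * (norm (p u0) + 1) * KB"
        by (intro mult_right_mono mult_left_mono d0(3)[OF that(1)]) (use KB in auto)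
      finally show "norm (B v (p u)) \<le> norm v * (norm (p u0) + 1) * KB" .
    qed
    finally show ?thesis by (simp add: C0_def algebra_simps)
  qed
  have lin: "bounded_linear (\<lambda>v. A ** \<omega> \<zeta> u v)" for A :: "complex^'m^'m" and \<zeta> u
  proof -
    have "bounded_linear (\<lambda>v. \<zeta> *\<^sub>M L v + B v (p u))"
      by (rule bounded_linear_add[OF bounded_linear_compose[OF bounded_linear_mscale L]
            B.bounded_linear_left])
    from bounded_linear_compose[OF M.bounded_linear_right this] show ?thesis by (simp add: \<omega>_def)
  qed
  have dG: "((\<lambda>u. G u \<zeta>) has_derivative (\<lambda>v. G u \<zeta> ** \<omega> \<zeta> u v)) (at u within T)"
    if "u \<in> ball u0 d0" "\<zeta> \<in> sphere \<xi> r" for u \<zeta> T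
    unfolding \<omega>_def using der[of u \<zeta>] that d0(2) r(2) has_derivative_at_withinI by blast
  define C where "C = K * C0"
  have C: "C > 0" unfolding C_def using K C0 by simp
  have G\<omega>_le: "norm (G u \<zeta> ** \<omega> \<zeta> u v) \<le> C * norm (G u \<zeta>) * norm v"
    if "u \<in> ball u0 d0" "\<zeta> \<in> sphere \<xi> r" for u \<zeta> v
  proof -
    have "norm (G u \<zeta> ** \<omega> \<zeta> u v) \<le> norm (G u \<zeta>) * norm (\<omega> \<zeta> u v) * K" by (rule K)
    also have "\<dots> \<le> norm (G u \<zeta>) * (C0 * norm v) * K"
      by (intro mult_right_mono mult_left_mono \<omega>_le that) (use K in auto)
    finally show ?thesis by (simp add: C_def mult_ac)
  qed
  \<comment> \<open>the choice \<open>C * d1 \<le> 1 / 2\<close> lets the supremum of \<open>G\<close> over this ball be absorbed below\<close>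
  define d1 where "d1 = min (d0 / 2) (1 / (2 * C))"
  have d1: "d1 > 0" "cball u0 d1 \<subseteq> ball u0 d0" "C * d1 \<le> 1 / 2"
  proof -
    show "d1 > 0" "cball u0 d1 \<subseteq> ball u0 d0" using d0 C by (auto simp: d1_def)
    have "C * d1 \<le> C * (1 / (2 * C))" using C by (intro mult_left_mono) (auto simp: d1_def)
    then show "C * d1 \<le> 1 / 2" using C by simp
  qed
  have lip: "norm (G u \<zeta> - G u' \<zeta>) \<le> C * m * norm (u - u')"
    if "\<zeta> \<in> sphere \<xi> r" "\<And>w. w \<in> cball u0 d1 \<Longrightarrow> norm (G w \<zeta>) \<le> m" "u \<in> cball u0 d1" "u' \<in> cball u0 d1"
    for u u' \<zeta> m
  proof (rule differentiable_bound)
    have m: "0 \<le> m" using that(2,3) norm_ge_zero order_trans by blast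
    fix w assume w: "w \<in> cball u0 d1"
    then have w': "w \<in> ball u0 d0" using d1(2) by blast
    show "((\<lambda>u. G u \<zeta>) has_derivative (\<lambda>v. G w \<zeta> ** \<omega> \<zeta> w v)) (at w within cball u0 d1)"
      by (rule dG[OF w' that(1)])
    show "onorm (\<lambda>v. G w \<zeta> ** \<omega> \<zeta> w v) \<le> C * m"
    proof (rule onorm_bound)
      fix v
      have "norm (G w \<zeta> ** \<omega> \<zeta> w v) \<le> C * norm (G w \<zeta>) * norm v" by (rule G\<omega>_le[OF w' that(1)])
      also have "\<dots> \<le> C * m * norm v"
        by (intro mult_right_mono mult_left_mono that(2) w) (use C in auto)
      finally show "norm (G w \<zeta> ** \<omega> \<zeta> w v) \<le> C * m * norm v" .
    qed (use C m in simp)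
  qed (use that in auto)
  obtain N where N: "N > 0" "\<And>\<zeta>. \<zeta> \<in> sphere \<xi> r \<Longrightarrow> norm (G u0 \<zeta>) \<le> N"
  proof -
    have "continuous_on (sphere \<xi> r) (G u0)"
      using mat_holomorphic_on_imp_continuous_on[OF hol[OF assms(2)]] continuous_on_subset by blast
    then have "bounded (G u0 ` sphere \<xi> r)"
      using compact_continuous_image compact_imp_bounded compact_sphere by blast
    then show thesis using that unfolding bounded_pos by blast
  qed
  have G_le: "norm (G u \<zeta>) \<le> 2 * N" if \<zeta>: "\<zeta> \<in> sphere \<xi> r" and u: "u \<in> cball u0 d1" for u \<zeta>
  proof -
    have "continuous_on (cball u0 d1) (\<lambda>u. norm (G u \<zeta>))"
    proof (intro continuous_on_norm, unfold continuous_on_eq_continuous_within, intro ballI)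
      fix w assume "w \<in> cball u0 d1"
      then have "w \<in> ball u0 d0" using d1(2) by blast
      from has_derivative_continuous[OF dG[OF this \<zeta>]]
      show "continuous (at w within cball u0 d1) (\<lambda>u. G u \<zeta>)" .
    qed
    then have "\<exists>w\<in>cball u0 d1. \<forall>y\<in>cball u0 d1. norm (G y \<zeta>) \<le> norm (G w \<zeta>)"
      using d1(1) by (intro continuous_attains_sup) auto
    then obtain w where w: "w \<in> cball u0 d1" "\<And>y. y \<in> cball u0 d1 \<Longrightarrow> norm (G y \<zeta>) \<le> norm (G w \<zeta>)"
      by blast
    have "norm (G w \<zeta> - G u0 \<zeta>) \<le> C * norm (G w \<zeta>) * norm (w - u0)"
      by (rule lip[OF \<zeta> w(2) w(1)]) (use d1 in auto)
    also have "\<dots> \<le> C * norm (G w \<zeta>) * d1"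
      using w(1) C by (intro mult_left_mono) (auto simp: dist_norm norm_minus_commute)
    also have "\<dots> = (C * d1) * norm (G w \<zeta>)" by simp
    also have "\<dots> \<le> 1 / 2 * norm (G w \<zeta>)" by (intro mult_right_mono d1(3)) auto
    finally have "norm (G w \<zeta>) \<le> 2 * norm (G u0 \<zeta>)"
      using norm_triangle_sub[of "G w \<zeta>" "G u0 \<zeta>"] by linarith
    then show ?thesis using w(2)[OF u] N(2)[OF \<zeta>] by linarith
  qed
  show ?thesis
    unfolding has_derivative_at_alt \<omega>_def[symmetric]
  proof (intro conjI allI impI)
    show "bounded_linear (\<lambda>v. G u0 \<xi> ** \<omega> \<xi> u0 v)" by (rule lin)
    fix e :: real assume e: "e > 0"
    define c where "c = real (CARD('m) * CARD('m))"
    have c: "c > 0" by (simp add: c_def)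
    define e' where "e' = e / c"
    have e': "e' > 0" using e c by (simp add: e'_def)
    \<comment> \<open>\<open>q\<close> and \<open>s\<close> give each of the two error terms in \<open>close\<close> the share \<open>e' / 2\<close>\<close>
    define q where "q = e' / (2 * (K * N * KB))"
    have q: "q > 0" unfolding q_def using e' K N KB by simp
    obtain b where b: "b > 0" "\<And>u. dist u u0 < b \<Longrightarrow> dist (p u) (p u0) < q"
      using cont_p[unfolded continuous_at_eps_delta] q by blast
    define s where "s = e' / (2 * (K * (C * (2 * N)) * C0))"
    have s: "s > 0" unfolding s_def using e' K N C C0 by simp
    define d2 where "d2 = min d1 (min b s)"
    have d2: "d2 > 0" "d2 \<le> d1" "d2 \<le> b" "d2 \<le> s" using d1 b s by (auto simp: d2_def)
    have close: "norm (G u \<zeta> ** \<omega> \<zeta> u v - G u0 \<zeta> ** \<omega> \<zeta> u0 v) \<le> e' * norm v"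
      if u: "u \<in> ball u0 d2" and \<zeta>: "\<zeta> \<in> sphere \<xi> r" for u \<zeta> v
    proof -
      have u1: "u \<in> cball u0 d1" using u d2 by auto
      then have u0: "u \<in> ball u0 d0" using d1(2) by blast
      have nu: "norm (u - u0) \<le> s" "norm (p u - p u0) \<le> q"
        using u d2 b(2)[of u] by (auto simp: dist_norm norm_minus_commute)
      have "G u \<zeta> ** \<omega> \<zeta> u v - G u0 \<zeta> ** \<omega> \<zeta> u0 v
          = (G u \<zeta> - G u0 \<zeta>) ** \<omega> \<zeta> u v + G u0 \<zeta> ** B v (p u - p u0)"
        by (simp add: \<omega>_def M.diff_left M.diff_right M.add_right B.diff_right)
      then have "norm (G u \<zeta> ** \<omega> \<zeta> u v - G u0 \<zeta> ** \<omega> \<zeta> u0 v)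
          \<le> norm ((G u \<zeta> - G u0 \<zeta>) ** \<omega> \<zeta> u v) + norm (G u0 \<zeta> ** B v (p u - p u0))"
        by (simp add: norm_triangle_ineq)
      also have "\<dots> \<le> (C * (2 * N) * s) * (C0 * norm v) * K + N * (norm v * q * KB) * K"
      proof (rule add_mono)
        have "norm (G u \<zeta> - G u0 \<zeta>) \<le> C * (2 * N) * norm (u - u0)"
          by (rule lip[OF \<zeta> G_le[OF \<zeta>] u1]) (use d1 in auto)
        also have "\<dots> \<le> C * (2 * N) * s" using nu C N by (intro mult_left_mono) auto
        finally have G: "norm (G u \<zeta> - G u0 \<zeta>) \<le> C * (2 * N) * s" .
        have "norm ((G u \<zeta> - G u0 \<zeta>) ** \<omega> \<zeta> u v) \<le> norm (G u \<zeta> - G u0 \<zeta>) * norm (\<omega> \<zeta> u v) * K"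
          by (rule K)
        also have "\<dots> \<le> (C * (2 * N) * s) * (C0 * norm v) * K"
          using C N s C0 K by (intro mult_right_mono mult_mono G \<omega>_le u0 \<zeta>) auto
        finally show "norm ((G u \<zeta> - G u0 \<zeta>) ** \<omega> \<zeta> u v) \<le> (C * (2 * N) * s) * (C0 * norm v) * K" .
        have "norm (B v (p u - p u0)) \<le> norm v * norm (p u - p u0) * KB" by (rule KB)
        also have "\<dots> \<le> norm v * q * KB"
          using nu KB by (intro mult_right_mono mult_left_mono) auto
        finally have B: "norm (B v (p u - p u0)) \<le> norm v * q * KB" .
        have "norm (G u0 \<zeta> ** B v (p u - p u0)) \<le> norm (G u0 \<zeta>) * norm (B v (p u - p u0)) * K"
          by (rule K)
        also have "\<dots> \<le> N * (norm v * q * KB) * K"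
          using N K by (intro mult_right_mono mult_mono B N(2) \<zeta>) auto
        finally show "norm (G u0 \<zeta> ** B v (p u - p u0)) \<le> N * (norm v * q * KB) * K" .
      qed
      also have "\<dots> = (s * (K * (C * (2 * N)) * C0) + q * (K * N * KB)) * norm v"
        by (simp add: algebra_simps)
      also have "s * (K * (C * (2 * N)) * C0) = e' / 2"
        unfolding s_def using K C N C0 by simp
      also have "q * (K * N * KB) = e' / 2"
        unfolding q_def using K N KB by simp
      finally show ?thesis by simp
    qed
    show "\<exists>d>0. \<forall>y. norm (y - u0) < d \<longrightarrow>
        norm (G y \<xi> - G u0 \<xi> - G u0 \<xi> ** \<omega> \<xi> u0 (y - u0)) \<le> e * norm (y - u0)"
    proof (intro exI conjI allI impI)
      show "d2 > 0" by (rule d2)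
      fix u assume "norm (u - u0) < d2"
      then have u: "u \<in> ball u0 d2" by (simp add: dist_norm norm_minus_commute)
      \<comment> \<open>the Taylor remainder, small on the circle and entire in \<open>\<zeta>\<close>\<close>
      define D where "D \<zeta> = G u \<zeta> - G u0 \<zeta> - G u0 \<zeta> ** \<omega> \<zeta> u0 (u - u0)" for \<zeta>
      have circle: "norm (D \<zeta>) \<le> norm (u - u0) * e'" if \<zeta>: "\<zeta> \<in> sphere \<xi> r" for \<zeta>
        unfolding D_def
      proof (rule differentiable_bound_linearization[where S = "ball u0 d2"
            and f = "\<lambda>u. G u \<zeta>" and f' = "\<lambda>u v. G u \<zeta> ** \<omega> \<zeta> u v"])
        show "u0 + t *\<^sub>R (u - u0) \<in> ball u0 d2" if "t \<in> {0..1}" for t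
        proof -
          have "norm (t *\<^sub>R (u - u0)) \<le> norm (u - u0)" using that by (simp add: mult_left_le_one_le)
          then show ?thesis using \<open>norm (u - u0) < d2\<close> by (simp add: dist_norm)
        qed
        show "u0 \<in> ball u0 d2" using d2 by simp
        fix w assume w: "w \<in> ball u0 d2"
        then have "w \<in> cball u0 d1" using d2 by auto
        then have "w \<in> ball u0 d0" using d1(2) by blast
        then show "((\<lambda>u. G u \<zeta>) has_derivative (\<lambda>v. G w \<zeta> ** \<omega> \<zeta> w v)) (at w within ball u0 d2)"
          by (rule dG[OF _ \<zeta>])
        show "onorm ((\<lambda>v. G w \<zeta> ** \<omega> \<zeta> w v) - (\<lambda>v. G u0 \<zeta> ** \<omega> \<zeta> u0 v)) \<le> e'"
          by (rule onorm_bound) (use close[OF w \<zeta>] e' in auto)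
      qed
      have "cmod (D \<xi> $ i $ j) \<le> norm (u - u0) * e'" for i j
      proof (rule maximum_modulus_frontier[where S = "cball \<xi> r" and f = "\<lambda>\<zeta>. D \<zeta> $ i $ j"])
        have "u \<in> cball u0 d1" using u d2 by auto
        then have uO: "u \<in> \<Omega>" using d1(2) d0(2) by blast
        have h: "(\<lambda>\<zeta>. G w \<zeta> $ k $ l) holomorphic_on UNIV" if "w \<in> \<Omega>" for w k l
          using hol[OF that] by (simp add: mat_holomorphic_on_def)
        have "(\<lambda>\<zeta>. D \<zeta> $ i $ j) holomorphic_on UNIV"
          unfolding D_def \<omega>_def matrix_matrix_mult_def
          by (auto intro!: holomorphic_intros h uO assms(2))
        then show "(\<lambda>\<zeta>. D \<zeta> $ i $ j) holomorphic_on interior (cball \<xi> r)"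
            "continuous_on (closure (cball \<xi> r)) (\<lambda>\<zeta>. D \<zeta> $ i $ j)"
          using holomorphic_on_subset holomorphic_on_imp_continuous_on continuous_on_subset by blast+
        fix \<zeta> assume "\<zeta> \<in> frontier (cball \<xi> r)"
        then have "\<zeta> \<in> sphere \<xi> r" by simp
        from circle[OF this] show "cmod (D \<zeta> $ i $ j) \<le> norm (u - u0) * e'"
          using matrix_entry_norm_le order_trans by blast
      qed (use r in auto)
      then have "norm (D \<xi>) \<le> c * (norm (u - u0) * e')" unfolding c_def by (rule matrix_norm_le_card)
      also have "\<dots> = e * norm (u - u0)" using c by (simp add: e'_def)
      finally show "norm (G u \<xi> - G u0 \<xi> - G u0 \<xi> ** \<omega> \<xi> u0 (u - u0)) \<le> e * norm (u - u0)"
        unfolding D_def .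
    qed
  qed
qed

section \<open>Variation of the dressed data with the base point\<close>

text \<open>At a zero of \<open>D\<close> the increment of \<open>g\<close> enters only through a term \<open>o(1) O(|u - x|)\<close>.\<close>

lemma has_derivative_mult_vanishing:
  assumes b: "bounded_bilinear b" and g: "isCont g x" and D: "(D has_derivative D') (at x)"
    and zero: "D x = 0"
  shows "((\<lambda>u. b (g u) (D u)) has_derivative (\<lambda>v. b (g x) (D' v))) (at x)"
proof -
  interpret bounded_bilinear b by (rule b)
  obtain K where K: "0 < K" "\<And>s t. norm (b s t) \<le> norm s * norm t * K" using pos_bounded by auto
  obtain K' where K': "0 < K'" "\<And>v. norm (D' v) \<le> norm v * K'"
    using bounded_linear.pos_bounded[OF has_derivative_bounded_linear[OF D]] by auto
  have "((\<lambda>u. b (g u - g x) (D u)) has_derivative (\<lambda>v. 0)) (at x)"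
    unfolding has_derivative_at_alt
  proof (intro conjI allI impI)
    fix e :: real assume e: "e > 0"
    define q where "q = e / ((1 + K') * K)"
    have q: "q > 0" using e K K' by (simp add: q_def add_pos_pos)
    obtain d1 where d1: "d1 > 0" "\<And>y. norm (y - x) < d1 \<Longrightarrow> norm (D y - D x - D' (y - x)) \<le> 1 * norm (y - x)"
      using D[unfolded has_derivative_at_alt] zero_less_one by blast
    obtain d2 where d2: "d2 > 0" "\<And>y. dist y x < d2 \<Longrightarrow> dist (g y) (g x) < q"
      using g[unfolded continuous_at_eps_delta] q by blast
    show "\<exists>d>0. \<forall>y. norm (y - x) < d \<longrightarrow>
        norm (b (g y - g x) (D y) - b (g x - g x) (D x) - 0) \<le> e * norm (y - x)"
    proof (intro exI[of _ "min d1 d2"] conjI allI impI)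
      fix y assume y: "norm (y - x) < min d1 d2"
      have "norm (D y) \<le> norm (D y - D' (y - x)) + norm (D' (y - x))"
        using norm_triangle_ineq[of "D y - D' (y - x)" "D' (y - x)"] by simp
      also have "\<dots> \<le> norm (y - x) + norm (y - x) * K'"
        using d1(2)[of y] y zero K'(2)[of "y - x"] by simp
      finally have D: "norm (D y) \<le> (1 + K') * norm (y - x)" by (simp add: algebra_simps)
      have "norm (b (g y - g x) (D y)) \<le> norm (g y - g x) * norm (D y) * K" by (rule K)
      also have "\<dots> \<le> q * ((1 + K') * norm (y - x)) * K"
        using d2(2)[of y] y K q by (intro mult_right_mono mult_mono D) (auto simp: dist_norm)
      also have "\<dots> = q * ((1 + K') * K) * norm (y - x)" by (simp add: mult_ac)
      also have "q * ((1 + K') * K) = e"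
      proof -
        have "(1 + K') * K \<noteq> 0" using K(1) K'(1) by auto
        then show ?thesis unfolding q_def by (rule nonzero_eq_divide_eq[THEN iffD1, OF _ refl])
      qed
      finally show "norm (b (g y - g x) (D y) - b (g x - g x) (D x) - 0) \<le> e * norm (y - x)"
        by (simp add: zero_right zero)
    qed (use d1 d2 in auto)
  qed simp
  moreover have "((\<lambda>u. b (g x) (D u)) has_derivative (\<lambda>v. b (g x) (D' v))) (at x)"
    by (rule bounded_linear.has_derivative[OF bounded_linear_right D])
  ultimately have "((\<lambda>u. b (g u - g x) (D u) + b (g x) (D u)) has_derivative (\<lambda>v. 0 + b (g x) (D' v))) (at x)"
    by (rule has_derivative_add)
  then show ?thesis by (simp add: diff_left)
qed

lemma norm_conj_transpose: "norm (conj_transpose A) \<le> real (CARD('n) * CARD('n)) * norm (A :: complex^'n^'n)"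
  by (rule matrix_norm_le_card) (simp add: matrix_entry_norm_le)

text \<open>The diagonal entries of \<open>P = P P\<^sup>*\<close> are the squared norms of the rows of \<open>P\<close>; in particular
  \<open>|P\<^sub>i\<^sub>i|\<^sup>2 \<le> P\<^sub>i\<^sub>i\<close>, so that all rows have norm at most one.\<close>

lemma hermitian_projection_norm_le:
  fixes P :: "complex^'n^'n"
  assumes "hermitian_projection P"
  shows "norm P \<le> real (CARD('n) * CARD('n)) * 1"
proof (rule matrix_norm_le_card)
  fix i j
  have "P $ i $ i = (P ** conj_transpose P) $ i $ i" using assms by (simp add: hermitian_projection_def)
  also have "\<dots> = of_real (\<Sum>k\<in>UNIV. (cmod (P $ i $ k))\<^sup>2)"
    by (simp add: matrix_matrix_mult_def complex_norm_square del: of_real_power)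
  finally have eq: "P $ i $ i = of_real (\<Sum>k\<in>UNIV. (cmod (P $ i $ k))\<^sup>2)" .
  have row: "(cmod (P $ i $ k))\<^sup>2 \<le> cmod (P $ i $ i)" for k
  proof -
    have "(cmod (P $ i $ k))\<^sup>2 \<le> (\<Sum>k\<in>UNIV. (cmod (P $ i $ k))\<^sup>2)"
      by (rule member_le_sum) auto
    also have "\<dots> = cmod (P $ i $ i)" by (subst eq) (simp only: norm_of_real, simp add: sum_nonneg)
    finally show ?thesis .
  qed
  have "cmod (P $ i $ i) \<le> 1"
  proof (rule ccontr)
    assume "\<not> cmod (P $ i $ i) \<le> 1"
    then have "cmod (P $ i $ i) * 1 < cmod (P $ i $ i) * cmod (P $ i $ i)"
      by (intro mult_strict_left_mono) auto
    then show False using row[of i] by (simp add: power2_eq_square)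
  qed
  then have "(cmod (P $ i $ j))\<^sup>2 \<le> 1" using row order_trans by blast
  then show "cmod (P $ i $ j) \<le> 1" by (simp add: abs_square_le_1)
qed

text \<open>For two Hermitian projections \<open>P\<close>, \<open>P\<^sub>0\<close> with the same ranges as the idempotents \<open>Q\<close>, \<open>Q\<^sub>0\<close> the
  identity \<open>P - P\<^sub>0 = (I - P)(Q - Q\<^sub>0)P\<^sub>0 + ((I - P\<^sub>0)(Q - Q\<^sub>0)P)\<^sup>*\<close> holds. As projections are bounded, it
  gives first continuity and then the derivative of \<open>P\<close> from that of \<open>Q\<close>.\<close>

lemma hermitian_projection_has_derivative:
  fixes P Q :: "'a::real_normed_vector \<Rightarrow> complex^'n^'n"
  assumes "open \<Omega>" "x \<in> \<Omega>" and P: "\<And>u. u \<in> \<Omega> \<Longrightarrow> hermitian_projection (P u)"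
    and PQ: "\<And>u. u \<in> \<Omega> \<Longrightarrow> P u ** Q u = Q u" and QP: "\<And>u. u \<in> \<Omega> \<Longrightarrow> Q u ** P u = P u"
    and Q: "(Q has_derivative Q') (at x)"
  shows "(P has_derivative (\<lambda>v. (mat 1 - P x) ** Q' v ** P x
      + conj_transpose ((mat 1 - P x) ** Q' v ** P x))) (at x)"
proof -
  interpret M: bounded_bilinear "(**) :: complex^'n^'n \<Rightarrow> complex^'n^'n \<Rightarrow> complex^'n^'n"
    by (rule bounded_bilinear_matrix_mult)
  interpret C: bounded_linear "conj_transpose :: complex^'n^'n \<Rightarrow> complex^'n^'n"
    by (rule bounded_linear_conj_transpose)
  define f where "f u = (mat 1 - P u) ** ((Q u - Q x) ** P x)
      + conj_transpose (((mat 1 - P x) ** (Q u - Q x)) ** P u)" for u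
  have diff: "P u - P x = f u" if u: "u \<in> \<Omega>" for u
  proof -
    note p = hermitian_projectionD[OF P[OF u]] and p0 = hermitian_projectionD[OF P[OF assms(2)]]
    have 1: "(mat 1 - P u) ** ((Q u - Q x) ** P x) = P u ** P x - P x"
      using PQ[OF u] QP[OF assms(2)] by (simp add: matrix_expand matrix_mul_assoc)
    have "((mat 1 - P x) ** (Q u - Q x)) ** P u = (mat 1 - P x) ** (Q u ** P u) - (Q x - P x ** Q x) ** P u"
      by (simp add: matrix_expand matrix_mul_assoc)
    then have "((mat 1 - P x) ** (Q u - Q x)) ** P u = P u - P x ** P u"
      using QP[OF u] PQ[OF assms(2)] by (simp add: matrix_expand)
    then show ?thesis
      unfolding f_def 1 by (simp add: conj_transpose_linear conj_transpose_mult p p0)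
  qed
  have cont: "isCont P x"
  proof -
    let ?c = "real (CARD('n) * CARD('n))"
    obtain K where K: "0 < K" "\<And>(s::complex^'n^'n) (t::complex^'n^'n). norm (s ** t) \<le> norm s * norm t * K"
      using M.pos_bounded by auto
    have cP: "norm (P u) \<le> ?c" "norm (mat 1 - P u) \<le> norm (mat 1 :: complex^'n^'n) + ?c" if "u \<in> \<Omega>" for u
    proof -
      show 1: "norm (P u) \<le> ?c" using hermitian_projection_norm_le[OF P[OF that]] by simp
      show "norm (mat 1 - P u) \<le> norm (mat 1 :: complex^'n^'n) + ?c"
        using norm_triangle_ineq4[of "mat 1" "P u"] 1 by linarith
    qed
    define m where "m = norm (mat 1 :: complex^'n^'n) + ?c"
    have m: "norm (P u) \<le> m" "norm (mat 1 - P u) \<le> m" if "u \<in> \<Omega>" for u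
      using cP[OF that] norm_ge_zero[of "mat 1 :: complex^'n^'n"] unfolding m_def by linarith+
    have m0: "m \<ge> 0" by (simp add: m_def)
    have b2: "norm (s ** (D ** t)) \<le> m * (norm D * m * K) * K" if "norm s \<le> m" "norm t \<le> m"
      for s D t :: "complex^'n^'n"
    proof -
      have "norm (s ** (D ** t)) \<le> norm s * norm (D ** t) * K" by (rule K)
      also have "\<dots> \<le> m * (norm D * m * K) * K"
      proof (intro mult_right_mono mult_mono that)
        have "norm (D ** t) \<le> norm D * norm t * K" by (rule K)
        also have "\<dots> \<le> norm D * m * K" by (intro mult_right_mono mult_left_mono that) (use K in auto)
        finally show "norm (D ** t) \<le> norm D * m * K" .
      qed (use m0 K in auto)
      finally show ?thesis .
    qed
    have bound: "norm (P u - P x) \<le> (1 + ?c) * (m * (norm (Q u - Q x) * m * K) * K)" if u: "u \<in> \<Omega>" for u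
    proof -
      have "norm (P u - P x) \<le> norm ((mat 1 - P u) ** ((Q u - Q x) ** P x))
          + ?c * norm ((mat 1 - P x) ** ((Q u - Q x) ** P u))"
        unfolding diff[OF u] f_def matrix_mul_assoc[symmetric]
        by (rule order_trans[OF norm_triangle_ineq add_left_mono[OF norm_conj_transpose]])
      also have "\<dots> \<le> (m * (norm (Q u - Q x) * m * K) * K) + ?c * (m * (norm (Q u - Q x) * m * K) * K)"
        using m[OF u] m[OF assms(2)] by (intro add_mono mult_left_mono b2) auto
      finally show ?thesis by (simp add: algebra_simps)
    qed
    have "isCont Q x" using Q has_derivative_continuous by blast
    then have "((\<lambda>u. (1 + ?c) * (m * (norm (Q u - Q x) * m * K) * K)) \<longlongrightarrow>
        (1 + ?c) * (m * (norm (Q x - Q x) * m * K) * K)) (at x)"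
      unfolding isCont_def by (intro tendsto_intros)
    then have lim: "((\<lambda>u. (1 + ?c) * (m * (norm (Q u - Q x) * m * K) * K)) \<longlongrightarrow> 0) (at x)" by simp
    have "\<forall>\<^sub>F u in at x. u \<in> \<Omega>" using assms(1,2) by (rule eventually_at_in_open')
    then have "\<forall>\<^sub>F u in at x. norm (P u - P x) \<le> (1 + ?c) * (m * (norm (Q u - Q x) * m * K) * K)"
      by eventually_elim (rule bound)
    then have "((\<lambda>u. P u - P x) \<longlongrightarrow> 0) (at x)"
      by (rule Lim_null_comparison[OF _ lim])
    then show ?thesis by (simp add: isCont_def LIM_zero_iff)
  qed
  have QQ: "((\<lambda>u. Q u - Q x) has_derivative Q') (at x)"
    using has_derivative_diff[OF Q has_derivative_const] by simp
  have 1: "((\<lambda>u. (mat 1 - P u) ** ((Q u - Q x) ** P x)) has_derivative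
      (\<lambda>v. (mat 1 - P x) ** (Q' v ** P x))) (at x)"
  proof (rule has_derivative_mult_vanishing[OF bounded_bilinear_matrix_mult])
    show "isCont (\<lambda>u. mat 1 - P u) x" using cont by (intro continuous_intros)
    show "((\<lambda>u. (Q u - Q x) ** P x) has_derivative (\<lambda>v. Q' v ** P x)) (at x)"
      by (rule bounded_linear.has_derivative[OF M.bounded_linear_left QQ])
  qed simp
  have "((\<lambda>u. ((mat 1 - P x) ** (Q u - Q x)) ** P u) has_derivative
      (\<lambda>v. ((mat 1 - P x) ** Q' v) ** P x)) (at x)"
  proof (rule has_derivative_mult_vanishing[OF bounded_bilinear.flip[OF bounded_bilinear_matrix_mult]])
    show "isCont P x" by (rule cont)
    show "((\<lambda>u. (mat 1 - P x) ** (Q u - Q x)) has_derivative (\<lambda>v. (mat 1 - P x) ** Q' v)) (at x)"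
      by (rule bounded_linear.has_derivative[OF M.bounded_linear_right QQ])
  qed simp
  then have 2: "((\<lambda>u. conj_transpose (((mat 1 - P x) ** (Q u - Q x)) ** P u)) has_derivative
      (\<lambda>v. conj_transpose (((mat 1 - P x) ** Q' v) ** P x))) (at x)"
    by (rule C.has_derivative)
  have "((\<lambda>u. P x + f u) has_derivative (\<lambda>v. 0 + ((mat 1 - P x) ** (Q' v ** P x)
      + conj_transpose (((mat 1 - P x) ** Q' v) ** P x)))) (at x)"
    unfolding f_def by (intro has_derivative_add has_derivative_const 1 2)
  then have "((\<lambda>u. P x + f u) has_derivative (\<lambda>v. (mat 1 - P x) ** Q' v ** P x
      + conj_transpose ((mat 1 - P x) ** Q' v ** P x))) (at x)"
    by (simp add: matrix_mul_assoc)
  then show ?thesis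
    by (rule has_derivative_transform_within_open[OF _ assms(1,2)]) (simp add: diff[symmetric])
qed

section \<open>Dressing a field of frames\<close>

definition frame_form :: "complex \<Rightarrow> complex^'n^'n \<Rightarrow> real^'n \<Rightarrow> complex^'n^'n" where
  "frame_form \<zeta> \<beta> v = (\<i> * \<zeta>) *\<^sub>M delta_form v + (delta_form v ** \<beta> - \<beta> ** delta_form v)"

lemma connection_form_eq: "connection_form \<zeta> \<beta> h v = block_mat (frame_form \<zeta> \<beta> v) (delta_form v *v h) 0"
  by (simp add: connection_form_def frame_form_def)

lemma frame_form_shift: "frame_form \<zeta> \<beta> v = frame_form w \<beta> v + (\<i> * (\<zeta> - w)) *\<^sub>M delta_form v"
  by (simp add: frame_form_def vec_eq_iff algebra_simps)

lemma delta_form_mult_nth: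
  "(delta_form v ** A) $ i $ j = of_real (v $ i) * A $ i $ j"
  "(A ** delta_form v) $ i $ j = A $ i $ j * of_real (v $ j)"
  by (simp_all add: matrix_matrix_mult_def delta_form_def if_distrib if_distribR cong: if_cong)

lemma conj_transpose_frame_form:
  assumes "conj_transpose \<beta> = \<beta>"
  shows "conj_transpose (frame_form \<zeta> \<beta> v) = - frame_form (cnj \<zeta>) \<beta> v"
proof -
  have "conj_transpose (delta_form v) = delta_form v" by (auto simp: vec_eq_iff delta_form_def)
  then show ?thesis
    using assms by (simp add: frame_form_def conj_transpose_linear conj_transpose_mult)
      (simp add: vec_eq_iff)
qed

lemma frame_form_dressed:
  "frame_form \<zeta> (\<beta> + c *\<^sub>M off_diag P) v
    = frame_form \<zeta> \<beta> v + c *\<^sub>M (delta_form v ** P - P ** delta_form v)"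
  by (auto simp: frame_form_def vec_eq_iff delta_form_mult_nth off_diag_def algebra_simps)

text \<open>Frame forms at different spectral values differ by multiples of \<open>delta_form v\<close>. Therefore the
  commutators with \<open>\<beta>\<close> cancel, and only multiples of \<open>\<delta> P\<close> and \<open>P \<delta> P\<close> survive. This is the
  reason why the dressed connection form is again affine in \<open>\<zeta>\<close>.\<close>

lemma projection_derivative_identity:
  fixes P :: "complex^'n^'n"
  assumes P: "P ** P = P" and dP: "dP = P ** frame_form (cnj z) \<beta> v ** (mat 1 - P) - (mat 1 - P) ** frame_form z \<beta> v ** P"
  shows "frame_form \<zeta> \<beta> v ** P + dP - P ** frame_form (cnj z) \<beta> v
    = (\<i> * (\<zeta> - z)) *\<^sub>M (delta_form v ** P) + (\<i> * (z - cnj z)) *\<^sub>M (P ** delta_form v ** P)"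
proof -
  let ?d = "delta_form v"
  define B where "B = frame_form 0 \<beta> v"
  have A: "frame_form w \<beta> v = B + (\<i> * w) *\<^sub>M ?d" for w using frame_form_shift[of w \<beta> v 0] by (simp add: B_def)
  show ?thesis
    unfolding dP A by (simp add: matrix_expand matrix_mul_assoc P)
      (simp add: vec_eq_iff algebra_simps)
qed

text \<open>Away from \<open>z\<close> and \<open>cnj z\<close> the dressed frame is \<open>g F W\<close> with \<open>W = c I + k R\<close>, where \<open>R\<close> has the rows
  \<open>(P  P \<eta>)\<close> and \<open>(0  0)\<close>, \<open>c = (\<zeta> - z) / (\<zeta> - cnj z)\<close> and \<open>k = 1 - c\<close>. With \<open>\<omega>\<close> the connection form of \<open>F\<close>, that
  of the dressed frame is \<open>\<omega>\<^sub>1\<close> precisely if \<open>\<omega> W + dW = W \<omega>\<^sub>1\<close>.\<close>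

lemma gauge_identity:
  fixes P :: "complex^'n^'n"
  assumes P: "P ** P = P"
    and dP: "dP = P ** frame_form (cnj z) \<beta> v ** (mat 1 - P) - (mat 1 - P) ** frame_form z \<beta> v ** P"
    and d\<eta>: "d\<eta> = delta_form v *v h - frame_form (cnj z) \<beta> v *v \<eta>"
    and k: "k * (\<zeta> - cnj z) = z - cnj z" and c: "c = 1 - k"
  shows "connection_form \<zeta> \<beta> h v ** block_mat (c *\<^sub>M mat 1 + k *\<^sub>M P) (k *s (P *v \<eta>)) c
      + k *\<^sub>M block_mat dP (dP *v \<eta> + P *v d\<eta>) 0
    = block_mat (c *\<^sub>M mat 1 + k *\<^sub>M P) (k *s (P *v \<eta>)) c **
      connection_form \<zeta> (\<beta> + (\<i> * (z - cnj z)) *\<^sub>M off_diag P) (h + (\<i> * (z - cnj z)) *s (P *v \<eta>)) v"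
proof -
  let ?A = "frame_form \<zeta> \<beta> v" and ?Ab = "frame_form (cnj z) \<beta> v" and ?d = "delta_form v"
  let ?m = "\<i> * (z - cnj z)"
  have key: "?A ** P + dP = P ** ?Ab + (\<i> * (\<zeta> - z)) *\<^sub>M (?d ** P) + ?m *\<^sub>M (P ** ?d ** P)"
    using projection_derivative_identity[OF P dP, of \<zeta>] by (simp add: algebra_simps)
  have Ab: "P ** ?Ab = P ** ?A + (\<i> * (cnj z - \<zeta>)) *\<^sub>M (P ** ?d)"
    by (subst frame_form_shift[of "cnj z" \<beta> v \<zeta>]) (simp add: matrix_expand)
  have "k * (\<zeta> - z) = k * (\<zeta> - cnj z) - k * (z - cnj z)" by (simp only: right_diff_distrib) simp
  then have k': "k * (\<zeta> - z) = (z - cnj z) * c" unfolding k c by (simp add: algebra_simps)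
  have 1: "?A ** (c *\<^sub>M mat 1 + k *\<^sub>M P) + k *\<^sub>M dP
      = (c *\<^sub>M mat 1 + k *\<^sub>M P) ** frame_form \<zeta> (\<beta> + ?m *\<^sub>M off_diag P) v"
  proof -
    have "?A ** (c *\<^sub>M mat 1 + k *\<^sub>M P) + k *\<^sub>M dP = c *\<^sub>M ?A + k *\<^sub>M (?A ** P + dP)"
      by (simp add: matrix_expand add.assoc)
    also have "\<dots> = c *\<^sub>M ?A + k *\<^sub>M (P ** ?A) + (\<i> * (k * (\<zeta> - z))) *\<^sub>M (?d ** P)
        + (k * ?m) *\<^sub>M (P ** ?d ** P) + (\<i> * (k * (cnj z - \<zeta>))) *\<^sub>M (P ** ?d)"
      unfolding key Ab by (simp add: vec_eq_iff algebra_simps)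
    also have "k * (cnj z - \<zeta>) = - ((z - cnj z) * c + k * (z - cnj z))"
      unfolding k'[symmetric] by (simp add: algebra_simps)
    also have "c *\<^sub>M ?A + k *\<^sub>M (P ** ?A) + (\<i> * (k * (\<zeta> - z))) *\<^sub>M (?d ** P) + (k * ?m) *\<^sub>M (P ** ?d ** P)
          + (\<i> * - ((z - cnj z) * c + k * (z - cnj z))) *\<^sub>M (P ** ?d)
        = (c *\<^sub>M mat 1 + k *\<^sub>M P) ** (?A + ?m *\<^sub>M (?d ** P - P ** ?d))"
      unfolding k' by (simp add: matrix_expand matrix_mul_assoc P vec_eq_iff algebra_simps)
    finally show ?thesis by (simp only: frame_form_dressed)
  qed
  have 2: "?A *v (k *s (P *v \<eta>)) + c *s (?d *v h) + k *s (dP *v \<eta> + P *v d\<eta>)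
      = (c *\<^sub>M mat 1 + k *\<^sub>M P) *v (?d *v (h + ?m *s (P *v \<eta>)))"
  proof -
    have "?A *v (k *s (P *v \<eta>)) + c *s (?d *v h) + k *s (dP *v \<eta> + P *v d\<eta>)
        = k *s ((?A ** P + dP) *v \<eta> - (P ** ?Ab) *v \<eta>) + c *s (?d *v h) + k *s (P *v (?d *v h))"
      unfolding d\<eta> by (simp add: matrix_vector_expand vec_eq_iff algebra_simps)
    also have "\<dots> = (\<i> * (k * (\<zeta> - z))) *s (?d *v (P *v \<eta>)) + (k * ?m) *s (P *v (?d *v (P *v \<eta>)))
        + c *s (?d *v h) + k *s (P *v (?d *v h))"
      unfolding key 
      by (simp add: matrix_vector_expand matrix_expand matrix_mul_assoc vec_eq_iff algebra_simps)
    also have "\<dots> = (c *\<^sub>M mat 1 + k *\<^sub>M P) *v (?d *v (h + ?m *s (P *v \<eta>)))"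
      unfolding k' 
      by (simp add: matrix_vector_expand matrix_expand matrix_mul_assoc vec_eq_iff algebra_simps)
    finally show ?thesis .
  qed
  have mb: "k *\<^sub>M block_mat A b d = block_mat (k *\<^sub>M A) (k *s b) (k * d)" for A :: "complex^'n^'n" and b d
    by (simp add: vec_eq_iff all_plus_iff)
  show ?thesis
    unfolding connection_form_eq block_mat_mult mb block_mat_add block_mat_eq_iff
    by (intro conjI) (rule 1, simp only: 2 vector_smult_lzero add_0_right, simp)
qed

text \<open>The properties of an extended frame that are inherited under dressing. Dressed data are complex
  in general; what remains of the reality of \<open>\<beta>\<close> is that it is Hermitian.\<close>

definition unitary_frame_field ::
  "(real^'n) set \<Rightarrow> (real^'n \<Rightarrow> complex^'n^'n) \<Rightarrow> (real^'n \<Rightarrow> complex^'n)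
    \<Rightarrow> (real^'n \<Rightarrow> complex \<Rightarrow> complex^'n^'n) \<Rightarrow> (real^'n \<Rightarrow> complex \<Rightarrow> complex^'n) \<Rightarrow> bool" where
  "unitary_frame_field \<Omega> \<beta> h E X \<longleftrightarrow>
     (\<forall>u\<in>\<Omega>. unitary_frame (E u) (X u) \<and> conj_transpose (\<beta> u) = \<beta> u) \<and>
     continuous_on \<Omega> \<beta> \<and> continuous_on \<Omega> h \<and>
     (\<forall>\<zeta>. \<forall>u\<in>\<Omega>. ((\<lambda>u. block_mat (E u \<zeta>) (X u \<zeta>) 1) has_derivative
        (\<lambda>v. block_mat (E u \<zeta>) (X u \<zeta>) 1 ** connection_form \<zeta> (\<beta> u) (h u) v)) (at u))"

lemma bounded_linear_block_mat:
  "bounded_linear (\<lambda>p. block_mat (fst p) (snd p) 0 :: complex^('n::finite + 1)^('n + 1))"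
  by (rule linear_conv_bounded_linear[THEN iffD1])
    (auto simp: linear_iff vec_eq_iff all_plus_iff)

lemma has_derivative_blocks:
  fixes E :: "'a::real_normed_vector \<Rightarrow> complex^'n^'n"
  assumes "((\<lambda>u. block_mat (E u) (X u) 1) has_derivative (\<lambda>v. block_mat (E' v) (X' v) 0)) (at x)"
  shows "(E has_derivative E') (at x)" "(X has_derivative X') (at x)"
proof -
  have 1: "bounded_linear (\<lambda>M::complex^('n + 1)^('n + 1). \<chi> i j. M $ Inl i $ Inl j)"
    by (rule linear_conv_bounded_linear[THEN iffD1]) (auto simp: linear_iff vec_eq_iff)
  have 2: "bounded_linear (\<lambda>M::complex^('n + 1)^('n + 1). \<chi> i. M $ Inl i $ Inr 1)"
    by (rule linear_conv_bounded_linear[THEN iffD1]) (auto simp: linear_iff vec_eq_iff)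
  have "(\<chi> i j. block_mat A b d $ Inl i $ Inl j) = A" "(\<chi> i. block_mat A b d $ Inl i $ Inr 1) = b"
    for A b d by (simp_all add: vec_eq_iff)
  then show "(E has_derivative E') (at x)" "(X has_derivative X') (at x)"
    using bounded_linear.has_derivative[OF 1 assms] bounded_linear.has_derivative[OF 2 assms]
    by simp_all
qed

lemma unitary_frame_field_derivatives:
  assumes "unitary_frame_field \<Omega> \<beta> h E X" "u \<in> \<Omega>"
  shows "((\<lambda>u. E u \<zeta>) has_derivative (\<lambda>v. E u \<zeta> ** frame_form \<zeta> (\<beta> u) v)) (at u)"
    and "((\<lambda>u. X u \<zeta>) has_derivative (\<lambda>v. E u \<zeta> *v (delta_form v *v h u))) (at u)"
proof -
  have "((\<lambda>u. block_mat (E u \<zeta>) (X u \<zeta>) 1) has_derivative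
        (\<lambda>v. block_mat (E u \<zeta>) (X u \<zeta>) 1 ** connection_form \<zeta> (\<beta> u) (h u) v)) (at u)"
    using assms unfolding unitary_frame_field_def by blast
  then have d: "((\<lambda>u. block_mat (E u \<zeta>) (X u \<zeta>) 1) has_derivative
      (\<lambda>v. block_mat (E u \<zeta> ** frame_form \<zeta> (\<beta> u) v) (E u \<zeta> *v (delta_form v *v h u)) 0)) (at u)"
    by (simp add: connection_form_eq block_mat_mult)
  show "((\<lambda>u. E u \<zeta>) has_derivative (\<lambda>v. E u \<zeta> ** frame_form \<zeta> (\<beta> u) v)) (at u)"
    and "((\<lambda>u. X u \<zeta>) has_derivative (\<lambda>v. E u \<zeta> *v (delta_form v *v h u))) (at u)"
    by (rule has_derivative_blocks[OF d])+
qed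

text \<open>The range of \<open>P(u)\<close> is that of the oblique projection \<open>Q = E\<^sup>-\<^sup>1 \<pi> E\<close> taken at \<open>z\<close>, which
  satisfies \<open>dQ = [Q, A]\<close> for the frame form \<open>A\<close> at \<open>z\<close>.\<close>

lemma dressed_projection_has_derivative:
  fixes z :: complex
  assumes fr: "unitary_frame_field \<Omega> \<beta> h E X" and "open \<Omega>" "u \<in> \<Omega>" and pi: "hermitian_projection \<pi>"
  defines "P \<equiv> dressed_projection E z \<pi>"
  shows "hermitian_projection (P u)"
    and "(P has_derivative (\<lambda>v. P u ** frame_form (cnj z) (\<beta> u) v ** (mat 1 - P u)
      - (mat 1 - P u) ** frame_form z (\<beta> u) v ** P u)) (at u)"
proof -
  define Q where "Q w = conj_transpose (E w (cnj z)) ** (\<pi> ** E w z)" for w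
  have props: "hermitian_projection (P w) \<and> P w ** Q w = Q w \<and> Q w ** P w = P w" if "w \<in> \<Omega>" for w
  proof -
    have f: "unitary_frame (E w) (X w)" using fr that by (simp add: unitary_frame_field_def)
    note E = unitary_frameD[OF f]
    have img: "hermitian_projection (P w)" "P w ** matrix_inv (E w z) ** \<pi> = matrix_inv (E w z) ** \<pi>"
      "\<pi> ** E w z ** P w = E w z ** P w"
      unfolding P_def dressed_projection_def
      by (rule hermitian_projection_onto_image[OF pi matrix_inv_mult(2)[OF E(4)]])+
    have "P w ** Q w = P w ** matrix_inv (E w z) ** \<pi> ** E w z"
      unfolding Q_def E(3)[symmetric] by (simp only: matrix_mul_assoc)
    also have "\<dots> = Q w" unfolding img(2) unfolding Q_def E(3)[symmetric] by (simp only: matrix_mul_assoc)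
    finally have 1: "P w ** Q w = Q w" .
    have "Q w ** P w = matrix_inv (E w z) ** (\<pi> ** E w z ** P w)"
      unfolding Q_def E(3)[symmetric] by (simp only: matrix_mul_assoc)
    also have "\<dots> = P w" unfolding img(3) by (simp add: matrix_mul_assoc matrix_inv_mult E(4))
    finally show ?thesis using img(1) 1 by blast
  qed
  then show "hermitian_projection (P u)" using assms(3) by blast
  have herm: "conj_transpose (\<beta> u) = \<beta> u" using fr assms(3) by (simp add: unitary_frame_field_def)
  let ?A = "frame_form z (\<beta> u)" and ?Ab = "frame_form (cnj z) (\<beta> u)"
  have cA: "conj_transpose (?Ab v) = - ?A v" "conj_transpose (?A v) = - ?Ab v" for v
    using conj_transpose_frame_form[OF herm, of "cnj z" v] conj_transpose_frame_form[OF herm, of z v]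
    by simp_all
  have "((\<lambda>w. conj_transpose (E w (cnj z)) ** (\<pi> ** E w z)) has_derivative
      (\<lambda>v. conj_transpose (E u (cnj z)) ** (\<pi> ** (E u z ** ?A v))
        + conj_transpose (E u (cnj z) ** ?Ab v) ** (\<pi> ** E u z))) (at u)"
    by (intro bounded_bilinear.FDERIV[OF bounded_bilinear_matrix_mult]
        bounded_linear.has_derivative[OF bounded_linear_conj_transpose]
        bounded_linear.has_derivative[OF bounded_bilinear.bounded_linear_right[OF bounded_bilinear_matrix_mult]]
        unitary_frame_field_derivatives[OF fr assms(3)])
  moreover have "conj_transpose (E u (cnj z)) ** (\<pi> ** (E u z ** ?A v))
        + conj_transpose (E u (cnj z) ** ?Ab v) ** (\<pi> ** E u z) = Q u ** ?A v - ?A v ** Q u" for v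
    by (simp add: Q_def conj_transpose_mult cA matrix_mul_assoc matrix_uminus_mult)
  ultimately have dQ: "(Q has_derivative (\<lambda>v. Q u ** ?A v - ?A v ** Q u)) (at u)"
    by (simp add: Q_def[abs_def])
  have "(P has_derivative (\<lambda>v. (mat 1 - P u) ** (Q u ** ?A v - ?A v ** Q u) ** P u
      + conj_transpose ((mat 1 - P u) ** (Q u ** ?A v - ?A v ** Q u) ** P u))) (at u)"
    by (rule hermitian_projection_has_derivative[OF assms(2,3) _ _ _ dQ]) (use props in auto)
  moreover have "(mat 1 - P u) ** (Q u ** ?A v - ?A v ** Q u) ** P u
      + conj_transpose ((mat 1 - P u) ** (Q u ** ?A v - ?A v ** Q u) ** P u)
    = P u ** ?Ab v ** (mat 1 - P u) - (mat 1 - P u) ** ?A v ** P u" for v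
  proof -
    note p = hermitian_projectionD[OF conjunct1[OF props[OF assms(3)]]]
    have "(mat 1 - P u) ** Q u = 0" using props[OF assms(3)] by (simp add: matrix_expand)
    moreover have "(mat 1 - P u) ** (Q u ** ?A v - ?A v ** Q u) ** P u
        = ((mat 1 - P u) ** Q u) ** ?A v ** P u - (mat 1 - P u) ** ?A v ** (Q u ** P u)"
      by (simp only: matrix_diff_ldistrib matrix_diff_rdistrib matrix_mul_assoc)
    ultimately have 1: "(mat 1 - P u) ** (Q u ** ?A v - ?A v ** Q u) ** P u
        = - ((mat 1 - P u) ** ?A v ** P u)"
      using props[OF assms(3)] by simp
    show ?thesis
      unfolding 1 by (simp add: conj_transpose_linear conj_transpose_mult cA p matrix_expand matrix_mul_assoc)
  qed
  ultimately show "(P has_derivative (\<lambda>v. P u ** ?Ab v ** (mat 1 - P u)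
      - (mat 1 - P u) ** ?A v ** P u)) (at u)" by simp
qed

lemma eta_vec_has_derivative:
  assumes fr: "unitary_frame_field \<Omega> \<beta> h E X" and "open \<Omega>" "u \<in> \<Omega>"
  shows "(eta_vec E X z has_derivative
    (\<lambda>v. delta_form v *v h u - frame_form (cnj z) (\<beta> u) v *v eta_vec E X z u)) (at u)"
proof -
  have eta: "eta_vec E X z w = conj_transpose (E w z) *v X w (cnj z)" if "w \<in> \<Omega>" for w
    using unitary_frameD(3)[of "E w" "X w" "cnj z"] fr that
    by (simp add: eta_vec_def unitary_frame_field_def)
  have f: "unitary_frame (E u) (X u)" and herm: "conj_transpose (\<beta> u) = \<beta> u"
    using fr assms(3) by (simp_all add: unitary_frame_field_def)
  have "((\<lambda>w. conj_transpose (E w z) *v X w (cnj z)) has_derivative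
      (\<lambda>v. conj_transpose (E u z) *v (E u (cnj z) *v (delta_form v *v h u))
        + conj_transpose (E u z ** frame_form z (\<beta> u) v) *v X u (cnj z))) (at u)"
    by (intro bounded_bilinear.FDERIV[OF bounded_bilinear_matrix_vector_mult]
        bounded_linear.has_derivative[OF bounded_linear_conj_transpose]
        unitary_frame_field_derivatives[OF fr assms(3)])
  moreover have "conj_transpose (E u z) *v (E u (cnj z) *v (delta_form v *v h u))
        + conj_transpose (E u z ** frame_form z (\<beta> u) v) *v X u (cnj z)
      = delta_form v *v h u - frame_form (cnj z) (\<beta> u) v *v eta_vec E X z u" for v
  proof -
    have "conj_transpose (E u z) *v (E u (cnj z) *v (delta_form v *v h u)) = delta_form v *v h u"
      using unitary_frameD(2)[OF f, of "cnj z"] by (simp add: matrix_vector_mul_assoc[of _ "E u (cnj z)"])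
    then show ?thesis
      by (simp add: conj_transpose_mult conj_transpose_frame_form[OF herm] eta[OF assms(3)]
          matrix_vector_mul_assoc[symmetric] matrix_vector_uminus)
  qed
  ultimately have "((\<lambda>w. conj_transpose (E w z) *v X w (cnj z)) has_derivative
      (\<lambda>v. delta_form v *v h u - frame_form (cnj z) (\<beta> u) v *v eta_vec E X z u)) (at u)" by simp
  then show ?thesis
    by (rule has_derivative_transform_within_open[OF _ assms(2,3)]) (simp add: eta)
qed

lemma bounded_linear_off_diag: "bounded_linear (off_diag :: complex^'n^'n \<Rightarrow> complex^'n^'n)"
  by (rule linear_conv_bounded_linear[THEN iffD1]) (auto simp: linear_iff vec_eq_iff off_diag_def)

lemma delta_form_vector_nth: "(delta_form v *v x) $ i = of_real (v $ i) * x $ i"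
  by (simp add: matrix_vector_mult_def delta_form_def if_distrib if_distribR cong: if_cong)

lemma bounded_bilinear_connection_form_0:
  "bounded_bilinear (\<lambda>v p. connection_form 0 (fst p) (snd p) v)"
  by (rule bilinear_conv_bounded_bilinear[THEN iffD1])
    (auto simp: bilinear_def linear_iff connection_form_eq frame_form_def vec_eq_iff all_plus_iff
      delta_form_mult_nth delta_form_vector_nth scaleR_conv_of_real[where 'a = complex] algebra_simps)

lemma connection_form_split:
  "connection_form \<zeta> \<beta> h v = \<zeta> *\<^sub>M block_mat (\<i> *\<^sub>M delta_form v) 0 0 + connection_form 0 \<beta> h v"
  by (simp add: connection_form_eq frame_form_def vec_eq_iff all_plus_iff)

text \<open>The derivative of \<open>F\<^sub>1 = g F W\<close> is \<open>g F (\<omega> W + dW)\<close>, to which the gauge identity applies for \<open>\<zeta>\<close> different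
  from \<open>z\<close> and \<open>cnj z\<close>. Since the connection form is affine in \<open>\<zeta>\<close> with continuous coefficients, the
  equation extends to these two values.\<close>

theorem dressing_frame_field:
  assumes fr: "unitary_frame_field \<Omega> \<beta> h E X" and \<Omega>: "open \<Omega>" and z: "z \<notin> \<real>"
    and pi: "hermitian_projection \<pi>"
  defines "P \<equiv> dressed_projection E z \<pi>" and "\<eta> \<equiv> eta_vec E X z"
  defines "\<beta>1 \<equiv> \<lambda>u. \<beta> u + (\<i> * (z - cnj z)) *\<^sub>M off_diag (P u)"
    and "h1 \<equiv> \<lambda>u. h u + (\<i> * (z - cnj z)) *s (P u *v \<eta> u)"
  obtains E1 X1 where "unitary_frame_field \<Omega> \<beta>1 h1 E1 X1"
    "\<And>u. u \<in> \<Omega> \<Longrightarrow> is_dressing (simple_elt_ext z \<pi>) (\<lambda>\<zeta>. block_mat (E u \<zeta>) (X u \<zeta>) 1)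
        (\<lambda>\<zeta>. block_mat (E1 u \<zeta>) (X1 u \<zeta>) 1)"
    "\<And>u \<zeta>. u \<in> \<Omega> \<Longrightarrow> \<zeta> \<notin> {z, cnj z} \<Longrightarrow>
        E1 u \<zeta> = simple_elt z \<pi> \<zeta> ** E u \<zeta> ** simple_elt (cnj z) (P u) \<zeta>"
    "\<And>u \<zeta>. u \<in> \<Omega> \<Longrightarrow> \<zeta> \<notin> {z, cnj z} \<Longrightarrow> X1 u \<zeta> = simple_elt (cnj z) (mat 1 - \<pi>) \<zeta> *v
        (X u \<zeta> - ((cnj z - z) / (\<zeta> - z)) *s ((E u \<zeta> ** P u) *v \<eta> u))"
proof -
  let ?step = "\<lambda>u E1 X1. unitary_frame E1 X1 \<and>
      is_dressing (simple_elt_ext z \<pi>) (\<lambda>\<zeta>. block_mat (E u \<zeta>) (X u \<zeta>) 1) (\<lambda>\<zeta>. block_mat (E1 \<zeta>) (X1 \<zeta>) 1) \<and>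
      (\<forall>\<zeta>. \<zeta> \<notin> {z, cnj z} \<longrightarrow> E1 \<zeta> = simple_elt z \<pi> \<zeta> ** E u \<zeta> ** simple_elt (cnj z) (P u) \<zeta>) \<and>
      (\<forall>\<zeta>. \<zeta> \<notin> {z, cnj z} \<longrightarrow> X1 \<zeta> = simple_elt (cnj z) (mat 1 - \<pi>) \<zeta> *v
        (X u \<zeta> - ((cnj z - z) / (\<zeta> - z)) *s ((E u \<zeta> ** P u) *v \<eta> u)))"
  have "\<forall>u\<in>\<Omega>. \<exists>p. ?step u (fst p) (snd p)"
  proof
    fix u assume "u \<in> \<Omega>"
    then have f: "unitary_frame (E u) (X u)" using fr by (simp add: unitary_frame_field_def)
    have "\<exists>E1 X1. ?step u E1 X1"
      unfolding P_def \<eta>_def dressed_projection_def eta_vec_def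
      by (rule dressing_by_simple_element[OF f z pi]) blast
    then show "\<exists>p. ?step u (fst p) (snd p)" by auto
  qed
  from bchoice[OF this] obtain p where p: "\<forall>u\<in>\<Omega>. ?step u (fst (p u)) (snd (p u))" ..
  define E1 where "E1 u = fst (p u)" for u
  define X1 where "X1 u = snd (p u)" for u
  have step: "?step u (E1 u) (X1 u)" if "u \<in> \<Omega>" for u
    using p that unfolding E1_def X1_def by blast
  note dP = dressed_projection_has_derivative[OF fr \<Omega> _ pi, where z = z, folded P_def]
  note d\<eta> = eta_vec_has_derivative[OF fr \<Omega>, where z = z, folded \<eta>_def]
  have zz: "z \<noteq> cnj z" using z not_real_cnj_neq by blast
  have contP: "continuous_on \<Omega> P"
    by (intro continuous_at_imp_continuous_on ballI) (rule has_derivative_continuous[OF dP(2)])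
  have cont\<eta>: "continuous_on \<Omega> \<eta>"
    by (intro continuous_at_imp_continuous_on ballI) (rule has_derivative_continuous[OF d\<eta>])
  have cont\<beta>: "continuous_on \<Omega> \<beta>1"
    unfolding \<beta>1_def using fr contP
    by (intro continuous_on_add bounded_linear.continuous_on[OF bounded_linear_mscale]
        bounded_linear.continuous_on[OF bounded_linear_off_diag]) (auto simp: unitary_frame_field_def)
  have conth: "continuous_on \<Omega> h1"
    unfolding h1_def using fr contP cont\<eta>
    by (intro continuous_on_add bounded_linear.continuous_on[OF bounded_linear_vector_smult]
        bounded_bilinear.continuous_on[OF bounded_bilinear_matrix_vector_mult])
      (auto simp: unitary_frame_field_def)
  have herm: "conj_transpose (\<beta>1 u) = \<beta>1 u" if "u \<in> \<Omega>" for u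
  proof -
    have "conj_transpose (off_diag (P u)) = off_diag (conj_transpose (P u))"
      by (auto simp: vec_eq_iff off_diag_def)
    moreover have "cnj (\<i> * (z - cnj z)) = \<i> * (z - cnj z)" by (simp add: algebra_simps)
    ultimately show ?thesis
      using fr that hermitian_projectionD(2)[OF dP(1)[OF that]]
      by (simp only: \<beta>1_def conj_transpose_linear unitary_frame_field_def)
  qed
  have off: "((\<lambda>u. block_mat (E1 u \<zeta>) (X1 u \<zeta>) 1) has_derivative
      (\<lambda>v. block_mat (E1 u \<zeta>) (X1 u \<zeta>) 1 ** connection_form \<zeta> (\<beta>1 u) (h1 u) v)) (at u)"
    if u: "u \<in> \<Omega>" and \<zeta>: "\<zeta> \<notin> {z, cnj z}" for u \<zeta>
  proof -
    define c where "c = (\<zeta> - z) / (\<zeta> - cnj z)"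
    define k where "k = (z - cnj z) / (\<zeta> - cnj z)"
    have nz: "\<zeta> - z \<noteq> 0" "\<zeta> - cnj z \<noteq> 0" using \<zeta> by auto
    have k: "k * (\<zeta> - cnj z) = z - cnj z" and c: "c = 1 - k"
      using nz by (simp_all add: k_def c_def field_simps)
    define T where "T = simple_elt_ext z \<pi> \<zeta>"
    define F where "F w = block_mat (E w \<zeta>) (X w \<zeta>) 1" for w
    define W where "W w = block_mat (c *\<^sub>M mat 1 + k *\<^sub>M P w) (k *s (P w *v \<eta> w)) c" for w
    have F1: "T ** (F w ** W w) = block_mat (E1 w \<zeta>) (X1 w \<zeta>) 1" if w: "w \<in> \<Omega>" for w
    proof -
      have 1: "simple_elt (cnj z) (P w) \<zeta> = c *\<^sub>M mat 1 + k *\<^sub>M P w"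
        unfolding c by (simp add: simple_elt_def c_def[symmetric] vec_eq_iff) (simp add: c algebra_simps)
      have sc: "simple_elt (cnj z) (mat 1 - \<pi>) \<zeta> = c *\<^sub>M simple_elt z \<pi> \<zeta>"
        using \<zeta> by (simp add: simple_elt_complement c_def)
      have ck: "c * ((cnj z - z) / (\<zeta> - z)) = - k" using nz(1) by (simp add: c_def k_def minus_divide_left)
      have "X1 w \<zeta> = simple_elt (cnj z) (mat 1 - \<pi>) \<zeta> *v
          (X w \<zeta> - ((cnj z - z) / (\<zeta> - z)) *s ((E w \<zeta> ** P w) *v \<eta> w))"
        using step[OF w] \<zeta> by blast
      also have "\<dots> = c *s (simple_elt z \<pi> \<zeta> *v X w \<zeta>)
          - (c * ((cnj z - z) / (\<zeta> - z))) *s (simple_elt z \<pi> \<zeta> *v ((E w \<zeta> ** P w) *v \<eta> w))"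
        by (simp only: sc mscale_vector matrix_vector_mult_diff_distrib vector_scalar_commute
            vector_ssub_ldistrib vector_smult_assoc mult.commute)
      also have "\<dots> = simple_elt z \<pi> \<zeta> *v (E w \<zeta> *v (k *s (P w *v \<eta> w)) + c *s X w \<zeta>)"
        unfolding ck by (simp add: matrix_vector_right_distrib vector_scalar_commute
            matrix_vector_mul_assoc matrix_mul_assoc vector_smult_lneg)
      finally have X1: "X1 w \<zeta> = simple_elt z \<pi> \<zeta> *v (E w \<zeta> *v (k *s (P w *v \<eta> w)) + c *s X w \<zeta>)" .
      have E1: "E1 w \<zeta> = simple_elt z \<pi> \<zeta> ** (E w \<zeta> ** (c *\<^sub>M mat 1 + k *\<^sub>M P w))"
        using step[OF w] \<zeta> 1 by (simp add: matrix_mul_assoc)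
      have "(\<zeta> - cnj z) / (\<zeta> - z) * c = 1" using nz by (simp add: c_def)
      then show ?thesis
        by (simp add: T_def F_def W_def simple_elt_ext_def block_mat_mult block_mat_eq_iff E1 X1)
    qed
    let ?dP = "\<lambda>v. P u ** frame_form (cnj z) (\<beta> u) v ** (mat 1 - P u)
        - (mat 1 - P u) ** frame_form z (\<beta> u) v ** P u"
    let ?d\<eta> = "\<lambda>v. delta_form v *v h u - frame_form (cnj z) (\<beta> u) v *v \<eta> u"
    have "((\<lambda>w. P w *v \<eta> w) has_derivative (\<lambda>v. P u *v ?d\<eta> v + ?dP v *v \<eta> u)) (at u)"
      by (rule bounded_bilinear.FDERIV[OF bounded_bilinear_matrix_vector_mult dP(2)[OF u] d\<eta>[OF u]])
    then have "((\<lambda>w. P w *v \<eta> w) has_derivative (\<lambda>v. ?dP v *v \<eta> u + P u *v ?d\<eta> v)) (at u)"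
      by (simp only: add.commute)
    from bounded_linear.has_derivative[OF bounded_linear_block_mat has_derivative_Pair[OF dP(2)[OF u] this]]
    have dR: "((\<lambda>w. block_mat (P w) (P w *v \<eta> w) 0) has_derivative
        (\<lambda>v. block_mat (?dP v) (?dP v *v \<eta> u + P u *v ?d\<eta> v) 0)) (at u)" by simp
    have "((\<lambda>w. c *\<^sub>M mat 1 + k *\<^sub>M block_mat (P w) (P w *v \<eta> w) 0) has_derivative
        (\<lambda>v. 0 + k *\<^sub>M block_mat (?dP v) (?dP v *v \<eta> u + P u *v ?d\<eta> v) 0)) (at u)"
      by (intro has_derivative_add has_derivative_const
          bounded_linear.has_derivative[OF bounded_linear_mscale] dR)
    moreover have "c *\<^sub>M mat 1 + k *\<^sub>M block_mat (P w) (P w *v \<eta> w) 0 = W w" for w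
      by (simp add: W_def vec_eq_iff all_plus_iff mat_def)
    ultimately have dW: "(W has_derivative
        (\<lambda>v. k *\<^sub>M block_mat (?dP v) (?dP v *v \<eta> u + P u *v ?d\<eta> v) 0)) (at u)"
      by (simp add: W_def[abs_def])
    let ?\<omega> = "\<lambda>v. connection_form \<zeta> (\<beta> u) (h u) v"
    have dF: "(F has_derivative (\<lambda>v. F u ** ?\<omega> v)) (at u)"
      using fr u by (simp add: unitary_frame_field_def F_def[abs_def])
    have "((\<lambda>w. T ** (F w ** W w)) has_derivative
        (\<lambda>v. T ** (F u ** (k *\<^sub>M block_mat (?dP v) (?dP v *v \<eta> u + P u *v ?d\<eta> v) 0)
          + (F u ** ?\<omega> v) ** W u))) (at u)"
      by (intro bounded_linear.has_derivative[OF bounded_bilinear.bounded_linear_right[OF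
              bounded_bilinear_matrix_mult]] bounded_bilinear.FDERIV[OF bounded_bilinear_matrix_mult] dF dW)
    moreover have "T ** (F u ** (k *\<^sub>M block_mat (?dP v) (?dP v *v \<eta> u + P u *v ?d\<eta> v) 0)
          + (F u ** ?\<omega> v) ** W u) = T ** (F u ** W u) ** connection_form \<zeta> (\<beta>1 u) (h1 u) v" for v
    proof -
      have "P u ** P u = P u" using hermitian_projectionD(1)[OF dP(1)[OF u]] .
      from gauge_identity[OF this refl refl k c, where v = v and \<beta> = "\<beta> u" and h = "h u" and \<eta> = "\<eta> u"]
      have g: "?\<omega> v ** W u + k *\<^sub>M block_mat (?dP v) (?dP v *v \<eta> u + P u *v ?d\<eta> v) 0
          = W u ** connection_form \<zeta> (\<beta>1 u) (h1 u) v"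
        by (simp only: W_def \<beta>1_def h1_def)
      have "F u ** (k *\<^sub>M block_mat (?dP v) (?dP v *v \<eta> u + P u *v ?d\<eta> v) 0) + (F u ** ?\<omega> v) ** W u
          = F u ** (?\<omega> v ** W u + k *\<^sub>M block_mat (?dP v) (?dP v *v \<eta> u + P u *v ?d\<eta> v) 0)"
        by (simp only: matrix_add_ldistrib matrix_mul_assoc add.commute)
      then show ?thesis unfolding g by (simp only: matrix_mul_assoc)
    qed
    ultimately have "((\<lambda>w. T ** (F w ** W w)) has_derivative
        (\<lambda>v. block_mat (E1 u \<zeta>) (X1 u \<zeta>) 1 ** connection_form \<zeta> (\<beta>1 u) (h1 u) v)) (at u)"
      by (simp only: F1[OF u])
    then show ?thesis
      by (rule has_derivative_transform_within_open[OF _ \<Omega> u]) (rule F1)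
  qed
  have all: "((\<lambda>u. block_mat (E1 u \<xi>) (X1 u \<xi>) 1) has_derivative
      (\<lambda>v. block_mat (E1 u \<xi>) (X1 u \<xi>) 1 ** connection_form \<xi> (\<beta>1 u) (h1 u) v)) (at u)"
    if u: "u \<in> \<Omega>" for u \<xi>
    unfolding connection_form_split[of \<xi>]
  proof (rule has_derivative_at_exceptional_parameter[OF \<Omega> u, where S = "{z, cnj z}"
        and G = "\<lambda>u \<zeta>. block_mat (E1 u \<zeta>) (X1 u \<zeta>) 1" and L = "\<lambda>v. block_mat (\<i> *\<^sub>M delta_form v) 0 0"
        and B = "\<lambda>v p. connection_form 0 (fst p) (snd p) v" and p = "\<lambda>u. (\<beta>1 u, h1 u)", unfolded fst_conv snd_conv])
    show "mat_holomorphic_on (\<lambda>\<zeta>. block_mat (E1 w \<zeta>) (X1 w \<zeta>) 1) UNIV" if "w \<in> \<Omega>" for w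
      using unitary_frame_in_Lambda_plus step[OF that] by (auto simp: Lambda_plus_iff)
    show "bounded_linear (\<lambda>v::real^'n. block_mat (\<i> *\<^sub>M delta_form v) 0 0)"
      by (rule linear_conv_bounded_linear[THEN iffD1])
        (auto simp: linear_iff vec_eq_iff all_plus_iff delta_form_def scaleR_conv_of_real[where 'a = complex] algebra_simps)
    show "bounded_bilinear (\<lambda>v (p::(complex^'n^'n) \<times> (complex^'n)). connection_form 0 (fst p) (snd p) v)"
      by (rule bounded_bilinear_connection_form_0)
    show "continuous_on \<Omega> (\<lambda>u. (\<beta>1 u, h1 u))" by (intro continuous_on_Pair cont\<beta> conth)
    show "finite {z, cnj z}" by simp
    show "((\<lambda>u. block_mat (E1 u \<zeta>) (X1 u \<zeta>) 1) has_derivative (\<lambda>v. block_mat (E1 w \<zeta>) (X1 w \<zeta>) 1 **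
        (\<zeta> *\<^sub>M block_mat (\<i> *\<^sub>M delta_form v) 0 0 + connection_form 0 (\<beta>1 w) (h1 w) v))) (at w)"
      if "w \<in> \<Omega>" "\<zeta> \<notin> {z, cnj z}" for w \<zeta>
      using off[OF that] by (simp only: connection_form_split[of \<zeta>, symmetric])
  qed
  have "unitary_frame_field \<Omega> \<beta>1 h1 E1 X1"
    unfolding unitary_frame_field_def using step herm cont\<beta> conth all by blast
  then show thesis using step that by blast
qed

section \<open>The extended frame of a flat Egoroff metric\<close>

text \<open>The mixed second derivatives \<open>La b\<close> and \<open>Lb a\<close> are both the limit of
  \<open>(\<phi>(u + sa + sb) - \<phi>(u + sa) - \<phi>(u + sb) + \<phi>(u)) / s\<^sup>2\<close>, which is symmetric in \<open>a\<close> and \<open>b\<close>. By the mean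
  value theorem this second difference is \<open>s\<close> times an increment of \<open>\<lambda>x. D x a\<close> along \<open>s b\<close>.\<close>

lemma second_difference_estimate:
  fixes \<phi> :: "'a::real_normed_vector \<Rightarrow> real"
  assumes "open \<Omega>" "u \<in> \<Omega>" and D: "\<And>x. x \<in> \<Omega> \<Longrightarrow> (\<phi> has_derivative D x) (at x)"
    and La: "((\<lambda>x. D x a) has_derivative La) (at u)" and e: "e > 0"
  obtains d where "d > 0" "\<And>s. 0 < s \<Longrightarrow> s < d \<Longrightarrow>
    \<bar>\<phi> (u + s *\<^sub>R a + s *\<^sub>R b) - \<phi> (u + s *\<^sub>R a) - \<phi> (u + s *\<^sub>R b) + \<phi> u - s\<^sup>2 * La b\<bar> \<le> e * s\<^sup>2"
proof -
  define c where "c = norm a + norm b + 1"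
  have c: "c > 0" by (simp add: c_def add_nonneg_pos)
  interpret La: bounded_linear La using La by (rule has_derivative_bounded_linear)
  have "e / (2 * c) > 0" using e c by simp
  then obtain d1 where d1: "d1 > 0"
    "\<And>y. norm (y - u) < d1 \<Longrightarrow> norm (D y a - D u a - La (y - u)) \<le> e / (2 * c) * norm (y - u)"
    using La[unfolded has_derivative_at_alt] by blast
  obtain r where r: "r > 0" "ball u r \<subseteq> \<Omega>" using assms(1,2) openE by blast
  show thesis
  proof (rule that[of "min d1 r / c"])
    show "min d1 r / c > 0" using d1 r c by simp
    fix s :: real assume s: "0 < s" "s < min d1 r / c"
    then have sc: "s * c < min d1 r" using c by (simp add: field_simps)
    have near: "norm ((u + (t * s) *\<^sub>R a + q *\<^sub>R b) - u) \<le> s * c" if "0 \<le> t" "t \<le> 1" "0 \<le> q" "q \<le> s" for t q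
    proof -
      have "norm ((t * s) *\<^sub>R a + q *\<^sub>R b) \<le> (t * s) * norm a + q * norm b"
        using norm_triangle_ineq[of "(t * s) *\<^sub>R a" "q *\<^sub>R b"] that s by simp
      also have "\<dots> \<le> s * norm a + s * norm b"
        using that s by (intro add_mono mult_right_mono) (auto simp: mult_left_le_one_le)
      also have "\<dots> \<le> s * c" using s by (simp add: c_def algebra_simps)
      finally show ?thesis by (simp add: add.assoc)
    qed
    define f where "f t = \<phi> (u + (t * s) *\<^sub>R a + s *\<^sub>R b) - \<phi> (u + (t * s) *\<^sub>R a + 0 *\<^sub>R b)" for t
    define f' where "f' t = s * (D (u + (t * s) *\<^sub>R a + s *\<^sub>R b) a - D (u + (t * s) *\<^sub>R a + 0 *\<^sub>R b) a)" for t
    have df: "DERIV f t :> f' t" if t: "0 \<le> t" "t \<le> 1" for t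
    proof -
      have one: "((\<lambda>t. \<phi> (u + (t * s) *\<^sub>R a + q *\<^sub>R b)) has_derivative
          (\<lambda>x. D (u + (t * s) *\<^sub>R a + q *\<^sub>R b) ((x * s) *\<^sub>R a))) (at t)" if q: "0 \<le> q" "q \<le> s" for q
      proof -
        have "u + (t * s) *\<^sub>R a + q *\<^sub>R b \<in> \<Omega>"
          using near[OF t q] sc r(2) by (auto simp: dist_norm norm_minus_commute subset_iff)
        moreover have "((\<lambda>t. u + (t * s) *\<^sub>R a + q *\<^sub>R b) has_derivative (\<lambda>x. (x * s) *\<^sub>R a)) (at t)"
          by (auto intro!: derivative_eq_intros)
        ultimately show ?thesis using has_derivative_compose[OF _ D] by blast
      qed
      have lin: "D x ((y * s) *\<^sub>R a) = y * s * D x a" if "x \<in> \<Omega>" for x y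
        using has_derivative_linear[OF D[OF that]] by (simp add: linear_cmul)
      have mem: "u + (t * s) *\<^sub>R a + q *\<^sub>R b \<in> \<Omega>" if "0 \<le> q" "q \<le> s" for q
        using near[OF t that] sc r(2) by (auto simp: dist_norm norm_minus_commute subset_iff)
      have "(f has_derivative (\<lambda>x. D (u + (t * s) *\<^sub>R a + s *\<^sub>R b) ((x * s) *\<^sub>R a)
          - D (u + (t * s) *\<^sub>R a + 0 *\<^sub>R b) ((x * s) *\<^sub>R a))) (at t)"
        unfolding f_def using s by (intro has_derivative_diff one) auto
      then have "(f has_derivative (\<lambda>x. f' t * x)) (at t)"
        using lin[OF mem[of s]] lin[OF mem[of 0]] s by (simp add: f'_def algebra_simps)
      then show ?thesis by (simp add: has_field_derivative_def)
    qed
    obtain t where t: "0 < t" "t < 1" "f 1 - f 0 = (1 - 0) * f' t"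
      using MVT2[of 0 1 f f'] df by auto
    let ?y1 = "u + (t * s) *\<^sub>R a + s *\<^sub>R b" and ?y0 = "u + (t * s) *\<^sub>R a + 0 *\<^sub>R b"
    have "La (?y1 - u) - La (?y0 - u) = s * La b" (is "?l = _")
      by (simp add: La.add La.scaleR algebra_simps)
    have est: "\<bar>D y a - D u a - La (y - u)\<bar> \<le> e / 2 * s" if "norm (y - u) \<le> s * c" for y
    proof -
      have "\<bar>D y a - D u a - La (y - u)\<bar> \<le> e / (2 * c) * norm (y - u)"
        using d1(2)[of y] that sc by simp
      also have "\<dots> \<le> e / (2 * c) * (s * c)" using e c that by (intro mult_left_mono) auto
      finally show ?thesis using c by simp
    qed
    have "\<bar>D ?y1 a - D u a - La (?y1 - u)\<bar> \<le> e / 2 * s" "\<bar>D ?y0 a - D u a - La (?y0 - u)\<bar> \<le> e / 2 * s"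
      by (rule est[OF near]; use t s in simp)+
    with \<open>?l = s * La b\<close> have "\<bar>(D ?y1 a - D ?y0 a) - s * La b\<bar> \<le> e * s" by linarith
    then have "s * \<bar>(D ?y1 a - D ?y0 a) - s * La b\<bar> \<le> s * (e * s)" using s by (intro mult_left_mono) auto
    then have "\<bar>s * ((D ?y1 a - D ?y0 a) - s * La b)\<bar> \<le> s * (e * s)" using s by (simp only: abs_mult abs_of_pos)
    moreover have "s * ((D ?y1 a - D ?y0 a) - s * La b) = f 1 - f 0 - s\<^sup>2 * La b"
      by (simp add: t(3) f'_def power2_eq_square algebra_simps)
    ultimately show "\<bar>\<phi> (u + s *\<^sub>R a + s *\<^sub>R b) - \<phi> (u + s *\<^sub>R a) - \<phi> (u + s *\<^sub>R b) + \<phi> u - s\<^sup>2 * La b\<bar> \<le> e * s\<^sup>2"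
      by (simp add: f_def power2_eq_square algebra_simps)
  qed
qed

lemma second_derivative_symmetric:
  fixes \<phi> :: "'a::real_normed_vector \<Rightarrow> real"
  assumes "open \<Omega>" "u \<in> \<Omega>" and D: "\<And>x. x \<in> \<Omega> \<Longrightarrow> (\<phi> has_derivative D x) (at x)"
    and La: "((\<lambda>x. D x a) has_derivative La) (at u)" and Lb: "((\<lambda>x. D x b) has_derivative Lb) (at u)"
  shows "La b = Lb a"
proof (rule ccontr)
  assume ne: "La b \<noteq> Lb a"
  define e where "e = \<bar>La b - Lb a\<bar> / 4"
  have e: "e > 0" using ne by (simp add: e_def)
  obtain d where d: "d > 0" "\<And>s. 0 < s \<Longrightarrow> s < d \<Longrightarrow>
    \<bar>\<phi> (u + s *\<^sub>R a + s *\<^sub>R b) - \<phi> (u + s *\<^sub>R a) - \<phi> (u + s *\<^sub>R b) + \<phi> u - s\<^sup>2 * La b\<bar> \<le> e * s\<^sup>2"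
    using second_difference_estimate[OF assms(1,2) D La e, of b] by blast
  obtain d' where d': "d' > 0" "\<And>s. 0 < s \<Longrightarrow> s < d' \<Longrightarrow>
    \<bar>\<phi> (u + s *\<^sub>R b + s *\<^sub>R a) - \<phi> (u + s *\<^sub>R b) - \<phi> (u + s *\<^sub>R a) + \<phi> u - s\<^sup>2 * Lb a\<bar> \<le> e * s\<^sup>2"
    using second_difference_estimate[OF assms(1,2) D Lb e, of a] by blast
  define s where "s = min d d' / 2"
  have s: "0 < s" "s < d" "s < d'" using d(1) d'(1) by (auto simp: s_def)
  have comm: "u + s *\<^sub>R b + s *\<^sub>R a = u + s *\<^sub>R a + s *\<^sub>R b" by simp
  have "\<bar>s\<^sup>2 * La b - s\<^sup>2 * Lb a\<bar> \<le> 2 * (e * s\<^sup>2)"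
    using d(2)[OF s(1,2)] d'(2)[OF s(1,3)] unfolding comm by linarith
  moreover have "s\<^sup>2 * \<bar>La b - Lb a\<bar> = \<bar>s\<^sup>2 * La b - s\<^sup>2 * Lb a\<bar>"
    unfolding right_diff_distrib[symmetric] abs_mult by simp
  ultimately have "s\<^sup>2 * \<bar>La b - Lb a\<bar> \<le> s\<^sup>2 * (2 * e)" by (simp add: mult_ac)
  then have "\<bar>La b - Lb a\<bar> \<le> 2 * e" using s(1) by simp
  then show False using e by (simp add: e_def)
qed

text \<open>Since \<open>h\<^sub>i\<^sup>2\<close> is the \<open>i\<close>-th partial derivative of the potential \<open>\<phi>\<close>, symmetry of its second
  derivatives reads \<open>2 h\<^sub>i \<partial>\<^sub>j h\<^sub>i = 2 h\<^sub>j \<partial>\<^sub>i h\<^sub>j\<close>.\<close>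

lemma rotation_coeffs_symmetric:
  fixes h :: "real^'n \<Rightarrow> real^'n"
  assumes "open \<Omega>" "u \<in> \<Omega>" and h: "flat_egoroff_metric \<Omega> h"
  shows "rotation_coeffs h u $ i $ j = rotation_coeffs h u $ j $ i"
proof -
  obtain \<phi> :: "real^'n \<Rightarrow> real" where \<phi>: "\<And>x. x \<in> \<Omega> \<Longrightarrow> \<phi> differentiable at x"
      "\<And>x i. x \<in> \<Omega> \<Longrightarrow> pderiv_at i \<phi> x = (h x $ i)\<^sup>2"
    using h unfolding flat_egoroff_metric_def by blast
  have dh: "(\<lambda>u. h u $ i) differentiable at x" if "x \<in> \<Omega>" for x i
  proof -
    have "Ck_on (Suc 0) (\<lambda>u. h u $ i) \<Omega>"
      using h unfolding flat_egoroff_metric_def smooth_on_def by blast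
    then show ?thesis using that by simp
  qed
  have D: "(\<phi> has_derivative frechet_derivative \<phi> (at x)) (at x)" if "x \<in> \<Omega>" for x
    using \<phi>(1)[OF that] by (simp add: frechet_derivative_works)
  have L: "((\<lambda>x. frechet_derivative \<phi> (at x) (axis i 1)) has_derivative
      (\<lambda>v. 2 * h u $ i * frechet_derivative (\<lambda>u. h u $ i) (at u) v)) (at u)" for i
  proof -
    have d: "((\<lambda>u. h u $ i) has_derivative frechet_derivative (\<lambda>u. h u $ i) (at u)) (at u)"
      using dh[OF assms(2)] by (simp add: frechet_derivative_works)
    have "((\<lambda>x. h x $ i * h x $ i) has_derivative
        (\<lambda>v. 2 * h u $ i * frechet_derivative (\<lambda>u. h u $ i) (at u) v)) (at u)"
      by (rule has_derivative_eq_rhs[OF has_derivative_mult[OF d d]]) (simp add: fun_eq_iff)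
    then show ?thesis
      by (rule has_derivative_transform_within_open[OF _ assms(1,2)])
        (simp add: \<phi>(2)[unfolded pderiv_at_def] power2_eq_square)
  qed
  have sym: "h u $ i * pderiv_at j (\<lambda>x. h x $ i) u = h u $ j * pderiv_at i (\<lambda>x. h x $ j) u"
    using second_derivative_symmetric[OF assms(1,2) D L[of i] L[of j]] by (simp add: pderiv_at_def)
  have "h u $ i \<noteq> 0" "h u $ j \<noteq> 0"
    using h assms(2) unfolding flat_egoroff_metric_def by blast+
  then show ?thesis using sym by (simp add: rotation_coeffs_def field_simps)
qed

text \<open>As \<open>\<beta>\<close> is real and symmetric, the frame form at \<open>cnj \<zeta>\<close> is the negative adjoint of the one at \<open>\<zeta>\<close>.
  So \<open>E(u, \<zeta>) E(u, cnj \<zeta>)\<^sup>*\<close> has derivative zero in \<open>u\<close> and keeps its initial value \<open>I\<close> on the connected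
  set \<open>\<Omega>\<close>.\<close>

lemma extended_frame_unitary_frame_field:
  fixes \<Omega> :: "(real^'n) set"
  assumes \<Omega>: "open \<Omega>" "connected \<Omega>" "0 \<in> \<Omega>" and h: "flat_egoroff_metric \<Omega> h"
    and fr: "extended_frame \<Omega> h (rotation_coeffs h) E X"
  shows "unitary_frame_field \<Omega> (\<lambda>u. cmat (rotation_coeffs h u)) (\<lambda>u. cvec (h u)) E X"
proof -
  let ?\<beta> = "\<lambda>u. cmat (rotation_coeffs h u)"
  have herm: "conj_transpose (?\<beta> u) = ?\<beta> u" if "u \<in> \<Omega>" for u
    using rotation_coeffs_symmetric[OF \<Omega>(1) that h] by (simp add: vec_eq_iff cmat_def)
  have C1: "(\<forall>x\<in>\<Omega>. (\<lambda>u. h u $ i) differentiable at x) \<and>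
      (\<forall>v. continuous_on \<Omega> (\<lambda>u. frechet_derivative (\<lambda>u. h u $ i) (at u) v))" for i
  proof -
    have "Ck_on (Suc 0) (\<lambda>u. h u $ i) \<Omega>"
      using h unfolding flat_egoroff_metric_def smooth_on_def by blast
    then show ?thesis by simp
  qed
  have conth: "continuous_on \<Omega> (\<lambda>u. h u $ i)" for i
    by (intro continuous_at_imp_continuous_on ballI differentiable_imp_continuous_within) (use C1[of i] in blast)
  have cont\<beta>: "continuous_on \<Omega> (\<lambda>u. rotation_coeffs h u $ i $ j)" for i j
  proof (cases "i = j")
    case False
    have "continuous_on \<Omega> (\<lambda>u. pderiv_at j (\<lambda>x. h x $ i) u / h u $ j)"
      using C1[of i] conth[of j] h unfolding pderiv_at_def flat_egoroff_metric_def
      by (intro continuous_on_divide) auto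
    then show ?thesis using False by (simp add: rotation_coeffs_def)
  qed (simp add: rotation_coeffs_def)
  have der: "((\<lambda>u. block_mat (E u \<zeta>) (X u \<zeta>) 1) has_derivative
        (\<lambda>v. block_mat (E u \<zeta>) (X u \<zeta>) 1 ** connection_form \<zeta> (?\<beta> u) (cvec (h u)) v)) (at u)"
    if u: "u \<in> \<Omega>" for u \<zeta>
  proof -
    let ?F = "\<lambda>u. block_mat (E u \<zeta>) (X u \<zeta>) 1"
    have l: "invertible (?F u)" "?F differentiable at u"
      "\<And>v. matrix_inv (?F u) ** frechet_derivative ?F (at u) v = connection_form \<zeta> (?\<beta> u) (cvec (h u)) v"
      using fr u unfolding extended_frame_def has_log_derivative_on_def by blast+
    have "frechet_derivative ?F (at u) v = ?F u ** connection_form \<zeta> (?\<beta> u) (cvec (h u)) v" for v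
      unfolding l(3)[symmetric] by (simp add: matrix_mul_assoc matrix_inv_mult l(1))
    then have "frechet_derivative ?F (at u) = (\<lambda>v. ?F u ** connection_form \<zeta> (?\<beta> u) (cvec (h u)) v)"
      by blast
    then show ?thesis using l(2) unfolding frechet_derivative_works by simp
  qed
  have derE: "((\<lambda>u. E u \<zeta>) has_derivative (\<lambda>v. E u \<zeta> ** frame_form \<zeta> (?\<beta> u) v)) (at u)"
    if "u \<in> \<Omega>" for u \<zeta>
    by (rule has_derivative_blocks(1)[where X = "\<lambda>u. X u \<zeta>"
          and X' = "\<lambda>v. E u \<zeta> *v (delta_form v *v cvec (h u))"])
      (use der[OF that, of \<zeta>] in \<open>simp add: connection_form_eq block_mat_mult\<close>)
  have unitary: "E u \<zeta> ** conj_transpose (E u (cnj \<zeta>)) = mat 1" if "u \<in> \<Omega>" for u \<zeta>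
  proof -
    let ?G = "\<lambda>u. E u \<zeta> ** conj_transpose (E u (cnj \<zeta>))"
    have d: "(?G has_derivative (\<lambda>v. 0)) (at u)" if u: "u \<in> \<Omega>" for u
    proof -
      have "(?G has_derivative (\<lambda>v. E u \<zeta> ** conj_transpose (E u (cnj \<zeta>) ** frame_form (cnj \<zeta>) (?\<beta> u) v)
          + (E u \<zeta> ** frame_form \<zeta> (?\<beta> u) v) ** conj_transpose (E u (cnj \<zeta>)))) (at u)"
        by (intro bounded_bilinear.FDERIV[OF bounded_bilinear_matrix_mult]
            bounded_linear.has_derivative[OF bounded_linear_conj_transpose] derE u)
      then show ?thesis
        by (simp add: conj_transpose_mult conj_transpose_frame_form[OF herm[OF u]] matrix_uminus_mult
            matrix_mul_assoc)
    qed
    have "?G constant_on \<Omega>"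
    proof (rule has_derivative_zero_connected_constant_on[OF \<Omega>(2,1) finite.emptyI])
      show "continuous_on \<Omega> ?G"
        by (intro continuous_at_imp_continuous_on ballI) (rule has_derivative_continuous[OF d])
      show "\<forall>x\<in>\<Omega> - {}. (?G has_derivative (\<lambda>v. 0)) (at x within \<Omega>)"
        using d has_derivative_at_withinI by blast
    qed
    then have "?G u = ?G 0" using that \<Omega>(3) unfolding constant_on_def by metis
    moreover have "E 0 w = mat 1" for w
      using fr unfolding extended_frame_def by (metis block_mat_mat_1 block_mat_eq_iff)
    ultimately show ?thesis by simp
  qed
  have "unitary_frame (E u) (X u)" if u: "u \<in> \<Omega>" for u
    unfolding unitary_frame_def
  proof (intro conjI allI)
    have hol: "(\<lambda>\<zeta>. block_mat (E u \<zeta>) (X u \<zeta>) 1 $ i $ j) holomorphic_on UNIV" for i j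
      using fr u unfolding extended_frame_def by blast
    show "mat_holomorphic_on (E u) UNIV"
      unfolding mat_holomorphic_on_def using hol[of "Inl _" "Inl _"] by simp
    show "(\<lambda>\<zeta>. X u \<zeta> $ i) holomorphic_on UNIV" for i using hol[of "Inl i" "Inr 1"] by simp
    show "conj_transpose (E u (cnj \<zeta>)) ** E u \<zeta> = mat 1" for \<zeta>
      using unitary[OF u] matrix_left_right_inverse by blast
  qed
  moreover have "continuous_on \<Omega> ?\<beta>" "continuous_on \<Omega> (\<lambda>u. cvec (h u))"
    unfolding cmat_def cvec_def
    by (intro continuous_on_vec_lambda continuous_on_of_real cont\<beta> conth)+
  ultimately show ?thesis
    unfolding unitary_frame_field_def using herm der by blast
qed

section \<open>Dressing by two simple elements\<close>

lemma unitary_frame_field_cong: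
  assumes "unitary_frame_field \<Omega> \<beta> h E X"
    and "\<And>u. u \<in> \<Omega> \<Longrightarrow> \<beta>' u = \<beta> u" "\<And>u. u \<in> \<Omega> \<Longrightarrow> h' u = h u"
  shows "unitary_frame_field \<Omega> \<beta>' h' E X"
proof -
  have "continuous_on \<Omega> \<beta>'" "continuous_on \<Omega> h'"
    using assms continuous_on_cong[OF refl, of \<Omega> \<beta>' \<beta>] continuous_on_cong[OF refl, of \<Omega> h' h]
    by (auto simp: unitary_frame_field_def)
  then show ?thesis using assms by (simp add: unitary_frame_field_def)
qed

lemma unitary_frame_field_log_derivative:
  assumes fr: "unitary_frame_field \<Omega> \<beta> h E X" and \<Omega>: "open \<Omega>"
    and G: "\<And>u. u \<in> \<Omega> \<Longrightarrow> G u = block_mat (E u \<zeta>) (X u \<zeta>) 1"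
  shows "has_log_derivative_on G (\<lambda>u. connection_form \<zeta> (\<beta> u) (h u)) \<Omega>"
  unfolding has_log_derivative_on_def
proof
  fix u assume u: "u \<in> \<Omega>"
  have "unitary_frame (E u) (X u)" using fr u by (simp add: unitary_frame_field_def)
  then have "invertible (E u \<zeta>)" by (rule unitary_frameD(4))
  then have inv: "invertible (G u)" unfolding G[OF u] by (rule invertible_block_mat) simp
  have "((\<lambda>u. block_mat (E u \<zeta>) (X u \<zeta>) 1) has_derivative
      (\<lambda>v. G u ** connection_form \<zeta> (\<beta> u) (h u) v)) (at u)"
    using fr u by (simp add: unitary_frame_field_def G[OF u])
  then have d: "(G has_derivative (\<lambda>v. G u ** connection_form \<zeta> (\<beta> u) (h u) v)) (at u)"
    by (rule has_derivative_transform_within_open[OF _ \<Omega> u]) (simp add: G)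
  have "frechet_derivative G (at u) = (\<lambda>v. G u ** connection_form \<zeta> (\<beta> u) (h u) v)"
    by (rule frechet_derivative_at[OF d, symmetric])
  then show "invertible (G u) \<and> G differentiable at u \<and>
      (\<forall>v. matrix_inv (G u) ** frechet_derivative G (at u) v = connection_form \<zeta> (\<beta> u) (h u) v)"
    using inv d by (auto simp: matrix_mul_assoc matrix_inv_mult differentiable_def)
qed

lemma connection_form_inject:
  fixes \<beta> \<beta>' :: "complex^'n^'n"
  assumes "\<And>v. connection_form 0 \<beta> h v = connection_form 0 \<beta>' h' v"
  shows "h = h'" and "i \<noteq> j \<Longrightarrow> \<beta> $ i $ j = \<beta>' $ i $ j"
proof -
  have eq: "delta_form v ** \<beta> - \<beta> ** delta_form v = delta_form v ** \<beta>' - \<beta>' ** delta_form v"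
      "delta_form v *v h = delta_form v *v h'" for v
    using assms[of v] by (simp_all add: connection_form_def block_mat_eq_iff)
  have "h $ i = h' $ i" for i
    using arg_cong[OF eq(2)[of "axis i 1"], of "\<lambda>x. x $ i"] by (simp add: delta_form_vector_nth axis_def)
  then show "h = h'" by (simp add: vec_eq_iff)
  assume "i \<noteq> j"
  then show "\<beta> $ i $ j = \<beta>' $ i $ j"
    using arg_cong[OF eq(1)[of "axis i 1"], of "\<lambda>A. A $ i $ j"] by (simp add: delta_form_mult_nth axis_def)
qed

text \<open>The data of the second dressing are computed from the frame \<open>E\<^sub>1\<close> obtained by the first one.
  As \<open>E\<^sub>1\<^sup>-\<^sup>1 g\<^sub>1 = g\<^sub>1' E\<^sup>-\<^sup>1\<close> with \<open>g\<^sub>1\<close>, \<open>g\<^sub>1'\<close> the simple elements of \<open>\<pi>\<^sub>1\<close> and its dressed projection, they are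
  the permuted projection and the vector \<open>\<eta>\<^sub>1\<^sub>2\<close> built from the two single dressings.\<close>

lemma second_dressing_data:
  fixes E :: "real^'n \<Rightarrow> complex \<Rightarrow> complex^'n^'n" and z1 z2 :: complex
  assumes fr: "unitary_frame (E u) (X u)" and fr1: "unitary_frame (E1 u) (X1 u)"
    and z: "z1 \<notin> \<real>" "z1 \<noteq> z2" "z1 \<noteq> cnj z2"
    and pi: "hermitian_projection \<pi>1" "hermitian_projection \<pi>2"
  defines "P1 \<equiv> dressed_projection E z1 \<pi>1 u" and "P2 \<equiv> dressed_projection E z2 \<pi>2 u"
  assumes E1: "\<And>\<zeta>. \<zeta> \<notin> {z1, cnj z1} \<Longrightarrow> E1 u \<zeta> = simple_elt z1 \<pi>1 \<zeta> ** E u \<zeta> ** simple_elt (cnj z1) P1 \<zeta>"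
    and X1: "\<And>\<zeta>. \<zeta> \<notin> {z1, cnj z1} \<Longrightarrow> X1 u \<zeta> = simple_elt (cnj z1) (mat 1 - \<pi>1) \<zeta> *v
        (X u \<zeta> - ((cnj z1 - z1) / (\<zeta> - z1)) *s ((E u \<zeta> ** P1) *v eta_vec E X z1 u))"
  shows "dressed_projection E1 z2 (permuted_projection z1 \<pi>1 z2 \<pi>2) u = permuted_projection z1 P1 z2 P2"
    and "eta_vec E1 X1 z2 u = eta_pair z1 P1 (eta_vec E X z1 u) z2 (eta_vec E X z2 u)"
proof -
  note E = unitary_frameD[OF fr] and I1 = unitary_frameD(4)[OF fr1]
  have P1: "hermitian_projection P1"
    unfolding P1_def dressed_projection_def
    by (rule hermitian_projection_onto_image(1)[OF pi(1) matrix_inv_mult(2)[OF E(4)]])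
  have zz: "z2 \<notin> {z1, cnj z1}" "cnj z2 \<notin> {z1, cnj z1}" using z by auto
  have inv: "matrix_inv (E1 u \<zeta>) ** simple_elt z1 \<pi>1 \<zeta> = simple_elt z1 P1 \<zeta> ** matrix_inv (E u \<zeta>)"
    if \<zeta>: "\<zeta> \<notin> {z1, cnj z1}" for \<zeta>
  proof -
    have "E1 u \<zeta> ** (simple_elt z1 P1 \<zeta> ** matrix_inv (E u \<zeta>))
        = simple_elt z1 \<pi>1 \<zeta> ** (E u \<zeta> ** (simple_elt (cnj z1) P1 \<zeta> ** simple_elt z1 P1 \<zeta>) ** matrix_inv (E u \<zeta>))"
      by (simp only: E1[OF \<zeta>] matrix_mul_assoc)
    also have "\<dots> = simple_elt z1 \<pi>1 \<zeta>"
      using \<zeta> simple_elt_inverse[OF P1, of \<zeta> "cnj z1"] by (simp add: matrix_inv_mult E(4))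
    finally have "matrix_inv (E1 u \<zeta>) ** simple_elt z1 \<pi>1 \<zeta>
        = matrix_inv (E1 u \<zeta>) ** (E1 u \<zeta> ** (simple_elt z1 P1 \<zeta> ** matrix_inv (E u \<zeta>)))"
      by (simp only:)
    also have "\<dots> = simple_elt z1 P1 \<zeta> ** matrix_inv (E u \<zeta>)"
      by (simp add: matrix_mul_assoc matrix_inv_mult I1)
    finally show ?thesis .
  qed
  have "mat_range (permuted_projection z1 \<pi>1 z2 \<pi>2) = (*v) (simple_elt z1 \<pi>1 z2) ` mat_range \<pi>2"
    unfolding permuted_projection_def
    using zz by (intro hermitian_projection_onto_image(4)[OF pi(2) simple_elt_inverse[OF pi(1)]]) auto
  moreover have "mat_range P2 = (*v) (matrix_inv (E u z2)) ` mat_range \<pi>2"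
    unfolding P2_def dressed_projection_def
    by (rule hermitian_projection_onto_image(4)[OF pi(2) matrix_inv_mult(2)[OF E(4)]])
  ultimately have "(*v) (matrix_inv (E1 u z2)) ` mat_range (permuted_projection z1 \<pi>1 z2 \<pi>2)
      = (*v) (simple_elt z1 P1 z2) ` mat_range P2"
    by (simp only: image_image matrix_vector_mul_assoc matrix_mul_assoc inv[OF zz(1)])
  then show "dressed_projection E1 z2 (permuted_projection z1 \<pi>1 z2 \<pi>2) u = permuted_projection z1 P1 z2 P2"
    by (simp only: dressed_projection_def permuted_projection_def)
  let ?\<zeta> = "cnj z2" and ?e1 = "eta_vec E X z1 u" and ?e2 = "eta_vec E X z2 u"
  let ?S = "simple_elt (cnj z1) (mat 1 - P1) ?\<zeta>" and ?s = "(cnj z1 - z1) / (?\<zeta> - z1)"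
  have nz: "?\<zeta> \<noteq> z1" "?\<zeta> \<noteq> cnj z1" using zz by auto
  have "matrix_inv (E1 u ?\<zeta>) ** simple_elt (cnj z1) (mat 1 - \<pi>1) ?\<zeta> = ?S ** matrix_inv (E u ?\<zeta>)"
    by (simp only: simple_elt_complement[OF nz] mscale_mult inv[OF zz(2)])
  then have "eta_vec E1 X1 z2 u = (?S ** matrix_inv (E u ?\<zeta>)) *v (X u ?\<zeta> - ?s *s ((E u ?\<zeta> ** P1) *v ?e1))"
    by (simp only: eta_vec_def X1[OF zz(2)] matrix_vector_mul_assoc)
  also have "\<dots> = ?S *v (?e2 - ?s *s (P1 *v ?e1))"
  proof -
    have "matrix_inv (E u ?\<zeta>) *v ((E u ?\<zeta> ** P1) *v ?e1) = P1 *v ?e1"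
      by (simp add: matrix_vector_mul_assoc matrix_mul_assoc matrix_inv_mult E(4))
    then have "matrix_inv (E u ?\<zeta>) *v (X u ?\<zeta> - ?s *s ((E u ?\<zeta> ** P1) *v ?e1)) = ?e2 - ?s *s (P1 *v ?e1)"
      by (simp only: matrix_vector_mult_diff_distrib vector_scalar_commute eta_vec_def)
    then show ?thesis by (simp only: matrix_vector_mul_assoc[symmetric])
  qed
  also have "\<dots> = eta_pair z1 P1 ?e1 z2 ?e2"
  proof -
    have "?S ** P1 = ((?\<zeta> - z1) / (?\<zeta> - cnj z1)) *\<^sub>M P1"
      using hermitian_projectionD[OF P1] by (simp add: simple_elt_def matrix_expand)
    then have "?S *v (P1 *v ?e1) = ((?\<zeta> - z1) / (?\<zeta> - cnj z1)) *s (P1 *v ?e1)"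
      by (simp add: matrix_vector_mul_assoc mscale_vector)
    then have "?S *v (?e2 - ?s *s (P1 *v ?e1))
        = ?S *v ?e2 - (?s * ((?\<zeta> - z1) / (?\<zeta> - cnj z1))) *s (P1 *v ?e1)"
      by (simp only: matrix_vector_mult_diff_distrib vector_scalar_commute vector_smult_assoc)
    also have "?s * ((?\<zeta> - z1) / (?\<zeta> - cnj z1)) = - ((cnj z1 - z1) / (cnj z1 - ?\<zeta>))"
    proof -
      have "?s * ((?\<zeta> - z1) / (?\<zeta> - cnj z1)) = (cnj z1 - z1) / (?\<zeta> - cnj z1)" using nz by simp
      also have "\<dots> = - ((cnj z1 - z1) / (cnj z1 - ?\<zeta>))"
        by (metis minus_diff_eq minus_divide_right)
      finally show ?thesis .
    qed
    finally show ?thesis by (simp only: eta_pair_def vector_smult_lneg diff_minus_eq_add)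
  qed
  finally show "eta_vec E1 X1 z2 u = eta_pair z1 P1 ?e1 z2 ?e2" .
qed

theorem dressing_frame_field_twice:
  fixes E :: "real^'n \<Rightarrow> complex \<Rightarrow> complex^'n^'n"
  assumes fr: "unitary_frame_field \<Omega> \<beta> h E X" and \<Omega>: "open \<Omega>"
    and z: "z1 \<notin> \<real>" "z2 \<notin> \<real>" "z1 \<noteq> z2" "z1 \<noteq> cnj z2"
    and pi: "hermitian_projection \<pi>1" "hermitian_projection \<pi>2"
  defines "\<rho>2 \<equiv> permuted_projection z1 \<pi>1 z2 \<pi>2"
    and "P1 \<equiv> dressed_projection E z1 \<pi>1" and "P2 \<equiv> dressed_projection E z2 \<pi>2"
    and "\<eta>1 \<equiv> eta_vec E X z1" and "\<eta>2 \<equiv> eta_vec E X z2"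
  defines "R2 \<equiv> \<lambda>u. permuted_projection z1 (P1 u) z2 (P2 u)"
    and "\<eta>12 \<equiv> \<lambda>u. eta_pair z1 (P1 u) (\<eta>1 u) z2 (\<eta>2 u)"
  obtains E1 X1 E12 X12 where
    "\<And>u. u \<in> \<Omega> \<Longrightarrow> is_dressing (simple_elt_ext z1 \<pi>1) (\<lambda>\<zeta>. block_mat (E u \<zeta>) (X u \<zeta>) 1)
        (\<lambda>\<zeta>. block_mat (E1 u \<zeta>) (X1 u \<zeta>) 1)"
    "\<And>u. u \<in> \<Omega> \<Longrightarrow> is_dressing (simple_elt_ext z2 \<rho>2) (\<lambda>\<zeta>. block_mat (E1 u \<zeta>) (X1 u \<zeta>) 1)
        (\<lambda>\<zeta>. block_mat (E12 u \<zeta>) (X12 u \<zeta>) 1)"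
    "unitary_frame_field \<Omega>
      (\<lambda>u. \<beta> u + (\<i> * (z1 - cnj z1)) *\<^sub>M off_diag (P1 u) + (\<i> * (z2 - cnj z2)) *\<^sub>M off_diag (R2 u))
      (\<lambda>u. h u + (\<i> * (z1 - cnj z1)) *s (P1 u *v \<eta>1 u) + (\<i> * (z2 - cnj z2)) *s (R2 u *v \<eta>12 u)) E12 X12"
    "\<And>u \<zeta>. u \<in> \<Omega> \<Longrightarrow> \<zeta> \<notin> {z1, z2, cnj z1, cnj z2} \<Longrightarrow> X12 u \<zeta> =
      (simple_elt (cnj z2) (mat 1 - \<rho>2) \<zeta> ** simple_elt (cnj z1) (mat 1 - \<pi>1) \<zeta>) *v
        (X u \<zeta> - ((cnj z1 - z1) / (\<zeta> - z1)) *s ((E u \<zeta> ** P1 u) *v \<eta>1 u)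
               - ((cnj z2 - z2) / (\<zeta> - z2)) *s
                   ((E u \<zeta> ** simple_elt z1 (mat 1 - P1 u) \<zeta> ** R2 u) *v \<eta>12 u))"
proof -
  have z': "z2 \<noteq> z1" "z2 \<noteq> cnj z1" using z by auto
  have \<rho>2: "hermitian_projection \<rho>2"
    unfolding \<rho>2_def by (rule permuted_projection_props(1)[OF pi(2,1) z'])
  obtain E1 X1 where fr1: "unitary_frame_field \<Omega> (\<lambda>u. \<beta> u + (\<i> * (z1 - cnj z1)) *\<^sub>M off_diag (P1 u))
        (\<lambda>u. h u + (\<i> * (z1 - cnj z1)) *s (P1 u *v \<eta>1 u)) E1 X1"
      and d1: "\<And>u. u \<in> \<Omega> \<Longrightarrow> is_dressing (simple_elt_ext z1 \<pi>1) (\<lambda>\<zeta>. block_mat (E u \<zeta>) (X u \<zeta>) 1)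
        (\<lambda>\<zeta>. block_mat (E1 u \<zeta>) (X1 u \<zeta>) 1)"
      and E1: "\<And>u \<zeta>. u \<in> \<Omega> \<Longrightarrow> \<zeta> \<notin> {z1, cnj z1} \<Longrightarrow>
        E1 u \<zeta> = simple_elt z1 \<pi>1 \<zeta> ** E u \<zeta> ** simple_elt (cnj z1) (P1 u) \<zeta>"
      and X1: "\<And>u \<zeta>. u \<in> \<Omega> \<Longrightarrow> \<zeta> \<notin> {z1, cnj z1} \<Longrightarrow> X1 u \<zeta> = simple_elt (cnj z1) (mat 1 - \<pi>1) \<zeta> *v
        (X u \<zeta> - ((cnj z1 - z1) / (\<zeta> - z1)) *s ((E u \<zeta> ** P1 u) *v \<eta>1 u))"
    unfolding P1_def \<eta>1_def by (rule dressing_frame_field[OF fr \<Omega> z(1) pi(1)]) blast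
  have data: "dressed_projection E1 z2 \<rho>2 u = R2 u" "eta_vec E1 X1 z2 u = \<eta>12 u" if u: "u \<in> \<Omega>" for u
  proof -
    have f: "unitary_frame (E u) (X u)" "unitary_frame (E1 u) (X1 u)"
      using fr fr1 u by (simp_all add: unitary_frame_field_def)
    note s = second_dressing_data[where E = E and X = X and ?E1.0 = E1 and ?X1.0 = X1 and u = u, OF f z(1,3,4) pi, folded P1_def P2_def \<eta>1_def \<eta>2_def, OF E1[OF u] X1[OF u]]
    show "dressed_projection E1 z2 \<rho>2 u = R2 u" "eta_vec E1 X1 z2 u = \<eta>12 u"
      using s by (simp_all add: \<rho>2_def R2_def \<eta>12_def)
  qed
  obtain E12 X12 where fr12: "unitary_frame_field \<Omega>
        (\<lambda>u. \<beta> u + (\<i> * (z1 - cnj z1)) *\<^sub>M off_diag (P1 u)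
          + (\<i> * (z2 - cnj z2)) *\<^sub>M off_diag (dressed_projection E1 z2 \<rho>2 u))
        (\<lambda>u. h u + (\<i> * (z1 - cnj z1)) *s (P1 u *v \<eta>1 u)
          + (\<i> * (z2 - cnj z2)) *s (dressed_projection E1 z2 \<rho>2 u *v eta_vec E1 X1 z2 u)) E12 X12"
      and d12: "\<And>u. u \<in> \<Omega> \<Longrightarrow> is_dressing (simple_elt_ext z2 \<rho>2) (\<lambda>\<zeta>. block_mat (E1 u \<zeta>) (X1 u \<zeta>) 1)
        (\<lambda>\<zeta>. block_mat (E12 u \<zeta>) (X12 u \<zeta>) 1)"
      and X12: "\<And>u \<zeta>. u \<in> \<Omega> \<Longrightarrow> \<zeta> \<notin> {z2, cnj z2} \<Longrightarrow> X12 u \<zeta> = simple_elt (cnj z2) (mat 1 - \<rho>2) \<zeta> *v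
        (X1 u \<zeta> - ((cnj z2 - z2) / (\<zeta> - z2)) *s
          ((E1 u \<zeta> ** dressed_projection E1 z2 \<rho>2 u) *v eta_vec E1 X1 z2 u))"
    by (rule dressing_frame_field[OF fr1 \<Omega> z(2) \<rho>2]) blast
  have "unitary_frame_field \<Omega>
      (\<lambda>u. \<beta> u + (\<i> * (z1 - cnj z1)) *\<^sub>M off_diag (P1 u) + (\<i> * (z2 - cnj z2)) *\<^sub>M off_diag (R2 u))
      (\<lambda>u. h u + (\<i> * (z1 - cnj z1)) *s (P1 u *v \<eta>1 u) + (\<i> * (z2 - cnj z2)) *s (R2 u *v \<eta>12 u)) E12 X12"
    by (rule unitary_frame_field_cong[OF fr12]) (simp_all add: data)
  moreover have "X12 u \<zeta> =
      (simple_elt (cnj z2) (mat 1 - \<rho>2) \<zeta> ** simple_elt (cnj z1) (mat 1 - \<pi>1) \<zeta>) *v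
        (X u \<zeta> - ((cnj z1 - z1) / (\<zeta> - z1)) *s ((E u \<zeta> ** P1 u) *v \<eta>1 u)
               - ((cnj z2 - z2) / (\<zeta> - z2)) *s
                   ((E u \<zeta> ** simple_elt z1 (mat 1 - P1 u) \<zeta> ** R2 u) *v \<eta>12 u))"
    if u: "u \<in> \<Omega>" and \<zeta>: "\<zeta> \<notin> {z1, z2, cnj z1, cnj z2}" for u \<zeta>
  proof -
    let ?g = "simple_elt (cnj z1) (mat 1 - \<pi>1) \<zeta>"
    have \<zeta>1: "\<zeta> \<notin> {z1, cnj z1}" and \<zeta>2: "\<zeta> \<notin> {z2, cnj z2}" using \<zeta> by auto
    have nz: "\<zeta> \<noteq> z1" "\<zeta> \<noteq> cnj z1" "\<zeta> - z1 \<noteq> 0" "\<zeta> - cnj z1 \<noteq> 0" using \<zeta>1 by auto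
    \<comment> \<open>the scalar factors of the two complementary simple elements are inverse to each other\<close>
    have c: "simple_elt z1 (mat 1 - P1 u) \<zeta> = ((\<zeta> - cnj z1) / (\<zeta> - z1)) *\<^sub>M simple_elt (cnj z1) (P1 u) \<zeta>"
      using simple_elt_complement[of \<zeta> "cnj z1" "P1 u"] nz by simp
    have "E1 u \<zeta> = ?g ** (E u \<zeta> ** simple_elt z1 (mat 1 - P1 u) \<zeta>)"
      unfolding E1[OF u \<zeta>1] c simple_elt_complement[OF nz(1,2)] mscale_mult mscale_mscale
      using nz by (simp add: matrix_mul_assoc)
    then have "E1 u \<zeta> ** R2 u = ?g ** (E u \<zeta> ** simple_elt z1 (mat 1 - P1 u) \<zeta> ** R2 u)"
      by (simp only: matrix_mul_assoc)
    then have "(E1 u \<zeta> ** R2 u) *v \<eta>12 u = ?g *v ((E u \<zeta> ** simple_elt z1 (mat 1 - P1 u) \<zeta> ** R2 u) *v \<eta>12 u)"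
      by (simp only: matrix_vector_mul_assoc)
    then show ?thesis
      unfolding X12[OF u \<zeta>2] data[OF u] X1[OF u \<zeta>1]
      by (simp only: matrix_vector_mul_assoc[symmetric, of "simple_elt (cnj z2) (mat 1 - \<rho>2) \<zeta>"]
          matrix_vector_mult_diff_distrib[of ?g] vector_scalar_commute[of ?g])
  qed
  ultimately show thesis using that d1 d12 by blast
qed

section \<open>The dressed frames of a flat Egoroff metric\<close>

theorem theorem6p1:
  fixes \<Omega> :: "(real^'n) set"
    and h :: "real^'n \<Rightarrow> real^'n"
    and E :: "real^'n \<Rightarrow> complex \<Rightarrow> complex^'n^'n"
    and X :: "real^'n \<Rightarrow> complex \<Rightarrow> complex^'n"
    and z1 z2 :: complex
    and \<pi>1 \<pi>2 :: "complex^'n^'n"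
  defines "\<beta> \<equiv> rotation_coeffs h"
    and "F \<equiv> \<lambda>u \<zeta>. block_mat (E u \<zeta>) (X u \<zeta>) 1"
    and "\<rho>1 \<equiv> permuted_projection z2 \<pi>2 z1 \<pi>1"
    and "\<rho>2 \<equiv> permuted_projection z1 \<pi>1 z2 \<pi>2"
  defines "F1 \<equiv> \<lambda>u. dress (simple_elt_ext z1 \<pi>1) (F u)"
    and "F2 \<equiv> \<lambda>u. dress (simple_elt_ext z2 \<pi>2) (F u)"
    and "g12 \<equiv> \<lambda>\<zeta>. simple_elt_ext z2 \<rho>2 \<zeta> ** simple_elt_ext z1 \<pi>1 \<zeta>"
    and "g21 \<equiv> \<lambda>\<zeta>. simple_elt_ext z1 \<rho>1 \<zeta> ** simple_elt_ext z2 \<pi>2 \<zeta>"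
  defines "F12 \<equiv> \<lambda>u. dress g12 (F u)"
    and "F21 \<equiv> \<lambda>u. dress g21 (F u)"
  defines "\<pi>t1 \<equiv> dressed_projection E z1 \<pi>1"
    and "\<pi>t2 \<equiv> dressed_projection E z2 \<pi>2"
    and "\<eta>1 \<equiv> eta_vec E X z1"
    and "\<eta>2 \<equiv> eta_vec E X z2"
  defines "\<rho>t1 \<equiv> \<lambda>u. permuted_projection z2 (\<pi>t2 u) z1 (\<pi>t1 u)"
    and "\<rho>t2 \<equiv> \<lambda>u. permuted_projection z1 (\<pi>t1 u) z2 (\<pi>t2 u)"
    and "\<eta>12 \<equiv> \<lambda>u. eta_pair z1 (\<pi>t1 u) (\<eta>1 u) z2 (\<eta>2 u)"
    and "\<eta>21 \<equiv> \<lambda>u. eta_pair z2 (\<pi>t2 u) (\<eta>2 u) z1 (\<eta>1 u)"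
  defines "h12 \<equiv> \<lambda>u. cvec (h u) + (\<i> * (z1 - cnj z1)) *s (\<pi>t1 u *v \<eta>1 u)
                               + (\<i> * (z2 - cnj z2)) *s (\<rho>t2 u *v \<eta>12 u)"
    and "\<beta>12 \<equiv> \<lambda>u. cmat (\<beta> u) + (\<i> * (z1 - cnj z1)) *\<^sub>M off_diag (\<pi>t1 u)
                               + (\<i> * (z2 - cnj z2)) *\<^sub>M off_diag (\<rho>t2 u)"
  assumes "open \<Omega>" and "connected \<Omega>" and "simply_connected \<Omega>" and "0 \<in> \<Omega>"
    and "flat_egoroff_metric \<Omega> h"
    and "extended_frame \<Omega> h \<beta> E X"
    and "z1 \<notin> \<real>" and "z2 \<notin> \<real>" and "z1 \<noteq> z2" and "z1 \<noteq> cnj z2"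
    and "hermitian_projection \<pi>1" and "hermitian_projection \<pi>2"
  shows
    "(\<forall>\<zeta>. \<zeta> \<notin> {z1, z2} \<longrightarrow>
        simple_elt z2 \<rho>2 \<zeta> ** simple_elt z1 \<pi>1 \<zeta> = simple_elt z1 \<rho>1 \<zeta> ** simple_elt z2 \<pi>2 \<zeta>)
     \<and> (\<forall>u\<in>\<Omega>.
          dressable (simple_elt_ext z1 \<pi>1) (F u) \<and> dressable (simple_elt_ext z2 \<pi>2) (F u) \<and>
          dressable g12 (F u) \<and> dressable g21 (F u) \<and>
          dressable (simple_elt_ext z2 \<rho>2) (F1 u) \<and> dressable (simple_elt_ext z1 \<rho>1) (F2 u) \<and>
          F12 u = dress (simple_elt_ext z2 \<rho>2) (F1 u) \<and>
          F12 u = F21 u \<and>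
          F21 u = dress (simple_elt_ext z1 \<rho>1) (F2 u))
     \<and> (\<exists>E12 X12.
          (\<forall>u\<in>\<Omega>. \<forall>\<zeta>. F12 u \<zeta> = block_mat (E12 u \<zeta>) (X12 u \<zeta>) 1) \<and>
          (\<forall>u\<in>\<Omega>. \<forall>\<zeta>. \<zeta> \<notin> {z1, z2, cnj z1, cnj z2} \<longrightarrow>
             X12 u \<zeta> =
               (simple_elt (cnj z2) (mat 1 - \<rho>2) \<zeta> ** simple_elt (cnj z1) (mat 1 - \<pi>1) \<zeta>) *v
               (X u \<zeta> - ((cnj z1 - z1) / (\<zeta> - z1)) *s ((E u \<zeta> ** \<pi>t1 u) *v \<eta>1 u)
                      - ((cnj z2 - z2) / (\<zeta> - z2)) *s
                          ((E u \<zeta> ** simple_elt z1 (mat 1 - \<pi>t1 u) \<zeta> ** \<rho>t2 u) *v \<eta>12 u)) \<and>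
             X12 u \<zeta> =
               (simple_elt (cnj z1) (mat 1 - \<rho>1) \<zeta> ** simple_elt (cnj z2) (mat 1 - \<pi>2) \<zeta>) *v
               (X u \<zeta> - ((cnj z2 - z2) / (\<zeta> - z2)) *s ((E u \<zeta> ** \<pi>t2 u) *v \<eta>2 u)
                      - ((cnj z1 - z1) / (\<zeta> - z1)) *s
                          ((E u \<zeta> ** simple_elt z2 (mat 1 - \<pi>t2 u) \<zeta> ** \<rho>t1 u) *v \<eta>21 u))))
     \<and> (\<forall>\<zeta>. has_log_derivative_on (\<lambda>u. F12 u \<zeta>) (\<lambda>u. connection_form \<zeta> (\<beta>12 u) (h12 u)) \<Omega>)
     \<and> (\<forall>u\<in>\<Omega>.
          h12 u = cvec (h u) + (\<i> * (z2 - cnj z2)) *s (\<pi>t2 u *v \<eta>2 u)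
                             + (\<i> * (z1 - cnj z1)) *s (\<rho>t1 u *v \<eta>21 u) \<and>
          \<beta>12 u = cmat (\<beta> u) + (\<i> * (z2 - cnj z2)) *\<^sub>M off_diag (\<pi>t2 u)
                             + (\<i> * (z1 - cnj z1)) *\<^sub>M off_diag (\<rho>t1 u))"
proof -
  let ?B = "\<lambda>E X u \<zeta>. block_mat (E u \<zeta>) (X u \<zeta>) 1"
  have z': "z2 \<noteq> z1" "z2 \<noteq> cnj z1" using \<open>z1 \<noteq> z2\<close> \<open>z1 \<noteq> cnj z2\<close> by auto
  have fld: "unitary_frame_field \<Omega> (\<lambda>u. cmat (\<beta> u)) (\<lambda>u. cvec (h u)) E X"
    unfolding \<beta>_def
    by (rule extended_frame_unitary_frame_field)
      (use \<open>open \<Omega>\<close> \<open>connected \<Omega>\<close> \<open>0 \<in> \<Omega>\<close> \<open>flat_egoroff_metric \<Omega> h\<close> \<open>extended_frame \<Omega> h \<beta> E X\<close>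
        in \<open>simp_all add: \<beta>_def\<close>)
  obtain E1 X1 E12 X12 where d1: "\<And>u. u \<in> \<Omega> \<Longrightarrow> is_dressing (simple_elt_ext z1 \<pi>1) (F u) (?B E1 X1 u)"
    and d12: "\<And>u. u \<in> \<Omega> \<Longrightarrow> is_dressing (simple_elt_ext z2 \<rho>2) (?B E1 X1 u) (?B E12 X12 u)"
    and fld12: "unitary_frame_field \<Omega> \<beta>12 h12 E12 X12"
    and X12: "\<And>u \<zeta>. u \<in> \<Omega> \<Longrightarrow> \<zeta> \<notin> {z1, z2, cnj z1, cnj z2} \<Longrightarrow> X12 u \<zeta> =
      (simple_elt (cnj z2) (mat 1 - \<rho>2) \<zeta> ** simple_elt (cnj z1) (mat 1 - \<pi>1) \<zeta>) *v
        (X u \<zeta> - ((cnj z1 - z1) / (\<zeta> - z1)) *s ((E u \<zeta> ** \<pi>t1 u) *v \<eta>1 u)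
               - ((cnj z2 - z2) / (\<zeta> - z2)) *s
                   ((E u \<zeta> ** simple_elt z1 (mat 1 - \<pi>t1 u) \<zeta> ** \<rho>t2 u) *v \<eta>12 u))"
    unfolding F_def \<rho>2_def \<beta>12_def h12_def \<rho>t2_def \<eta>12_def \<pi>t1_def \<pi>t2_def \<eta>1_def \<eta>2_def
    by (rule dressing_frame_field_twice[OF fld \<open>open \<Omega>\<close> \<open>z1 \<notin> \<real>\<close> \<open>z2 \<notin> \<real>\<close> \<open>z1 \<noteq> z2\<close> \<open>z1 \<noteq> cnj z2\<close>
          \<open>hermitian_projection \<pi>1\<close> \<open>hermitian_projection \<pi>2\<close>]) blast
  define \<beta>21 where "\<beta>21 u = cmat (\<beta> u) + (\<i> * (z2 - cnj z2)) *\<^sub>M off_diag (\<pi>t2 u)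
      + (\<i> * (z1 - cnj z1)) *\<^sub>M off_diag (\<rho>t1 u)" for u
  define h21 where "h21 u = cvec (h u) + (\<i> * (z2 - cnj z2)) *s (\<pi>t2 u *v \<eta>2 u)
      + (\<i> * (z1 - cnj z1)) *s (\<rho>t1 u *v \<eta>21 u)" for u
  obtain E2 X2 E21 X21 where d2: "\<And>u. u \<in> \<Omega> \<Longrightarrow> is_dressing (simple_elt_ext z2 \<pi>2) (F u) (?B E2 X2 u)"
    and d21: "\<And>u. u \<in> \<Omega> \<Longrightarrow> is_dressing (simple_elt_ext z1 \<rho>1) (?B E2 X2 u) (?B E21 X21 u)"
    and fld21: "unitary_frame_field \<Omega> \<beta>21 h21 E21 X21"
    and X21: "\<And>u \<zeta>. u \<in> \<Omega> \<Longrightarrow> \<zeta> \<notin> {z2, z1, cnj z2, cnj z1} \<Longrightarrow> X21 u \<zeta> =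
      (simple_elt (cnj z1) (mat 1 - \<rho>1) \<zeta> ** simple_elt (cnj z2) (mat 1 - \<pi>2) \<zeta>) *v
        (X u \<zeta> - ((cnj z2 - z2) / (\<zeta> - z2)) *s ((E u \<zeta> ** \<pi>t2 u) *v \<eta>2 u)
               - ((cnj z1 - z1) / (\<zeta> - z1)) *s
                   ((E u \<zeta> ** simple_elt z2 (mat 1 - \<pi>t2 u) \<zeta> ** \<rho>t1 u) *v \<eta>21 u))"
    unfolding F_def \<rho>1_def \<beta>21_def[abs_def] h21_def[abs_def] \<rho>t1_def \<eta>21_def \<pi>t1_def \<pi>t2_def \<eta>1_def \<eta>2_def
    by (rule dressing_frame_field_twice[OF fld \<open>open \<Omega>\<close> \<open>z2 \<notin> \<real>\<close> \<open>z1 \<notin> \<real>\<close> z'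
          \<open>hermitian_projection \<pi>2\<close> \<open>hermitian_projection \<pi>1\<close>]) blast
  have permute: "simple_elt z2 \<rho>2 \<zeta> ** simple_elt z1 \<pi>1 \<zeta> = simple_elt z1 \<rho>1 \<zeta> ** simple_elt z2 \<pi>2 \<zeta>"
    if "\<zeta> \<notin> {z1, z2}" for \<zeta>
    unfolding \<rho>1_def \<rho>2_def
    by (rule simple_elt_permutability[OF \<open>hermitian_projection \<pi>1\<close> \<open>hermitian_projection \<pi>2\<close>
          \<open>z1 \<noteq> z2\<close> \<open>z1 \<noteq> cnj z2\<close> that])
  have "g12 \<zeta> = g21 \<zeta>" if "\<zeta> \<notin> {z1, z2}" for \<zeta>
    using permute[OF that] by (simp add: g12_def g21_def simple_elt_ext_def block_mat_mult mult.commute)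
  then have g: "\<forall>\<^sub>F \<zeta> in at_infinity. g12 \<zeta> = g21 \<zeta>"
    using eventually_at_infinity_notin_finite[of "{z1, z2}"] by (auto elim: eventually_mono)
  have dg12: "is_dressing g12 (F u) (?B E12 X12 u)" and dg21: "is_dressing g21 (F u) (?B E21 X21 u)"
    if "u \<in> \<Omega>" for u
    unfolding g12_def g21_def
    using is_dressing_compose[OF d1 d12] is_dressing_compose[OF d2 d21] that by blast+
  \<comment> \<open>\<open>g12\<close> and \<open>g21\<close> agree near infinity, which is all that the dressing action depends on\<close>
  have eq: "?B E12 X12 u = ?B E21 X21 u" if u: "u \<in> \<Omega>" for u
  proof (rule is_dressing_unique[OF dg12[OF u]])
    have "g12 \<in> Lambda_minus" using dg12[OF u] by (simp add: is_dressing_def)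
    then show "is_dressing g12 (F u) (?B E21 X21 u)" by (rule is_dressing_cong[OF dg21[OF u] g])
  qed
  have frames: "F1 u = ?B E1 X1 u" "F2 u = ?B E2 X2 u" "F12 u = ?B E12 X12 u" "F21 u = ?B E21 X21 u"
    if "u \<in> \<Omega>" for u
    unfolding F1_def F2_def F12_def F21_def
    using is_dressing_dress(2)[OF d1[OF that]] is_dressing_dress(2)[OF d2[OF that]]
      is_dressing_dress(2)[OF dg12[OF that]] is_dressing_dress(2)[OF dg21[OF that]] by simp_all
  have log: "has_log_derivative_on (\<lambda>u. F12 u \<zeta>) (\<lambda>u. connection_form \<zeta> (\<beta>12 u) (h12 u)) \<Omega>"
      "has_log_derivative_on (\<lambda>u. F12 u \<zeta>) (\<lambda>u. connection_form \<zeta> (\<beta>21 u) (h21 u)) \<Omega>" for \<zeta>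
  proof -
    show "has_log_derivative_on (\<lambda>u. F12 u \<zeta>) (\<lambda>u. connection_form \<zeta> (\<beta>12 u) (h12 u)) \<Omega>"
      by (rule unitary_frame_field_log_derivative[OF fld12 \<open>open \<Omega>\<close>]) (simp add: frames)
    have "F12 u \<zeta> = ?B E21 X21 u \<zeta>" if "u \<in> \<Omega>" for u
      using fun_cong[OF eq[OF that], of \<zeta>] frames(3)[OF that] by simp
    then show "has_log_derivative_on (\<lambda>u. F12 u \<zeta>) (\<lambda>u. connection_form \<zeta> (\<beta>21 u) (h21 u)) \<Omega>"
      by (rule unitary_frame_field_log_derivative[OF fld21 \<open>open \<Omega>\<close>])
  qed
  \<comment> \<open>one frame has been given two connection forms, so their coefficients agree; the diagonals of
    \<open>\<beta>12\<close> and \<open>\<beta>21\<close> are not seen by the commutator with \<open>\<delta>\<close>, but both equal that of \<open>\<beta>\<close>\<close>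
  have coeffs: "h12 u = h21 u" "\<beta>12 u = \<beta>21 u" if u: "u \<in> \<Omega>" for u
  proof -
    have c: "connection_form 0 (\<beta>12 u) (h12 u) v = connection_form 0 (\<beta>21 u) (h21 u) v" for v
      using log[of 0] u unfolding has_log_derivative_on_def by metis
    show "h12 u = h21 u" by (rule connection_form_inject(1)[OF c])
    have "\<beta>12 u $ i $ j = \<beta>21 u $ i $ j" for i j
    proof (cases "i = j")
      case True
      then show ?thesis by (simp add: \<beta>12_def \<beta>21_def off_diag_def)
    qed (rule connection_form_inject(2)[OF c])
    then show "\<beta>12 u = \<beta>21 u" by (simp add: vec_eq_iff)
  qed
  have "dressable (simple_elt_ext z1 \<pi>1) (F u) \<and> dressable (simple_elt_ext z2 \<pi>2) (F u) \<and>
          dressable g12 (F u) \<and> dressable g21 (F u) \<and>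
          dressable (simple_elt_ext z2 \<rho>2) (F1 u) \<and> dressable (simple_elt_ext z1 \<rho>1) (F2 u) \<and>
          F12 u = dress (simple_elt_ext z2 \<rho>2) (F1 u) \<and>
          F12 u = F21 u \<and>
          F21 u = dress (simple_elt_ext z1 \<rho>1) (F2 u)" if u: "u \<in> \<Omega>" for u
    using is_dressing_dress[OF d1[OF u]] is_dressing_dress[OF d2[OF u]] is_dressing_dress[OF d12[OF u]]
      is_dressing_dress[OF d21[OF u]] is_dressing_dress[OF dg12[OF u]] is_dressing_dress[OF dg21[OF u]]
    unfolding frames[OF u] eq[OF u] by simp
  moreover have "\<exists>E12 X12.
          (\<forall>u\<in>\<Omega>. \<forall>\<zeta>. F12 u \<zeta> = block_mat (E12 u \<zeta>) (X12 u \<zeta>) 1) \<and>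
          (\<forall>u\<in>\<Omega>. \<forall>\<zeta>. \<zeta> \<notin> {z1, z2, cnj z1, cnj z2} \<longrightarrow>
             X12 u \<zeta> =
               (simple_elt (cnj z2) (mat 1 - \<rho>2) \<zeta> ** simple_elt (cnj z1) (mat 1 - \<pi>1) \<zeta>) *v
               (X u \<zeta> - ((cnj z1 - z1) / (\<zeta> - z1)) *s ((E u \<zeta> ** \<pi>t1 u) *v \<eta>1 u)
                      - ((cnj z2 - z2) / (\<zeta> - z2)) *s
                          ((E u \<zeta> ** simple_elt z1 (mat 1 - \<pi>t1 u) \<zeta> ** \<rho>t2 u) *v \<eta>12 u)) \<and>
             X12 u \<zeta> =
               (simple_elt (cnj z1) (mat 1 - \<rho>1) \<zeta> ** simple_elt (cnj z2) (mat 1 - \<pi>2) \<zeta>) *v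
               (X u \<zeta> - ((cnj z2 - z2) / (\<zeta> - z2)) *s ((E u \<zeta> ** \<pi>t2 u) *v \<eta>2 u)
                      - ((cnj z1 - z1) / (\<zeta> - z1)) *s
                          ((E u \<zeta> ** simple_elt z2 (mat 1 - \<pi>t2 u) \<zeta> ** \<rho>t1 u) *v \<eta>21 u)))"
  proof (intro exI conjI ballI allI impI)
    fix u \<zeta> assume u: "u \<in> \<Omega>"
    show "F12 u \<zeta> = block_mat (E12 u \<zeta>) (X12 u \<zeta>) 1" by (simp add: frames(3)[OF u])
    assume \<zeta>: "\<zeta> \<notin> {z1, z2, cnj z1, cnj z2}"
    show "X12 u \<zeta> =
               (simple_elt (cnj z2) (mat 1 - \<rho>2) \<zeta> ** simple_elt (cnj z1) (mat 1 - \<pi>1) \<zeta>) *v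
               (X u \<zeta> - ((cnj z1 - z1) / (\<zeta> - z1)) *s ((E u \<zeta> ** \<pi>t1 u) *v \<eta>1 u)
                      - ((cnj z2 - z2) / (\<zeta> - z2)) *s
                          ((E u \<zeta> ** simple_elt z1 (mat 1 - \<pi>t1 u) \<zeta> ** \<rho>t2 u) *v \<eta>12 u))"
      by (rule X12[OF u \<zeta>])
    have "X12 u \<zeta> = X21 u \<zeta>" using fun_cong[OF eq[OF u], of \<zeta>] by (simp add: block_mat_eq_iff)
    moreover have "\<zeta> \<notin> {z2, z1, cnj z2, cnj z1}" using \<zeta> by blast
    ultimately show "X12 u \<zeta> =
               (simple_elt (cnj z1) (mat 1 - \<rho>1) \<zeta> ** simple_elt (cnj z2) (mat 1 - \<pi>2) \<zeta>) *v
               (X u \<zeta> - ((cnj z2 - z2) / (\<zeta> - z2)) *s ((E u \<zeta> ** \<pi>t2 u) *v \<eta>2 u)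
                      - ((cnj z1 - z1) / (\<zeta> - z1)) *s
                          ((E u \<zeta> ** simple_elt z2 (mat 1 - \<pi>t2 u) \<zeta> ** \<rho>t1 u) *v \<eta>21 u))"
      using X21[OF u] by simp
  qed
  moreover have "h12 u = cvec (h u) + (\<i> * (z2 - cnj z2)) *s (\<pi>t2 u *v \<eta>2 u)
                             + (\<i> * (z1 - cnj z1)) *s (\<rho>t1 u *v \<eta>21 u) \<and>
          \<beta>12 u = cmat (\<beta> u) + (\<i> * (z2 - cnj z2)) *\<^sub>M off_diag (\<pi>t2 u)
                             + (\<i> * (z1 - cnj z1)) *\<^sub>M off_diag (\<rho>t1 u)" if "u \<in> \<Omega>" for u
    using coeffs[OF that] by (simp add: \<beta>21_def h21_def)
  ultimately show ?thesis using permute log(1) by blast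
qed

end
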